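(* Let $\mathfrak g$ be a complex Lie algebra and let $f:\Lambda^3\mathfrak g\to\mathbb C$ be a Chevalley--Eilenberg 3-cocycle with values in the trivial module $\mathbb C$. Let $\alpha\in C^2(\mathfrak g;(U\mathfrak g^+)^\vee)$ be the 2-cocycle $$\alpha(x,g_1,g_2)=\sum_{(x)}\int_0^1 f\big(\mathrm{pr}(x^{(1)}),A_t(x^{(2)},g_1),A_t(x^{(3)},g_2)\big)\,dt\qquad(x\in U\mathfrak g^+,\ g_1,g_2\in\mathfrak g).$$ Then the Yoneda product $$0\to\mathbb C\to(U\mathfrak g)^\vee\to(U\mathfrak g^+)^\vee\oplus_\alpha\mathfrak g\to\mathfrak g\to0$$ of the short exact sequence of $\mathfrak g$-modules $0\to\mathbb C\to(U\mathfrak g)^\vee\to(U\mathfrak g^+)^\vee\to0$ with the abelian extension $(U\mathfrak g^+)^\vee\oplus_\alpha\mathfrak g$ of $\mathfrak g$ by $(U\mathfrak g^+)^\vee$ defined by $\alpha$ is a crossed module of Lie algebras whose equivalence class represents $[f]\in H^3(\mathfrak g;\mathbb C)$.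
   Context: $U\mathfrak g$ is the universal enveloping algebra, with unit $\eta$, augmentation $\varepsilon$, augmentation ideal $U\mathfrak g^+=\ker\varepsilon$, its standard Hopf algebra structure, Sweedler notation $\sum_{(x)}x^{(1)}\otimes\cdots\otimes x^{(n)}$, and convolution product $\star$ on linear endomorphisms. $(-)^\vee$ is the full linear dual; $(U\mathfrak g)^\vee$ is a left $\mathfrak g$-module by $(g\cdot\varphi)(x)=\varphi(xg)$, similarly $(U\mathfrak g^+)^\vee$. The short exact sequence is dual to $0\to U\mathfrak g^+\to U\mathfrak g\xrightarrow{\varepsilon}\mathbb C\to0$. A 2-cochain with values in $(U\mathfrak g^+)^\vee$ is identified with a linear map $U\mathfrak g^+\otimes\Lambda^2\mathfrak g\to\mathbb C$, $\alpha(x,g_1,g_2)=\alpha(g_1,g_2)(x)$. Definitions: $\mathrm{pr}=\sum_{k\ge0}\frac{(-1)^k}{k+1}(\mathrm{Id}-\eta\varepsilon)^{\star(k+1)}$ (Eulerian idempotent, with values in $\mathfrak g$); $\phi_t(x)=\sum_{n\ge0}\frac{t^n}{n!}\mathrm{pr}^{\star n}(x)\in U\mathfrak g\otimes\mathbb C[t]$; $A_t(x,g)=\sum_{(x)}\phi_{-t}(x^{(1)})\phi_t(x^{(2)}g)\in\mathfrak g\otimes\mathbb C[t]$ for $x\in U\mathfrak g$, $g\in\mathfrak g$. $f$ is extended $\mathbb C[t]$-multilinearly. A crossed module of Lie algebras is a Lie algebra homomorphism $\mu:\mathfrak m\to\mathfrak n$ with an action of $\mathfrak n$ on $\mathfrak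 m$ by derivations such that $\mu(n\cdot m)=[n,\mu(m)]$ and $\mu(m)\cdot m'=[m,m']$. For a $\mathfrak g$-module $V_3$ and $\alpha\in Z^2(\mathfrak g,V_3)$, $V_3\oplus_\alpha\mathfrak g$ has bracket $[(h,X),(h',Y)]=(X\cdot h'-Y\cdot h+\alpha(X,Y),[X,Y])$. For a short exact sequence $0\to V_1\to V_2\xrightarrow{d}V_3\to0$ of $\mathfrak g$-modules, the Yoneda product has $\mu:V_2\to V_3\oplus_\alpha\mathfrak g$, $\mu(v)=(d(v),0)$, with $V_2$ an abelian Lie algebra on which $V_3\oplus_\alpha\mathfrak g$ acts through $\mathfrak g$. The class of a crossed module with $V=\ker\mu$, $\mathfrak g=\mathrm{coker}\,\mu$ in $H^3(\mathfrak g,V)$: choose a linear section $\rho$ of $\pi:\mathfrak n\to\mathfrak g$, put $a(x,y)=[\rho(x),\rho(y)]-\rho([x,y])\in\mathrm{im}\,\mu$, choose a bilinear skew-symmetric $b:\mathfrak g\times\mathfrak g\to\mathfrak m$ with $\mu\circ b=a$; then $\gamma(x,y,z)=\sum_{\mathrm{cycl}}\big(\rho(x)\cdot b(y,z)-b([x,y],z)\big)\in V$ is a 3-cocycle whose class depends only on the equivalence class of the crossed module. The crossed module represents $[f]$ if this class equals $[f]$. *)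

theory Defs
  imports
    "HOL-Analysis.Analysis"
    "HOL-Library.Poly_Mapping"
    "HOL-Library.Function_Algebras"
    "HOL-Computational_Algebra.Polynomial"
begin

section \<open>Complex vector spaces, algebras and Lie algebras\<close>

class complex_vector = ab_group_add +
  fixes scaleC :: "complex \<Rightarrow> 'a \<Rightarrow> 'a"  (infixr \<open>*\<^sub>C\<close> 75)
  assumes scaleC_add_right: "c *\<^sub>C (x + y) = c *\<^sub>C x + c *\<^sub>C y"
    and scaleC_add_left: "(c + d) *\<^sub>C x = c *\<^sub>C x + d *\<^sub>C x"
    and scaleC_scaleC: "c *\<^sub>C (d *\<^sub>C x) = (c * d) *\<^sub>C x"
    and scaleC_one: "1 *\<^sub>C x = x"

abbreviation clinear :: "('a::complex_vector \<Rightarrow> 'b::complex_vector) \<Rightarrow> bool"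
  where "clinear \<equiv> Vector_Spaces.linear scaleC scaleC"

global_interpretation complex_vector: vector_space "scaleC :: complex \<Rightarrow> 'a \<Rightarrow> 'a::complex_vector"
  defines csubspace = complex_vector.subspace
    and cspan = complex_vector.span
  by unfold_locales (simp_all add: scaleC_add_right scaleC_add_left scaleC_scaleC scaleC_one)

text \<open>Associative unital complex algebras; the zero algebra is allowed.\<close>

class complex_algebra = complex_vector + ring + monoid_mult +
  assumes scaleC_mult_left: "(c *\<^sub>C x) * y = c *\<^sub>C (x * y)"
    and scaleC_mult_right: "x * (c *\<^sub>C y) = c *\<^sub>C (x * y)"

class complex_lie_algebra = complex_vector +
  fixes lie_bracket :: "'a \<Rightarrow> 'a \<Rightarrow> 'a"
  assumes lie_bracket_add_left: "lie_bracket (x + y) z = lie_bracket x z + lie_bracket y z"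
    and lie_bracket_add_right: "lie_bracket x (y + z) = lie_bracket x y + lie_bracket x z"
    and lie_bracket_scaleC_left: "lie_bracket (c *\<^sub>C x) y = c *\<^sub>C lie_bracket x y"
    and lie_bracket_scaleC_right: "lie_bracket x (c *\<^sub>C y) = c *\<^sub>C lie_bracket x y"
    and lie_bracket_self: "lie_bracket x x = 0"
    and lie_jacobi: "lie_bracket x (lie_bracket y z) + lie_bracket y (lie_bracket z x)
      + lie_bracket z (lie_bracket x y) = 0"

lemma clinear_iff:
  fixes f :: "'a::complex_vector \<Rightarrow> 'b::complex_vector"
  shows "clinear f \<longleftrightarrow> (\<forall>x y. f (x + y) = f x + f y) \<and> (\<forall>c x. f (c *\<^sub>C x) = c *\<^sub>C f x)"
  unfolding Vector_Spaces.linear_def module_hom_def module_hom_axioms_def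
  by (simp add: complex_vector.vector_space_axioms complex_vector.module_axioms)

lemma clinear_zero: "clinear f \<Longrightarrow> f 0 = 0"
  by (metis add_cancel_right_right clinear_iff)

lemma clinear_sum: "clinear f \<Longrightarrow> f (sum g A) = (\<Sum>a\<in>A. f (g a))"
  by (induction A rule: infinite_finite_induct) (simp_all add: clinear_zero clinear_iff)

instantiation complex :: complex_algebra
begin
definition scaleC_complex :: "complex \<Rightarrow> complex \<Rightarrow> complex"
  where [simp]: "scaleC_complex c x = c * x"
instance by standard (simp_all add: algebra_simps)
end

instantiation "fun" :: (type, complex_vector) complex_vector
begin
definition scaleC_fun :: "complex \<Rightarrow> ('a \<Rightarrow> 'b) \<Rightarrow> 'a \<Rightarrow> 'b"
  where "scaleC_fun c f = (\<lambda>x. c *\<^sub>C f x)"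
instance
  by standard (simp_all add: scaleC_fun_def fun_eq_iff scaleC_add_right scaleC_add_left
      scaleC_scaleC scaleC_one)
end

instantiation prod :: (complex_vector, complex_vector) complex_vector
begin
definition scaleC_prod :: "complex \<Rightarrow> 'a \<times> 'b \<Rightarrow> 'a \<times> 'b"
  where "scaleC_prod c p = (c *\<^sub>C fst p, c *\<^sub>C snd p)"
instance
  by standard (simp_all add: scaleC_prod_def prod_eq_iff scaleC_add_right scaleC_add_left
      scaleC_scaleC scaleC_one)
end

instantiation poly :: ("{comm_ring_1,complex_algebra}") complex_algebra
begin
definition scaleC_poly :: "complex \<Rightarrow> 'a poly \<Rightarrow> 'a poly"
  where "scaleC_poly c p = smult (c *\<^sub>C 1) p"
instance
  by standard (simp_all add: scaleC_poly_def smult_add_right smult_add_left scaleC_add_left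
      scaleC_scaleC scaleC_one scaleC_mult_left)
end

instantiation poly_mapping :: (type, complex_vector) complex_vector
begin
lift_definition scaleC_poly_mapping :: "complex \<Rightarrow> ('a \<Rightarrow>\<^sub>0 'b) \<Rightarrow> 'a \<Rightarrow>\<^sub>0 'b"
  is "\<lambda>c f k. c *\<^sub>C f k"
proof -
  fix c :: complex and f :: "'a \<Rightarrow> 'b"
  assume "finite {k. f k \<noteq> 0}"
  then show "finite {k. c *\<^sub>C f k \<noteq> 0}"
    by (rule rev_finite_subset) auto
qed
instance
  by standard (transfer; simp add: fun_eq_iff scaleC_add_right scaleC_add_left
      scaleC_scaleC scaleC_one)+
end

lemma lookup_scaleC [simp]:
  "Poly_Mapping.lookup (c *\<^sub>C p) k = c *\<^sub>C Poly_Mapping.lookup p k"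
  by transfer simp

text \<open>Linear extension to the free complex vector space on a set.\<close>

definition free_ext :: "('k \<Rightarrow> 'v::complex_vector) \<Rightarrow> ('k \<Rightarrow>\<^sub>0 complex) \<Rightarrow> 'v"
  where "free_ext h p = (\<Sum>k\<in>Poly_Mapping.keys p. Poly_Mapping.lookup p k *\<^sub>C h k)"

lemma free_ext_superset:
  assumes "finite A" "Poly_Mapping.keys p \<subseteq> A"
  shows "free_ext h p = (\<Sum>k\<in>A. Poly_Mapping.lookup p k *\<^sub>C h k)"
  unfolding free_ext_def using assms
  by (intro sum.mono_neutral_left) (auto simp: in_keys_iff)

lemma clinear_free_ext: "clinear (free_ext h)"
proof -
  have "free_ext h (p + q) = free_ext h p + free_ext h q" for p q
    using Poly_Mapping.keys_add[of p q]
    by (subst (1 2 3) free_ext_superset[where A = "Poly_Mapping.keys p \<union> Poly_Mapping.keys q"])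
      (auto simp: lookup_add scaleC_add_left sum.distrib)
  moreover have "free_ext h (c *\<^sub>C p) = c *\<^sub>C free_ext h p" for c p
    by (subst (1 2) free_ext_superset[where A = "Poly_Mapping.keys p"])
      (auto simp: in_keys_iff complex_vector.scale_sum_right scaleC_scaleC)
  ultimately show ?thesis by (simp add: clinear_iff)
qed

lemma free_ext_single [simp]: "free_ext h (Poly_Mapping.single k c) = c *\<^sub>C h k"
  by (cases "c = 0") (simp_all add: free_ext_def)

lemma free_expansion:
  "p = (\<Sum>k\<in>Poly_Mapping.keys p. Poly_Mapping.lookup p k *\<^sub>C Poly_Mapping.single k (1::complex))"
  by (rule poly_mapping_eqI) (auto simp: lookup_sum lookup_single when_def in_keys_iff
      if_distrib sum.delta cong: if_cong)

lemma free_clinear_eqI: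
  assumes "clinear F" "clinear G"
    and "\<And>k. F (Poly_Mapping.single k (1::complex)) = G (Poly_Mapping.single k 1)"
  shows "F p = G p"
proof -
  have "F p = (\<Sum>k\<in>Poly_Mapping.keys p. Poly_Mapping.lookup p k *\<^sub>C F (Poly_Mapping.single k 1))"
    by (subst free_expansion) (use assms in \<open>simp add: clinear_sum clinear_iff\<close>)
  also have "\<dots> = G p"
    by (subst (4) free_expansion) (use assms in \<open>simp add: clinear_sum clinear_iff\<close>)
  finally show ?thesis .
qed

section \<open>Tensor products over the complex numbers\<close>

definition tensor_relations :: "('a::complex_vector \<times> 'b::complex_vector \<Rightarrow>\<^sub>0 complex) set"
  where "tensor_relations =
    (let e = (\<lambda>p. Poly_Mapping.single p (1::complex)) in
      {e (a + a', b) - e (a, b) - e (a', b) | a a' b. True}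
    \<union> {e (a, b + b') - e (a, b) - e (a, b') | a b b'. True}
    \<union> {e (c *\<^sub>C a, b) - c *\<^sub>C e (a, b) | c a b. True}
    \<union> {e (a, c *\<^sub>C b) - c *\<^sub>C e (a, b) | c a b. True})"

definition tensor_rel where
  "tensor_rel p q \<longleftrightarrow> p - q \<in> cspan (tensor_relations :: ('a::complex_vector \<times> 'b::complex_vector \<Rightarrow>\<^sub>0 complex) set)"

quotient_type (overloaded) ('a, 'b) tensor = "('a::complex_vector \<times> 'b::complex_vector) \<Rightarrow>\<^sub>0 complex" / tensor_rel
proof (rule equivpI)
  show "reflp tensor_rel"
    by (simp add: reflp_def tensor_rel_def complex_vector.span_zero)
  show "symp (tensor_rel :: ('a \<times> 'b \<Rightarrow>\<^sub>0 complex) \<Rightarrow> _)"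
  proof (rule sympI, unfold tensor_rel_def)
    fix p q :: "'a \<times> 'b \<Rightarrow>\<^sub>0 complex"
    assume "p - q \<in> cspan tensor_relations"
    then have "- (p - q) \<in> cspan tensor_relations" by (rule complex_vector.span_neg)
    then show "q - p \<in> cspan tensor_relations" by simp
  qed
  show "transp (tensor_rel :: ('a \<times> 'b \<Rightarrow>\<^sub>0 complex) \<Rightarrow> _)"
  proof (rule transpI, unfold tensor_rel_def)
    fix p q r :: "'a \<times> 'b \<Rightarrow>\<^sub>0 complex"
    assume "p - q \<in> cspan tensor_relations" "q - r \<in> cspan tensor_relations"
    then have "(p - q) + (q - r) \<in> cspan tensor_relations" by (rule complex_vector.span_add)
    then show "p - r \<in> cspan tensor_relations" by simp
  qed
qed

instantiation tensor :: (complex_vector, complex_vector) complex_vector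
begin
lift_definition zero_tensor :: "('a, 'b) tensor" is 0 .
lift_definition plus_tensor :: "('a, 'b) tensor \<Rightarrow> ('a, 'b) tensor \<Rightarrow> ('a, 'b) tensor" is "(+)"
  unfolding tensor_rel_def add_diff_add by (rule complex_vector.span_add)
lift_definition minus_tensor :: "('a, 'b) tensor \<Rightarrow> ('a, 'b) tensor \<Rightarrow> ('a, 'b) tensor" is "(-)"
proof -
  fix p p' q q' :: "'a \<times> 'b \<Rightarrow>\<^sub>0 complex"
  assume "tensor_rel p p'" "tensor_rel q q'"
  moreover have eq: "(p - q) - (p' - q') = (p - p') - (q - q')" by simp
  ultimately show "tensor_rel (p - q) (p' - q')"
    unfolding tensor_rel_def eq by (blast intro: complex_vector.span_diff)
qed
lift_definition uminus_tensor :: "('a, 'b) tensor \<Rightarrow> ('a, 'b) tensor" is uminus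
  unfolding tensor_rel_def minus_diff_minus by (rule complex_vector.span_neg)
lift_definition scaleC_tensor :: "complex \<Rightarrow> ('a, 'b) tensor \<Rightarrow> ('a, 'b) tensor" is scaleC
  unfolding tensor_rel_def complex_vector.scale_right_diff_distrib[symmetric]
  by (rule complex_vector.span_scale)
instance
  by standard (transfer; simp add: tensor_rel_def complex_vector.span_zero add_ac
      scaleC_add_right scaleC_add_left scaleC_scaleC complex_vector.scale_one)+
end

lift_definition pure_tensor :: "'a::complex_vector \<Rightarrow> 'b::complex_vector \<Rightarrow> ('a, 'b) tensor"
    (infixr \<open>\<otimes>\<close> 70)
  is "\<lambda>a b. Poly_Mapping.single (a, b) 1" .

definition cbilinear :: "('a::complex_vector \<Rightarrow> 'b::complex_vector \<Rightarrow> 'c::complex_vector) \<Rightarrow> bool"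
  where "cbilinear B \<longleftrightarrow> (\<forall>a. clinear (B a)) \<and> (\<forall>b. clinear (\<lambda>a. B a b))"

lemma clinear_abs_tensor: "clinear abs_tensor"
  by (simp add: clinear_iff plus_tensor.abs_eq scaleC_tensor.abs_eq)

lemma cbilinear_pure_tensor: "cbilinear (\<otimes>)"
proof -
  have mem: "abs_tensor p = abs_tensor q" if "p - q \<in> tensor_relations" for p q :: "'a \<times> 'b \<Rightarrow>\<^sub>0 complex"
    using that by (simp add: tensor.abs_eq_iff tensor_rel_def complex_vector.span_base)
  show ?thesis
    unfolding cbilinear_def clinear_iff pure_tensor.abs_eq plus_tensor.abs_eq scaleC_tensor.abs_eq
    by (intro conjI allI mem) (simp_all add: tensor_relations_def Let_def diff_diff_eq[symmetric], blast+)
qed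

lemma tensor_obtain_rep:
  obtains p where "t = abs_tensor p"
  using Quotient3_abs_rep[OF Quotient3_tensor, of t, symmetric] by (rule that)

lemma tensor_clinear_eqI:
  assumes F: "clinear F" and G: "clinear G" and eq: "\<And>a b. F (a \<otimes> b) = G (a \<otimes> b)"
  shows "F t = G t"
proof -
  obtain p where t: "t = abs_tensor p"
    by (rule tensor_obtain_rep)
  have "(F \<circ> abs_tensor) p = (G \<circ> abs_tensor) p"
  proof (rule free_clinear_eqI)
    show "clinear (F \<circ> abs_tensor)" "clinear (G \<circ> abs_tensor)"
      using F G clinear_abs_tensor by (auto intro: Vector_Spaces.linear_compose)
    fix k :: "'a \<times> 'b"
    show "(F \<circ> abs_tensor) (Poly_Mapping.single k 1) = (G \<circ> abs_tensor) (Poly_Mapping.single k 1)"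
      using eq[of "fst k" "snd k"] by (simp add: pure_tensor.abs_eq)
  qed
  then show ?thesis by (simp add: t)
qed

text \<open>The linear map induced by a bilinear map; unspecified for other maps.\<close>

definition tensor_lift ::
    "('a::complex_vector \<Rightarrow> 'b::complex_vector \<Rightarrow> 'c::complex_vector) \<Rightarrow> ('a, 'b) tensor \<Rightarrow> 'c"
  where "tensor_lift B = (THE L. clinear L \<and> (\<forall>a b. L (a \<otimes> b) = B a b))"

lemma tensor_lift:
  assumes "cbilinear B"
  shows "clinear (tensor_lift B)" and "tensor_lift B (a \<otimes> b) = B a b"
proof -
  let ?h = "free_ext (\<lambda>(a, b). B a b)"
  have lin: "clinear ?h" by (rule clinear_free_ext)
  have B: "B (a + a') b = B a b + B a' b" "B a (b + b') = B a b + B a b'"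
    "B (c *\<^sub>C a) b = c *\<^sub>C B a b" "B a (c *\<^sub>C b) = c *\<^sub>C B a b" for a a' b b' c
    using assms by (simp_all add: cbilinear_def clinear_iff)
  have h_diff: "?h (p - q) = ?h p - ?h q" for p q
    using lin by (metis add_diff_cancel clinear_iff diff_add_cancel)
  have h_scale: "?h (c *\<^sub>C p) = c *\<^sub>C ?h p" for c p
    using lin by (simp add: clinear_iff)
  have "?h r = 0" if "r \<in> tensor_relations" for r
    using that unfolding tensor_relations_def Let_def
    by (elim UnE CollectE exE conjE) (simp_all add: h_diff h_scale B del: scaleC_complex_def)
  then have "tensor_relations \<subseteq> {r. ?h r = 0}" by blast
  moreover have "csubspace {r. ?h r = 0}"
    by (simp add: complex_vector.subspace_def clinear_zero[OF lin] h_scale lin[unfolded clinear_iff])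
  ultimately have "cspan tensor_relations \<subseteq> {r. ?h r = 0}"
    by (rule complex_vector.span_minimal)
  then have resp: "?h p = ?h q" if "tensor_rel p q" for p q
    using that h_diff[of p q] by (auto simp: tensor_rel_def)
  define L where "L t = ?h (rep_tensor t)" for t
  have L_abs: "L (abs_tensor p) = ?h p" for p
    unfolding L_def by (rule resp, unfold tensor.abs_eq_iff[symmetric])
      (rule Quotient3_abs_rep[OF Quotient3_tensor])
  have "clinear L"
    unfolding clinear_iff
  proof (intro conjI allI)
    fix s t :: "('a, 'b) tensor" and c
    obtain p where s: "s = abs_tensor p" by (rule tensor_obtain_rep)
    obtain q where t: "t = abs_tensor q" by (rule tensor_obtain_rep)
    show "L (s + t) = L s + L t" "L (c *\<^sub>C s) = c *\<^sub>C L s"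
      using lin by (simp_all only: s t plus_tensor.abs_eq scaleC_tensor.abs_eq L_abs clinear_iff)
  qed
  moreover have "L (a \<otimes> b) = B a b" for a b
    by (simp add: pure_tensor.abs_eq L_abs scaleC_one)
  ultimately have L: "clinear L \<and> (\<forall>a b. L (a \<otimes> b) = B a b)" by blast
  have "tensor_lift B = L"
    unfolding tensor_lift_def
  proof (rule the_equality)
    show "clinear L \<and> (\<forall>a b. L (a \<otimes> b) = B a b)" by (rule L)
    fix M assume M: "clinear M \<and> (\<forall>a b. M (a \<otimes> b) = B a b)"
    have "M t = L t" for t
      by (rule tensor_clinear_eqI[of M L]) (use L M in simp_all)
    then show "M = L" by (rule ext)
  qed
  with L show "clinear (tensor_lift B)" and "tensor_lift B (a \<otimes> b) = B a b" by auto
qed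


lemma cbilinearI:
  assumes "\<And>a a' b. B (a + a') b = B a b + B a' b" "\<And>a b b'. B a (b + b') = B a b + B a b'"
    and "\<And>c a b. B (c *\<^sub>C a) b = c *\<^sub>C B a b" "\<And>c a b. B a (c *\<^sub>C b) = c *\<^sub>C B a b"
  shows "cbilinear B"
  using assms by (simp add: cbilinear_def clinear_iff)

lemma cbilinearD:
  assumes "cbilinear B"
  shows "B (a + a') b = B a b + B a' b" "B a (b + b') = B a b + B a b'"
    and "B (c *\<^sub>C a) b = c *\<^sub>C B a b" "B a (c *\<^sub>C b) = c *\<^sub>C B a b"
  using assms by (simp_all add: cbilinear_def clinear_iff)

lemmas pure_tensor_bilinear = cbilinearD[OF cbilinear_pure_tensor]

definition tensor_map ::
    "('a::complex_vector \<Rightarrow> 'c::complex_vector) \<Rightarrow> ('b::complex_vector \<Rightarrow> 'd::complex_vector)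
      \<Rightarrow> ('a, 'b) tensor \<Rightarrow> ('c, 'd) tensor"
  where "tensor_map F G = tensor_lift (\<lambda>a b. F a \<otimes> G b)"

definition tensor_lmult :: "'a::complex_algebra \<Rightarrow> 'b::complex_algebra \<Rightarrow> ('a, 'b) tensor \<Rightarrow> ('a, 'b) tensor"
  where "tensor_lmult a b = tensor_lift (\<lambda>c d. (a * c) \<otimes> (b * d))"

lemma tensor_lmult:
  shows "clinear (tensor_lmult a b)" and "tensor_lmult a b (c \<otimes> d) = (a * c) \<otimes> (b * d)"
proof -
  have "cbilinear (\<lambda>c d. (a * c) \<otimes> (b * d))"
    by (rule cbilinearI) (simp_all add: pure_tensor_bilinear distrib_left scaleC_mult_right)
  then show "clinear (tensor_lmult a b)" and "tensor_lmult a b (c \<otimes> d) = (a * c) \<otimes> (b * d)"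
    unfolding tensor_lmult_def by (rule tensor_lift)+
qed

lemma clinear_add: "clinear F \<Longrightarrow> clinear G \<Longrightarrow> clinear (\<lambda>x. F x + G x)"
  by (simp add: clinear_iff scaleC_add_right add_ac)

lemma clinear_scaleC: "clinear F \<Longrightarrow> clinear (\<lambda>x. c *\<^sub>C F x)"
  by (simp add: clinear_iff scaleC_add_right scaleC_scaleC mult.commute)

lemma cbilinear_tensor_lmult: "cbilinear (\<lambda>a b. tensor_lmult a b s)"
proof (rule cbilinearI)
  fix a a' and b b' and c
  show "tensor_lmult (a + a') b s = tensor_lmult a b s + tensor_lmult a' b s"
    "tensor_lmult a (b + b') s = tensor_lmult a b s + tensor_lmult a b' s"
    by (rule tensor_clinear_eqI[OF tensor_lmult(1) clinear_add[OF tensor_lmult(1) tensor_lmult(1)]],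
        simp add: tensor_lmult(2) pure_tensor_bilinear distrib_right)+
  show "tensor_lmult (c *\<^sub>C a) b s = c *\<^sub>C tensor_lmult a b s"
    "tensor_lmult a (c *\<^sub>C b) s = c *\<^sub>C tensor_lmult a b s"
    by (rule tensor_clinear_eqI[OF tensor_lmult(1) clinear_scaleC[OF tensor_lmult(1)]],
        simp add: tensor_lmult(2) pure_tensor_bilinear scaleC_mult_left)+
qed

instantiation tensor :: (complex_algebra, complex_algebra) complex_algebra
begin

definition one_tensor :: "('a, 'b) tensor"
  where "one_tensor = 1 \<otimes> 1"

text \<open>\<^term>\<open>(a \<otimes> b) * (c \<otimes> d) = (a * c) \<otimes> (b * d)\<close>, extended bilinearly.\<close>

definition times_tensor :: "('a, 'b) tensor \<Rightarrow> ('a, 'b) tensor \<Rightarrow> ('a, 'b) tensor"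
  where "times_tensor t s = tensor_lift (\<lambda>a b. tensor_lift (\<lambda>c d. (a * c) \<otimes> (b * d)) s) t"

instance
proof
  have times: "t * s = tensor_lift (\<lambda>a b. tensor_lmult a b s) t" for t s :: "('a, 'b) tensor"
    by (simp add: times_tensor_def tensor_lmult_def)
  have linl: "clinear (\<lambda>t. t * s)" for s :: "('a, 'b) tensor"
    unfolding times by (rule tensor_lift(1)[OF cbilinear_tensor_lmult])
  have pure_left: "(a \<otimes> b) * s = tensor_lmult a b s" for a :: 'a and b :: 'b and s
    unfolding times by (rule tensor_lift(2)[OF cbilinear_tensor_lmult])
  have pure: "(a \<otimes> b) * (c \<otimes> d) = (a * c) \<otimes> (b * d)" for a c :: 'a and b d :: 'b
    by (simp add: pure_left tensor_lmult(2))
  fix r s t :: "('a, 'b) tensor" and c :: complex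
  show addl: "(r + s) * t = r * t + s * t"
    using linl[of t] by (simp add: clinear_iff)
  show scl: "(c *\<^sub>C s) * t = c *\<^sub>C (s * t)"
    using linl[of t] by (simp add: clinear_iff)
  have linr: "clinear ((*) r)" for r :: "('a, 'b) tensor"
    unfolding clinear_iff
  proof (intro conjI allI)
    fix x y :: "('a, 'b) tensor" and c
    show "r * (x + y) = r * x + r * y"
      by (rule tensor_clinear_eqI[OF linl clinear_add[OF linl linl]])
        (simp add: pure_left tensor_lmult(1)[unfolded clinear_iff])
    show "r * (c *\<^sub>C x) = c *\<^sub>C (r * x)"
      by (rule tensor_clinear_eqI[OF linl clinear_scaleC[OF linl]])
        (simp add: pure_left tensor_lmult(1)[unfolded clinear_iff])
  qed
  show "r * (s + t) = r * s + r * t" "s * (c *\<^sub>C t) = c *\<^sub>C (s * t)"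
    using linr by (simp_all add: clinear_iff)
  have lin: "x * (y + z) = x * y + x * z" "(x + y) * z = x * z + y * z"
    "d *\<^sub>C x * y = d *\<^sub>C (x * y)" "x * d *\<^sub>C y = d *\<^sub>C (x * y)"
    for x y z :: "('a, 'b) tensor" and d
    using linl[of z] linl[of y] linr[of x] by (simp_all add: clinear_iff)
  show "r * s * t = r * (s * t)"
  proof (rule tensor_clinear_eqI[where t = r])
    show "clinear (\<lambda>r. r * s * t)" "clinear (\<lambda>r. r * (s * t))"
      by (simp_all add: clinear_iff lin)
    fix a :: 'a and b :: 'b
    show "(a \<otimes> b) * s * t = (a \<otimes> b) * (s * t)"
    proof (rule tensor_clinear_eqI[where t = s])
      show "clinear (\<lambda>s. (a \<otimes> b) * s * t)" "clinear (\<lambda>s. (a \<otimes> b) * (s * t))"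
        by (simp_all add: clinear_iff lin)
      fix a' :: 'a and b' :: 'b
      show "(a \<otimes> b) * (a' \<otimes> b') * t = (a \<otimes> b) * ((a' \<otimes> b') * t)"
      proof (rule tensor_clinear_eqI[where t = t])
        show "clinear (\<lambda>t. (a \<otimes> b) * (a' \<otimes> b') * t)"
          "clinear (\<lambda>t. (a \<otimes> b) * ((a' \<otimes> b') * t))"
          by (simp_all add: clinear_iff lin)
      qed (simp add: pure mult.assoc)
    qed
  qed
  have id: "clinear (\<lambda>t::('a, 'b) tensor. t)" by (simp add: clinear_iff)
  show "1 * t = t"
    by (rule tensor_clinear_eqI[OF linr id]) (simp add: one_tensor_def pure)
  show "t * 1 = t"
    by (rule tensor_clinear_eqI[OF linl id]) (simp add: one_tensor_def pure)
qed

end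

section \<open>The universal enveloping algebra\<close>

text \<open>
  The free monoid is written additively, so that finitely supported functions on it form the free
  associative algebra under the convolution product of \<^typ>\<open>'k \<Rightarrow>\<^sub>0 complex\<close>.
\<close>

datatype 'a free_monoid = Word (letters: "'a list")

instantiation free_monoid :: (type) monoid_add
begin
definition zero_free_monoid :: "'a free_monoid"
  where "zero_free_monoid = Word []"
definition plus_free_monoid :: "'a free_monoid \<Rightarrow> 'a free_monoid \<Rightarrow> 'a free_monoid"
  where "plus_free_monoid v w = Word (letters v @ letters w)"
instance by standard (simp_all add: zero_free_monoid_def plus_free_monoid_def)
end

definition free_gen :: "'a \<Rightarrow> 'a free_monoid \<Rightarrow>\<^sub>0 complex"
  where "free_gen x = Poly_Mapping.single (Word [x]) 1"

text \<open>
  The first two families of generators turn the free algebra into the tensor algebra, the third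
  one imposes \<open>xy - yx = [x, y]\<close>. The rule \<open>mult\<close> covers scalar multiples and zero.
\<close>

inductive_set uea_ideal :: "('g::complex_lie_algebra free_monoid \<Rightarrow>\<^sub>0 complex) set" where
  additive: "free_gen (x + y) - free_gen x - free_gen y \<in> uea_ideal"
| homogeneous: "free_gen (c *\<^sub>C x) - c *\<^sub>C free_gen x \<in> uea_ideal"
| commutator: "free_gen x * free_gen y - free_gen y * free_gen x - free_gen (lie_bracket x y) \<in> uea_ideal"
| add: "p \<in> uea_ideal \<Longrightarrow> q \<in> uea_ideal \<Longrightarrow> p + q \<in> uea_ideal"
| mult: "p \<in> uea_ideal \<Longrightarrow> r * p * s \<in> uea_ideal"

lemma scaleC_eq_mult: "c *\<^sub>C p = Poly_Mapping.single 0 c * p"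
  for p :: "'k::monoid_add \<Rightarrow>\<^sub>0 complex"
proof -
  have "c *\<^sub>C p = Poly_Mapping.map ((*) c) p"
    by (rule poly_mapping_eqI) (simp add: Poly_Mapping.map.rep_eq when_def)
  then show ?thesis by (simp add: mult_map_scale_conv_mult)
qed

lemma single_zero_central: "p * Poly_Mapping.single 0 c = Poly_Mapping.single 0 c * p"
  for p :: "'k::monoid_add \<Rightarrow>\<^sub>0 complex"
proof (rule free_clinear_eqI[where p = p])
  show "clinear (\<lambda>p::'k \<Rightarrow>\<^sub>0 complex. p * Poly_Mapping.single 0 c)"
    by (simp add: clinear_iff scaleC_eq_mult distrib_right mult.assoc)
  show "clinear (\<lambda>p::'k \<Rightarrow>\<^sub>0 complex. Poly_Mapping.single 0 c * p)"
    by (simp add: clinear_iff scaleC_eq_mult distrib_left mult_single mult.commute flip: mult.assoc)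
qed (simp add: mult_single)

lemma uea_ideal_closed:
  fixes p r :: "'g::complex_lie_algebra free_monoid \<Rightarrow>\<^sub>0 complex"
  shows uea_ideal_zero: "(0 :: 'g free_monoid \<Rightarrow>\<^sub>0 complex) \<in> uea_ideal"
    and uea_ideal_lmult: "p \<in> uea_ideal \<Longrightarrow> r * p \<in> uea_ideal"
    and uea_ideal_rmult: "p \<in> uea_ideal \<Longrightarrow> p * r \<in> uea_ideal"
    and uea_ideal_uminus: "p \<in> uea_ideal \<Longrightarrow> - p \<in> uea_ideal"
    and uea_ideal_scaleC: "p \<in> uea_ideal \<Longrightarrow> c *\<^sub>C p \<in> uea_ideal"
proof -
  show "(0 :: 'g free_monoid \<Rightarrow>\<^sub>0 complex) \<in> uea_ideal"
    using uea_ideal.mult[OF uea_ideal.additive, of 0] by simp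
  have l: "r * p \<in> uea_ideal" if "p \<in> uea_ideal" for p r :: "'g free_monoid \<Rightarrow>\<^sub>0 complex"
    using uea_ideal.mult[OF that, of r 1] by simp
  then show "p \<in> uea_ideal \<Longrightarrow> r * p \<in> uea_ideal" by blast
  show "p \<in> uea_ideal \<Longrightarrow> p * r \<in> uea_ideal"
    using uea_ideal.mult[of p 1 r] by simp
  show "p \<in> uea_ideal \<Longrightarrow> - p \<in> uea_ideal"
    using l[of p "- 1"] by simp
  show "p \<in> uea_ideal \<Longrightarrow> c *\<^sub>C p \<in> uea_ideal"
    by (simp add: scaleC_eq_mult l)
qed

definition uea_rel :: "('g::complex_lie_algebra free_monoid \<Rightarrow>\<^sub>0 complex) \<Rightarrow> _ \<Rightarrow> bool"
  where "uea_rel p q \<longleftrightarrow> p - q \<in> uea_ideal"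

quotient_type (overloaded) 'g uea = "'g::complex_lie_algebra free_monoid \<Rightarrow>\<^sub>0 complex" / uea_rel
proof (rule equivpI)
  show "reflp uea_rel"
    by (simp add: reflp_def uea_rel_def uea_ideal_zero)
  show "symp (uea_rel :: ('g free_monoid \<Rightarrow>\<^sub>0 complex) \<Rightarrow> _)"
  proof (rule sympI, unfold uea_rel_def)
    fix p q :: "'g free_monoid \<Rightarrow>\<^sub>0 complex"
    assume "p - q \<in> uea_ideal"
    then have "- (p - q) \<in> uea_ideal" by (rule uea_ideal_uminus)
    then show "q - p \<in> uea_ideal" by simp
  qed
  show "transp (uea_rel :: ('g free_monoid \<Rightarrow>\<^sub>0 complex) \<Rightarrow> _)"
  proof (rule transpI, unfold uea_rel_def)
    fix p q r :: "'g free_monoid \<Rightarrow>\<^sub>0 complex"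
    assume "p - q \<in> uea_ideal" "q - r \<in> uea_ideal"
    then have "(p - q) + (q - r) \<in> uea_ideal" by (rule uea_ideal.add)
    then show "p - r \<in> uea_ideal" by simp
  qed
qed

instantiation uea :: (complex_lie_algebra) complex_algebra
begin
lift_definition zero_uea :: "'a uea" is 0 .
lift_definition one_uea :: "'a uea" is 1 .
lift_definition plus_uea :: "'a uea \<Rightarrow> 'a uea \<Rightarrow> 'a uea" is "(+)"
  unfolding uea_rel_def add_diff_add by (rule uea_ideal.add)
lift_definition uminus_uea :: "'a uea \<Rightarrow> 'a uea" is uminus
  unfolding uea_rel_def minus_diff_minus by (rule uea_ideal_uminus)
lift_definition minus_uea :: "'a uea \<Rightarrow> 'a uea \<Rightarrow> 'a uea" is "(-)"
proof -
  fix p p' q q' :: "'a free_monoid \<Rightarrow>\<^sub>0 complex"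
  assume "uea_rel p p'" "uea_rel q q'"
  moreover have eq: "(p - q) - (p' - q') = (p - p') + - (q - q')" by simp
  ultimately show "uea_rel (p - q) (p' - q')"
    unfolding uea_rel_def eq by (blast intro: uea_ideal.add uea_ideal_uminus)
qed
lift_definition times_uea :: "'a uea \<Rightarrow> 'a uea \<Rightarrow> 'a uea" is "(*)"
proof -
  fix p p' q q' :: "'a free_monoid \<Rightarrow>\<^sub>0 complex"
  assume "uea_rel p p'" "uea_rel q q'"
  moreover have eq: "p * q - p' * q' = (p - p') * q + p' * (q - q')"
    by (simp add: algebra_simps)
  ultimately show "uea_rel (p * q) (p' * q')"
    unfolding uea_rel_def eq by (blast intro: uea_ideal.add uea_ideal_lmult uea_ideal_rmult)
qed
lift_definition scaleC_uea :: "complex \<Rightarrow> 'a uea \<Rightarrow> 'a uea" is scaleC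
  unfolding uea_rel_def complex_vector.scale_right_diff_distrib[symmetric]
  by (rule uea_ideal_scaleC)
instance
proof
  fix x y z :: "'a uea" and c d :: complex
  show "x * y * z = x * (y * z)" "(x + y) * z = x * z + y * z" "x * (y + z) = x * y + x * z"
    "1 * x = x" "x * 1 = x"
    by (transfer; simp add: mult.assoc distrib_left distrib_right uea_rel_def uea_ideal_zero)+
  show "(c *\<^sub>C x) * y = c *\<^sub>C (x * y)"
    by transfer (simp add: scaleC_eq_mult mult.assoc uea_rel_def uea_ideal_zero)
  have "p * (c *\<^sub>C q) = c *\<^sub>C (p * q)" for p q :: "'a free_monoid \<Rightarrow>\<^sub>0 complex"
    unfolding scaleC_eq_mult by (metis mult.assoc single_zero_central)
  then show "x * (c *\<^sub>C y) = c *\<^sub>C (x * y)"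
    by transfer (simp add: uea_rel_def uea_ideal_zero)
qed (transfer; simp add: uea_rel_def uea_ideal_zero add_ac scaleC_add_right scaleC_add_left
      scaleC_scaleC complex_vector.scale_one)+
end

lift_definition uea_incl :: "'g::complex_lie_algebra \<Rightarrow> 'g uea" is free_gen .

definition algebra_hom :: "('a::complex_algebra \<Rightarrow> 'b::complex_algebra) \<Rightarrow> bool"
  where "algebra_hom F \<longleftrightarrow> clinear F \<and> F 1 = 1 \<and> (\<forall>x y. F (x * y) = F x * F y)"

text \<open>
  The algebra homomorphism determined by a linear map that sends brackets to commutators;
  unspecified for other maps.
\<close>

definition uea_lift :: "('g::complex_lie_algebra \<Rightarrow> 'a::complex_algebra) \<Rightarrow> 'g uea \<Rightarrow> 'a"
  where "uea_lift h = (THE F. algebra_hom F \<and> (\<forall>x. F (uea_incl x) = h x))"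

lemma uea_obtain_rep:
  obtains p where "u = abs_uea p"
  using Quotient3_abs_rep[OF Quotient3_uea, of u, symmetric] by (rule that)

lemma word_Cons_eq:
  "Poly_Mapping.single (Word (x # xs)) (1::complex) = free_gen x * Poly_Mapping.single (Word xs) 1"
  by (simp add: free_gen_def mult_single plus_free_monoid_def)

lemma uea_hom_eqI:
  assumes F: "algebra_hom F" and G: "algebra_hom G" and eq: "\<And>x. F (uea_incl x) = G (uea_incl x)"
  shows "F u = G u"
proof -
  obtain p where u: "u = abs_uea p" by (rule uea_obtain_rep)
  have words: "F (abs_uea (Poly_Mapping.single (Word xs) 1)) = G (abs_uea (Poly_Mapping.single (Word xs) 1))" for xs
  proof (induction xs)
    case Nil
    have "abs_uea (Poly_Mapping.single (Word []) 1) = (1 :: 'a uea)"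
      by (simp only: one_uea.abs_eq zero_free_monoid_def[symmetric] single_one)
    then show ?case using F G by (simp add: algebra_hom_def)
  next
    case (Cons x xs)
    then show ?case
      using F G eq[of x]
      by (simp add: word_Cons_eq algebra_hom_def uea_incl.abs_eq flip: times_uea.abs_eq)
  qed
  have lin: "clinear (\<lambda>p. H (abs_uea p))" if "algebra_hom H" for H :: "'a uea \<Rightarrow> 'b"
    using that
    by (simp add: algebra_hom_def clinear_iff flip: plus_uea.abs_eq scaleC_uea.abs_eq)
  have "F (abs_uea p) = G (abs_uea p)"
  proof (rule free_clinear_eqI[OF lin[OF F] lin[OF G]])
    fix k :: "'a free_monoid"
    show "F (abs_uea (Poly_Mapping.single k 1)) = G (abs_uea (Poly_Mapping.single k 1))"
      using words[of "letters k"] by simp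
  qed
  then show ?thesis by (simp only: u)
qed

lemma uea_lift:
  fixes h :: "'g::complex_lie_algebra \<Rightarrow> 'a::complex_algebra"
  assumes lin: "clinear h" and br: "\<And>x y. h (lie_bracket x y) = h x * h y - h y * h x"
  shows "algebra_hom (uea_lift h)" and "uea_lift h (uea_incl x) = h x"
proof -
  let ?H = "free_ext (\<lambda>w. prod_list (map h (letters w)))"
  have H: "clinear ?H" by (rule clinear_free_ext)
  have H_add: "?H (p + q) = ?H p + ?H q" and H_scale: "?H (c *\<^sub>C p) = c *\<^sub>C ?H p" for p q c
    using H by (simp_all only: clinear_iff)
  have H_diff: "?H (p - q) = ?H p - ?H q" for p q
    using H_add[of "p - q" q] by (simp add: algebra_simps)
  have H_one: "?H 1 = 1"
    by (simp only: single_one[symmetric] free_ext_single)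
      (simp add: zero_free_monoid_def complex_vector.scale_one)
  have H_gen: "?H (free_gen x) = h x" for x
    by (simp add: free_gen_def complex_vector.scale_one)
  have H_mult: "?H (p * q) = ?H p * ?H q" for p q
  proof (rule free_clinear_eqI[where p = p])
    have c: "c *\<^sub>C x * y = c *\<^sub>C (x * y)" "x * c *\<^sub>C y = c *\<^sub>C (x * y)"
      for x y :: "'g free_monoid \<Rightarrow>\<^sub>0 complex" and c
      unfolding scaleC_eq_mult by (metis mult.assoc single_zero_central)+
    show "clinear (\<lambda>p. ?H (p * q))" "clinear (\<lambda>p. ?H p * ?H q)"
      by (simp_all add: clinear_iff distrib_right H_add H_scale c scaleC_mult_left)
    fix v :: "'g free_monoid"
    show "?H (Poly_Mapping.single v 1 * q) = ?H (Poly_Mapping.single v 1) * ?H q"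
    proof (rule free_clinear_eqI[where p = q])
      show "clinear (\<lambda>q. ?H (Poly_Mapping.single v 1 * q))"
        "clinear (\<lambda>q. ?H (Poly_Mapping.single v 1) * ?H q)"
        by (simp_all add: clinear_iff distrib_left H_add H_scale c scaleC_mult_right del: free_ext_single)
    qed (simp add: mult_single plus_free_monoid_def complex_vector.scale_one)
  qed
  have ideal: "?H r = 0" if "r \<in> uea_ideal" for r
    using that
    by induction
      (use lin in \<open>simp_all add: H_add H_diff H_scale H_mult H_gen br clinear_iff\<close>)
  have resp: "?H p = ?H q" if "uea_rel p q" for p q
    using that ideal[of "p - q"] by (simp add: uea_rel_def H_diff)
  define F where "F u = ?H (rep_uea u)" for u
  have F_abs: "F (abs_uea p) = ?H p" for p
    unfolding F_def by (rule resp, unfold uea.abs_eq_iff[symmetric])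
      (rule Quotient3_abs_rep[OF Quotient3_uea])
  have F_hom: "algebra_hom F"
    unfolding algebra_hom_def clinear_iff
  proof (intro conjI allI)
    show "F 1 = 1" by (simp only: one_uea.abs_eq F_abs H_one)
    fix u v :: "'g uea" and c
    obtain p where u: "u = abs_uea p" by (rule uea_obtain_rep)
    obtain q where v: "v = abs_uea q" by (rule uea_obtain_rep)
    show "F (u + v) = F u + F v" "F (c *\<^sub>C u) = c *\<^sub>C F u" "F (u * v) = F u * F v"
      by (simp_all only: u v plus_uea.abs_eq times_uea.abs_eq scaleC_uea.abs_eq F_abs H_add H_scale H_mult)
  qed
  have F: "algebra_hom F \<and> (\<forall>x. F (uea_incl x) = h x)"
    using F_hom by (simp add: uea_incl.abs_eq F_abs H_gen)
  have "uea_lift h = F"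
    unfolding uea_lift_def
  proof (rule the_equality)
    show "algebra_hom F \<and> (\<forall>x. F (uea_incl x) = h x)" by (rule F)
    fix M assume M: "algebra_hom M \<and> (\<forall>x. M (uea_incl x) = h x)"
    have "M u = F u" for u
      by (rule uea_hom_eqI[of M F]) (use F M in simp_all)
    then show "M = F" by (rule ext)
  qed
  with F show "algebra_hom (uea_lift h)" and "uea_lift h (uea_incl x) = h x" by simp_all
qed

lemma clinear_uea_incl: "clinear uea_incl"
proof -
  have "abs_uea p = abs_uea q" if "p - q \<in> uea_ideal" for p q :: "'a free_monoid \<Rightarrow>\<^sub>0 complex"
    using that by (simp add: uea.abs_eq_iff uea_rel_def)
  note eq = this
  have "uea_incl (x + y) = uea_incl x + uea_incl y" for x y :: 'a
    unfolding uea_incl.abs_eq plus_uea.abs_eq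
    by (rule eq) (use uea_ideal.additive[of x y] in \<open>simp only: diff_diff_eq\<close>)
  moreover have "uea_incl (c *\<^sub>C x) = c *\<^sub>C uea_incl x" for x :: 'a and c
    unfolding uea_incl.abs_eq scaleC_uea.abs_eq by (rule eq) (rule uea_ideal.homogeneous)
  ultimately show ?thesis by (simp add: clinear_iff)
qed

lemma uea_incl_bracket:
  "uea_incl (lie_bracket x y) = uea_incl x * uea_incl y - uea_incl y * uea_incl x"
proof -
  have "uea_rel (free_gen x * free_gen y - free_gen y * free_gen x) (free_gen (lie_bracket x y))"
    unfolding uea_rel_def by (rule uea_ideal.commutator)
  then show ?thesis
    by (simp only: uea_incl.abs_eq times_uea.abs_eq minus_uea.abs_eq uea.abs_eq_iff[symmetric])
qed

definition counit :: "'g::complex_lie_algebra uea \<Rightarrow> complex"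
  where "counit = uea_lift (\<lambda>_. 0)"

definition comult :: "'g::complex_lie_algebra uea \<Rightarrow> ('g uea, 'g uea) tensor"
  where "comult = uea_lift (\<lambda>x. uea_incl x \<otimes> 1 + 1 \<otimes> uea_incl x)"

lemma counit: "algebra_hom counit" "counit (uea_incl x) = 0"
  unfolding counit_def by (rule uea_lift; simp add: clinear_iff)+

lemma pure_tensor_mult: "(a \<otimes> b) * (c \<otimes> d) = (a * c) \<otimes> (b * d)"
proof -
  have "(a \<otimes> b) * s = tensor_lmult a b s" for s
    using tensor_lift(2)[OF cbilinear_tensor_lmult[of s], of a b]
    by (simp add: times_tensor_def tensor_lmult_def)
  then show ?thesis by (simp add: tensor_lmult(2))
qed

lemma comult:
  fixes x :: "'g::complex_lie_algebra"
  shows "algebra_hom (comult :: 'g uea \<Rightarrow> _)" "comult (uea_incl x) = uea_incl x \<otimes> 1 + 1 \<otimes> uea_incl x"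
proof -
  let ?h = "\<lambda>x::'g. uea_incl x \<otimes> 1 + 1 \<otimes> uea_incl x"
  have lin: "clinear ?h"
    by (simp add: clinear_iff clinear_uea_incl[unfolded clinear_iff] pure_tensor_bilinear
        scaleC_add_right add_ac)
  have d: "(a - a') \<otimes> b = a \<otimes> b - a' \<otimes> b" "b \<otimes> (a - a') = b \<otimes> a - b \<otimes> a'" for a a' b :: "'g uea"
    using pure_tensor_bilinear(1)[of "a - a'" a' b] pure_tensor_bilinear(2)[of b "a - a'" a']
    by (simp_all add: eq_diff_eq)
  have br: "?h (lie_bracket x y) = ?h x * ?h y - ?h y * ?h x" for x y
    by (simp add: uea_incl_bracket pure_tensor_mult d distrib_left distrib_right)
  show "algebra_hom (comult :: 'g uea \<Rightarrow> _)" "comult (uea_incl x) = ?h x"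
    unfolding comult_def by (rule uea_lift[OF lin br])+
qed

definition comult3 :: "'g::complex_lie_algebra uea \<Rightarrow> ('g uea, ('g uea, 'g uea) tensor) tensor"
  where "comult3 x = tensor_map (\<lambda>u. u) comult (comult x)"

definition aug_ideal :: "'g::complex_lie_algebra uea set"
  where "aug_ideal = {x. counit x = 0}"

section \<open>The Eulerian idempotent and the forms \<open>A\<^sub>t\<close>\<close>

definition convolution :: "('g::complex_lie_algebra uea \<Rightarrow> 'g uea) \<Rightarrow> ('g uea \<Rightarrow> 'g uea) \<Rightarrow> 'g uea \<Rightarrow> 'g uea"
  where "convolution F G x = tensor_lift (\<lambda>a b. F a * G b) (comult x)"

primrec conv_power :: "('g::complex_lie_algebra uea \<Rightarrow> 'g uea) \<Rightarrow> nat \<Rightarrow> 'g uea \<Rightarrow> 'g uea" where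
  "conv_power F 0 = (\<lambda>x. counit x *\<^sub>C 1)"
| "conv_power F (Suc n) = convolution F (conv_power F n)"

text \<open>
  The series below are finite sums at each argument, because \<^term>\<open>\<lambda>x. x - counit x *\<^sub>C 1\<close> is locally
  nilpotent for convolution; \<^const>\<open>Sum_any\<close> sums the nonzero terms.
\<close>

definition eulerian :: "'g::complex_lie_algebra uea \<Rightarrow> 'g uea"
  where "eulerian x =
    Sum_any (\<lambda>k. ((- 1) ^ k / of_nat (k + 1)) *\<^sub>C conv_power (\<lambda>y. y - counit y *\<^sub>C 1) (k + 1) x)"

text \<open>
  The same map regarded as taking values in the Lie algebra. It uses that \<^const>\<open>uea_incl\<close> is injective
  (Poincare--Birkhoff--Witt) and that \<^const>\<open>eulerian\<close> has values in its range.
\<close>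

definition pr :: "'g::complex_lie_algebra uea \<Rightarrow> 'g"
  where "pr x = inv uea_incl (eulerian x)"

text \<open>
  For \<open>s\<close> in \<open>\<complex>[t]\<close>, \<open>phi s x\<close> is the result of substituting \<open>s\<close> for \<open>t\<close> in \<open>\<phi>\<^sub>t(x)\<close>, an element of
  the algebra \<open>U\<gg> \<otimes> \<complex>[t]\<close>; only \<open>s = t\<close> and \<open>s = -t\<close> are used.
\<close>

definition phi :: "complex poly \<Rightarrow> 'g::complex_lie_algebra uea \<Rightarrow> ('g uea, complex poly) tensor"
  where "phi s x = Sum_any (\<lambda>n. conv_power eulerian n x \<otimes> smult (1 / fact n) (s ^ n))"

definition A_form :: "'g::complex_lie_algebra uea \<Rightarrow> 'g \<Rightarrow> ('g, complex poly) tensor"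
  where "A_form x g =
    (let t = [:0, 1:] in
      inv (tensor_map uea_incl (\<lambda>p. p))
        (tensor_lift (\<lambda>x1 x2. phi (- t) x1 * phi t (x2 * uea_incl g)) (comult x)))"

definition poly_extend :: "('g::complex_lie_algebra \<Rightarrow> 'g \<Rightarrow> 'g \<Rightarrow> complex) \<Rightarrow>
    ('g, complex poly) tensor \<Rightarrow> ('g, complex poly) tensor \<Rightarrow> ('g, complex poly) tensor \<Rightarrow> complex poly"
  where "poly_extend f u v w =
    tensor_lift (\<lambda>a p. tensor_lift (\<lambda>b q. tensor_lift (\<lambda>c r. smult (f a b c) (p * q * r)) w) v) u"

definition alpha_integrand :: "('g::complex_lie_algebra \<Rightarrow> 'g \<Rightarrow> 'g \<Rightarrow> complex) \<Rightarrow> 'g \<Rightarrow> 'g \<Rightarrow> 'g uea \<Rightarrow> complex poly"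
  where "alpha_integrand f g1 g2 x =
    tensor_lift (\<lambda>x1. tensor_lift (\<lambda>x2 x3. poly_extend f (pr x1 \<otimes> 1) (A_form x2 g1) (A_form x3 g2))) (comult3 x)"

text \<open>
  A functional on a subspace is represented by its extension by zero off the subspace. In
  particular \<open>alpha f g1 g2\<close> is an element of \<open>(U\<gg>\<^sup>+)\<^sup>\<or>\<close>.
\<close>

definition alpha :: "('g::complex_lie_algebra \<Rightarrow> 'g \<Rightarrow> 'g \<Rightarrow> complex) \<Rightarrow> 'g \<Rightarrow> 'g \<Rightarrow> 'g uea \<Rightarrow> complex"
  where "alpha f g1 g2 x =
    (if x \<in> aug_ideal then integral {0..1} (\<lambda>t::real. poly (alpha_integrand f g1 g2 x) (of_real t)) else 0)"

section \<open>Lie algebras, modules and crossed modules on subspaces\<close>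

definition clinear_on :: "'a::complex_vector set \<Rightarrow> 'b::complex_vector set \<Rightarrow> ('a \<Rightarrow> 'b) \<Rightarrow> bool"
  where "clinear_on S T f \<longleftrightarrow> (\<forall>x\<in>S. f x \<in> T) \<and>
    (\<forall>x\<in>S. \<forall>y\<in>S. f (x + y) = f x + f y) \<and> (\<forall>c. \<forall>x\<in>S. f (c *\<^sub>C x) = c *\<^sub>C f x)"

definition cbilinear_on :: "'a::complex_vector set \<Rightarrow> 'b::complex_vector set \<Rightarrow> 'c::complex_vector set
    \<Rightarrow> ('a \<Rightarrow> 'b \<Rightarrow> 'c) \<Rightarrow> bool"
  where "cbilinear_on S T U B \<longleftrightarrow>
    (\<forall>x\<in>S. clinear_on T U (B x)) \<and> (\<forall>y\<in>T. clinear_on S U (\<lambda>x. B x y))"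

locale lie_algebra_on =
  fixes L :: "'l::complex_vector set" and br :: "'l \<Rightarrow> 'l \<Rightarrow> 'l"
  assumes subspace: "csubspace L"
    and bilinear: "cbilinear_on L L L br"
    and alternating: "x \<in> L \<Longrightarrow> br x x = 0"
    and jacobi: "x \<in> L \<Longrightarrow> y \<in> L \<Longrightarrow> z \<in> L \<Longrightarrow> br x (br y z) + br y (br z x) + br z (br x y) = 0"

locale lie_module_on = lie_algebra_on L br
  for L :: "'l::complex_vector set" and br :: "'l \<Rightarrow> 'l \<Rightarrow> 'l" +
  fixes V :: "'v::complex_vector set" and act :: "'l \<Rightarrow> 'v \<Rightarrow> 'v"
  assumes module_subspace: "csubspace V"
    and act_bilinear: "cbilinear_on L V V act"
    and act_bracket: "x \<in> L \<Longrightarrow> y \<in> L \<Longrightarrow> v \<in> V \<Longrightarrow> act (br x y) v = act x (act y v) - act y (act x v)"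

definition lie_hom_on :: "'l::complex_vector set \<Rightarrow> ('l \<Rightarrow> 'l \<Rightarrow> 'l) \<Rightarrow>
    'k::complex_vector set \<Rightarrow> ('k \<Rightarrow> 'k \<Rightarrow> 'k) \<Rightarrow> ('l \<Rightarrow> 'k) \<Rightarrow> bool"
  where "lie_hom_on L brL K brK h \<longleftrightarrow>
    clinear_on L K h \<and> (\<forall>x\<in>L. \<forall>y\<in>L. h (brL x y) = brK (h x) (h y))"

locale lie_crossed_module =
  M: lie_algebra_on M brM + lie_module_on N brN M act
  for M :: "'m::complex_vector set" and brM :: "'m \<Rightarrow> 'm \<Rightarrow> 'm"
    and N :: "'n::complex_vector set" and brN :: "'n \<Rightarrow> 'n \<Rightarrow> 'n"
    and act :: "'n \<Rightarrow> 'm \<Rightarrow> 'm" +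
  fixes \<mu> :: "'m \<Rightarrow> 'n"
  assumes hom: "lie_hom_on M brM N brN \<mu>"
    and derivation: "n \<in> N \<Longrightarrow> m \<in> M \<Longrightarrow> m' \<in> M \<Longrightarrow> act n (brM m m') = brM (act n m) m' + brM m (act n m')"
    and equivariant: "n \<in> N \<Longrightarrow> m \<in> M \<Longrightarrow> \<mu> (act n m) = brN n (\<mu> m)"
    and peiffer: "m \<in> M \<Longrightarrow> m' \<in> M \<Longrightarrow> act (\<mu> m) m' = brM m m'"

abbreviation g_module :: "'v::complex_vector set \<Rightarrow> ('g::complex_lie_algebra \<Rightarrow> 'v \<Rightarrow> 'v) \<Rightarrow> bool"
  where "g_module \<equiv> lie_module_on UNIV lie_bracket"

definition short_exact :: "'a::complex_vector set \<Rightarrow> ('a \<Rightarrow> 'b) \<Rightarrow> 'b::complex_vector set \<Rightarrow> ('b \<Rightarrow> 'c)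
    \<Rightarrow> 'c::complex_vector set \<Rightarrow> bool"
  where "short_exact A i B d C \<longleftrightarrow> clinear_on A B i \<and> clinear_on B C d \<and>
    inj_on i A \<and> i ` A = {b \<in> B. d b = 0} \<and> d ` B = C"

definition g_module_short_exact ::
    "'a::complex_vector set \<Rightarrow> ('g::complex_lie_algebra \<Rightarrow> 'a \<Rightarrow> 'a) \<Rightarrow> ('a \<Rightarrow> 'b)
      \<Rightarrow> 'b::complex_vector set \<Rightarrow> ('g \<Rightarrow> 'b \<Rightarrow> 'b) \<Rightarrow> ('b \<Rightarrow> 'c)
      \<Rightarrow> 'c::complex_vector set \<Rightarrow> ('g \<Rightarrow> 'c \<Rightarrow> 'c) \<Rightarrow> bool"
  where "g_module_short_exact A actA i B actB d C actC \<longleftrightarrow>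
    g_module A actA \<and> g_module B actB \<and> g_module C actC \<and> short_exact A i B d C \<and>
    (\<forall>g. \<forall>a\<in>A. i (actA g a) = actB g (i a)) \<and> (\<forall>g. \<forall>b\<in>B. d (actB g b) = actC g (d b))"

text \<open>
  An exact sequence \<open>0 \<rightarrow> V \<rightarrow> M \<rightarrow> N \<rightarrow> \<gg> \<rightarrow> 0\<close> with maps \<open>i\<close>, \<open>\<mu>\<close>, \<open>\<pi>\<close> whose middle map is a crossed module
  with kernel \<open>V\<close> and cokernel \<open>\<gg>\<close>, inducing the given action on \<open>V\<close>.
\<close>

locale crossed_extension =
  lie_crossed_module M brM N brN act \<mu> + V: lie_module_on UNIV lie_bracket V actV
  for V :: "'v::complex_vector set" and actV :: "'g::complex_lie_algebra \<Rightarrow> 'v \<Rightarrow> 'v"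
    and i :: "'v \<Rightarrow> 'm::complex_vector"
    and M :: "'m set" and brM :: "'m \<Rightarrow> 'm \<Rightarrow> 'm" and \<mu> :: "'m \<Rightarrow> 'n::complex_vector"
    and N :: "'n set" and brN :: "'n \<Rightarrow> 'n \<Rightarrow> 'n" and act :: "'n \<Rightarrow> 'm \<Rightarrow> 'm"
    and \<pi> :: "'n \<Rightarrow> 'g" +
  assumes i_linear: "clinear_on V M i"
    and i_inj: "inj_on i V"
    and exact_M: "i ` V = {m \<in> M. \<mu> m = 0}"
    and exact_N: "\<mu> ` M = {n \<in> N. \<pi> n = 0}"
    and \<pi>_hom: "lie_hom_on N brN UNIV lie_bracket \<pi>"
    and \<pi>_surj: "\<pi> ` N = UNIV"
    and induced_action: "n \<in> N \<Longrightarrow> v \<in> V \<Longrightarrow> i (actV (\<pi> n) v) = act n (i v)"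

section \<open>Chevalley--Eilenberg cochains in degrees two and three\<close>

definition ce_C2 :: "'v::complex_vector set \<Rightarrow> ('g::complex_lie_algebra \<Rightarrow> 'g \<Rightarrow> 'v) set"
  where "ce_C2 V = {b. cbilinear_on UNIV UNIV V b \<and> (\<forall>x. b x x = 0)}"

definition ce_C3 :: "'v::complex_vector set \<Rightarrow> ('g::complex_lie_algebra \<Rightarrow> 'g \<Rightarrow> 'g \<Rightarrow> 'v) set"
  where "ce_C3 V = {c. (\<forall>x. cbilinear_on UNIV UNIV V (c x)) \<and> (\<forall>y z. clinear_on UNIV V (\<lambda>x. c x y z)) \<and>
    (\<forall>x y. c x x y = 0 \<and> c x y y = 0 \<and> c x y x = 0)}"

definition ce_d2 :: "('g::complex_lie_algebra \<Rightarrow> 'v \<Rightarrow> 'v) \<Rightarrow> ('g \<Rightarrow> 'g \<Rightarrow> 'v) \<Rightarrow> 'g \<Rightarrow> 'g \<Rightarrow> 'g \<Rightarrow> 'v::complex_vector"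
  where "ce_d2 act b x y z =
    act x (b y z) - act y (b x z) + act z (b x y)
    - b (lie_bracket x y) z + b (lie_bracket x z) y - b (lie_bracket y z) x"

definition ce_d3 :: "('g::complex_lie_algebra \<Rightarrow> 'v \<Rightarrow> 'v) \<Rightarrow> ('g \<Rightarrow> 'g \<Rightarrow> 'g \<Rightarrow> 'v)
    \<Rightarrow> 'g \<Rightarrow> 'g \<Rightarrow> 'g \<Rightarrow> 'g \<Rightarrow> 'v::complex_vector"
  where "ce_d3 act c w x y z =
    act w (c x y z) - act x (c w y z) + act y (c w x z) - act z (c w x y)
    - c (lie_bracket w x) y z + c (lie_bracket w y) x z - c (lie_bracket w z) x y
    - c (lie_bracket x y) w z + c (lie_bracket x z) w y - c (lie_bracket y z) w x"

definition ce_Z2 :: "'v::complex_vector set \<Rightarrow> ('g::complex_lie_algebra \<Rightarrow> 'v \<Rightarrow> 'v) \<Rightarrow> ('g \<Rightarrow> 'g \<Rightarrow> 'v) set"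
  where "ce_Z2 V act = {b \<in> ce_C2 V. \<forall>x y z. ce_d2 act b x y z = 0}"

definition ce_Z3 :: "'v::complex_vector set \<Rightarrow> ('g::complex_lie_algebra \<Rightarrow> 'v \<Rightarrow> 'v) \<Rightarrow> ('g \<Rightarrow> 'g \<Rightarrow> 'g \<Rightarrow> 'v) set"
  where "ce_Z3 V act = {c \<in> ce_C3 V. \<forall>w x y z. ce_d3 act c w x y z = 0}"

definition ce_B3 :: "'v::complex_vector set \<Rightarrow> ('g::complex_lie_algebra \<Rightarrow> 'v \<Rightarrow> 'v) \<Rightarrow> ('g \<Rightarrow> 'g \<Rightarrow> 'g \<Rightarrow> 'v) set"
  where "ce_B3 V act = ce_d2 act ` ce_C2 V"

text \<open>The class of a cocycle in \<open>H\<^sup>3(\<gg>; V)\<close>, as a coset of \<^const>\<open>ce_B3\<close>.\<close>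

definition ce_class3 :: "'v::complex_vector set \<Rightarrow> ('g::complex_lie_algebra \<Rightarrow> 'v \<Rightarrow> 'v)
    \<Rightarrow> ('g \<Rightarrow> 'g \<Rightarrow> 'g \<Rightarrow> 'v) \<Rightarrow> ('g \<Rightarrow> 'g \<Rightarrow> 'g \<Rightarrow> 'v) set"
  where "ce_class3 V act c = {c' \<in> ce_Z3 V act. c' - c \<in> ce_B3 V act}"

section \<open>The class of a crossed module and Yoneda products\<close>

definition crossed_choice :: "'m::complex_vector set \<Rightarrow> ('m \<Rightarrow> 'n) \<Rightarrow> 'n::complex_vector set \<Rightarrow> ('n \<Rightarrow> 'n \<Rightarrow> 'n)
    \<Rightarrow> ('n \<Rightarrow> 'g::complex_lie_algebra) \<Rightarrow> ('g \<Rightarrow> 'n) \<Rightarrow> ('g \<Rightarrow> 'g \<Rightarrow> 'm) \<Rightarrow> bool"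
  where "crossed_choice M \<mu> N brN \<pi> \<rho> b \<longleftrightarrow>
    clinear_on UNIV N \<rho> \<and> (\<forall>x. \<pi> (\<rho> x) = x) \<and> b \<in> ce_C2 M \<and>
    (\<forall>x y. \<mu> (b x y) = brN (\<rho> x) (\<rho> y) - \<rho> (lie_bracket x y))"

definition crossed_cocycle :: "('n \<Rightarrow> 'm \<Rightarrow> 'm) \<Rightarrow> ('g::complex_lie_algebra \<Rightarrow> 'n) \<Rightarrow> ('g \<Rightarrow> 'g \<Rightarrow> 'm)
    \<Rightarrow> 'g \<Rightarrow> 'g \<Rightarrow> 'g \<Rightarrow> 'm::complex_vector"
  where "crossed_cocycle act \<rho> b x y z =
    (act (\<rho> x) (b y z) - b (lie_bracket x y) z)
    + (act (\<rho> y) (b z x) - b (lie_bracket y z) x)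
    + (act (\<rho> z) (b x y) - b (lie_bracket z x) y)"

text \<open>
  The kernel of \<open>\<mu>\<close> is identified with \<open>V\<close> along \<open>i\<close>. The class does not depend on the choices, so it is
  required to be that of \<open>f\<close> for every choice; the first conjunct rules out vacuity.
\<close>

definition represents_class :: "'v::complex_vector set \<Rightarrow> ('g::complex_lie_algebra \<Rightarrow> 'v \<Rightarrow> 'v) \<Rightarrow> ('v \<Rightarrow> 'm)
    \<Rightarrow> 'm::complex_vector set \<Rightarrow> ('m \<Rightarrow> 'n) \<Rightarrow> 'n::complex_vector set \<Rightarrow> ('n \<Rightarrow> 'n \<Rightarrow> 'n) \<Rightarrow> ('n \<Rightarrow> 'm \<Rightarrow> 'm)
    \<Rightarrow> ('n \<Rightarrow> 'g) \<Rightarrow> ('g \<Rightarrow> 'g \<Rightarrow> 'g \<Rightarrow> 'v) \<Rightarrow> bool"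
  where "represents_class V actV i M \<mu> N brN act \<pi> f \<longleftrightarrow>
    (\<exists>\<rho> b. crossed_choice M \<mu> N brN \<pi> \<rho> b) \<and>
    (\<forall>\<rho> b. crossed_choice M \<mu> N brN \<pi> \<rho> b \<longrightarrow>
      (\<exists>c \<in> ce_Z3 V actV. (\<forall>x y z. i (c x y z) = crossed_cocycle act \<rho> b x y z) \<and>
        ce_class3 V actV c = ce_class3 V actV f))"

text \<open>The abelian extension \<open>V \<oplus>\<^sub>\<alpha> \<gg>\<close>.\<close>

definition ext_carrier :: "'v set \<Rightarrow> ('v \<times> 'g) set"
  where "ext_carrier V = V \<times> UNIV"

definition ext_bracket :: "('g::complex_lie_algebra \<Rightarrow> 'v \<Rightarrow> 'v) \<Rightarrow> ('g \<Rightarrow> 'g \<Rightarrow> 'v)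
    \<Rightarrow> 'v \<times> 'g \<Rightarrow> 'v \<times> 'g \<Rightarrow> 'v::complex_vector \<times> 'g"
  where "ext_bracket act \<alpha> = (\<lambda>(h, x) (h', y). (act x h' - act y h + \<alpha> x y, lie_bracket x y))"

definition yoneda_map :: "('b \<Rightarrow> 'c) \<Rightarrow> 'b \<Rightarrow> 'c \<times> 'g::complex_lie_algebra"
  where "yoneda_map d v = (d v, 0)"

definition yoneda_act :: "('g \<Rightarrow> 'b \<Rightarrow> 'b) \<Rightarrow> 'c \<times> 'g \<Rightarrow> 'b \<Rightarrow> 'b"
  where "yoneda_act act = (\<lambda>(h, x) v. act x v)"

section \<open>Duals of the enveloping algebra\<close>

definition dual_space :: "'a::complex_vector set \<Rightarrow> ('a \<Rightarrow> complex) set"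
  where "dual_space W = {\<phi>. clinear_on W UNIV \<phi> \<and> (\<forall>x. x \<notin> W \<longrightarrow> \<phi> x = 0)}"

definition dual_act :: "'g::complex_lie_algebra uea set \<Rightarrow> 'g \<Rightarrow> ('g uea \<Rightarrow> complex) \<Rightarrow> 'g uea \<Rightarrow> complex"
  where "dual_act W g \<phi> = (\<lambda>x. if x \<in> W then \<phi> (x * uea_incl g) else 0)"

definition counit_dual :: "complex \<Rightarrow> 'g::complex_lie_algebra uea \<Rightarrow> complex"
  where "counit_dual z = (\<lambda>x. z * counit x)"

definition restrict_aug :: "('g::complex_lie_algebra uea \<Rightarrow> complex) \<Rightarrow> 'g uea \<Rightarrow> complex"
  where "restrict_aug \<phi> = (\<lambda>x. if x \<in> aug_ideal then \<phi> x else 0)"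

definition trivial_act :: "'g::complex_lie_algebra \<Rightarrow> 'v::complex_vector \<Rightarrow> 'v"
  where "trivial_act g v = 0"

abbreviation uea_dual :: "('g::complex_lie_algebra uea \<Rightarrow> complex) set"
  where "uea_dual \<equiv> dual_space UNIV"

abbreviation aug_dual :: "('g::complex_lie_algebra uea \<Rightarrow> complex) set"
  where "aug_dual \<equiv> dual_space aug_ideal"

abbreviation uea_dual_act :: "'g::complex_lie_algebra \<Rightarrow> ('g uea \<Rightarrow> complex) \<Rightarrow> 'g uea \<Rightarrow> complex"
  where "uea_dual_act \<equiv> dual_act UNIV"

abbreviation aug_dual_act :: "'g::complex_lie_algebra \<Rightarrow> ('g uea \<Rightarrow> complex) \<Rightarrow> 'g uea \<Rightarrow> complex"
  where "aug_dual_act \<equiv> dual_act aug_ideal"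

end

theory Submission
  imports Defs
begin

text \<open>
  In characteristic zero \<open>U\<gg>\<close> is spanned by the powers of elements of \<open>\<gg>\<close>, so linear maps on \<open>U\<gg>\<close> are determined
  by their values on the group-like series \<open>exp y = \<Sum> y\<^sup>n / n!\<close>. There \<open>pr (exp y) = y\<close>,
  \<open>\<phi>\<^sub>t (exp y) = exp (t y)\<close>, and \<open>exp y \<cdot> g\<close> is the derivative of \<open>exp\<close> at \<open>y\<close> in the direction \<open>T g\<close> with
  \<open>T = ad y / (1 - exp (- ad y))\<close>. This gives \<open>A\<^sub>t (exp y, g) = (1 - exp (- t ad y)) / (1 - exp (- ad y)) g\<close> and
  \<open>\<alpha> (exp y, g\<^sub>1, g\<^sub>2) = \<integral> f (y, A\<^sub>t g\<^sub>1, A\<^sub>t g\<^sub>2) dt\<close>: \<open>\<alpha>\<close> is the image under the Poincare homotopy of the left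
  invariant form \<open>f\<close> on the formal group of \<open>\<gg>\<close>. The equation \<open>\<partial>\<^sub>t A\<^sub>t = T - ad y A\<^sub>t\<close> with \<open>A\<^sub>0 = 0\<close>, \<open>A\<^sub>1 = 1\<close> yields
  the Maurer--Cartan equation for \<open>A\<^sub>t\<close>; its \<open>T\<close>-part says that \<open>(x, v) \<cdot> g = (x g, pr (x g))\<close> is a right
  module structure on \<open>U\<gg> \<oplus> \<gg>\<close>, whence \<open>\<gg>\<close> embeds into \<open>U\<gg>\<close>. By the cocycle identity, the coboundary of the
  integrand is \<open>\<partial>\<^sub>t f (A\<^sub>t g\<^sub>1, A\<^sub>t g\<^sub>2, A\<^sub>t g\<^sub>3)\<close>. So \<open>\<alpha>\<close>, taken on all of \<open>U\<gg>\<close>, has coboundary \<open>f \<cdot> \<epsilon>\<close>: it is closed on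
  \<open>U\<gg>\<^sup>+\<close>, and \<open>f\<close> is the class of the Yoneda product.
\<close>

section \<open>Linear and bilinear maps\<close>

text \<open>\<open>pr\<close> and \<open>A_form\<close> are defined through inverses of maps built
  from \<open>uea_incl\<close>, so nothing can be said about their values before injectivity is
  known. To avoid a circle, the Maurer-Cartan equation is proved with brackets in \<gg> alone, the
  spanning by powers uses only the relations of U\<gg>, and \<open>eulerian\<close> is first studied
  with values in U\<gg>. The series exp y lies in no completion here, and the spaces carry no
  topology. Each identity between series is therefore replaced by its homogeneous parts in y, and
  differentiation in y by extracting the linear coefficient of a polynomial curve. This explains the
  many degree indices: a derivative replaces one factor y by a term of T g, so it shifts the degree
  by one. Since y occurs with bounded degree in each part, the dependence on t is polynomial, and
  the differential equations in t become identities in C[t].\<close>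

lemma clinearD:
  assumes "clinear f"
  shows "f (x + y) = f x + f y" "f (c *\<^sub>C x) = c *\<^sub>C f x" "f (x - y) = f x - f y" "f (- x) = - f x" "f 0 = 0"
proof -
  show add: "f (x + y) = f x + f y" for x y using assms by (simp add: clinear_iff)
  show "f (c *\<^sub>C x) = c *\<^sub>C f x" using assms by (simp add: clinear_iff)
  show "f 0 = 0" using assms by (rule clinear_zero)
  then show m: "f (- x) = - f x" for x using add[of x "- x"] by (simp add: minus_unique)
  show "f (x - y) = f x - f y" using add[of x "- y"] by (simp add: m)
qed

lemma clinearI:
  assumes "\<And>x y. f (x + y) = f x + f y" "\<And>c x. f (c *\<^sub>C x) = c *\<^sub>C f x"
  shows "clinear f"
  using assms by (simp add: clinear_iff)

lemma clinear_compose2: "clinear f \<Longrightarrow> clinear g \<Longrightarrow> clinear (\<lambda>x. f (g x))"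
  by (simp add: clinear_iff)

lemma clinear_ident: "clinear (\<lambda>x. x)"
  by (simp add: clinear_iff)

lemma clinear_const_zero: "clinear (\<lambda>x. 0)"
  by (simp add: clinear_iff)

lemma clinear_minus: "clinear F \<Longrightarrow> clinear G \<Longrightarrow> clinear (\<lambda>x. F x - G x)"
  by (simp add: clinear_iff complex_vector.scale_right_diff_distrib)

lemma cbilinear_left: "cbilinear B \<Longrightarrow> clinear (\<lambda>a. B a b)"
  and cbilinear_right: "cbilinear B \<Longrightarrow> clinear (B a)"
  by (simp_all add: cbilinear_def)

lemma clinear_mult_left: "clinear (\<lambda>x::'a::complex_algebra. x * y)"
  and clinear_mult_right: "clinear (\<lambda>x::'a::complex_algebra. y * x)"
  by (simp_all add: clinear_iff distrib_left distrib_right scaleC_mult_left scaleC_mult_right)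

lemma cbilinear_mult: "cbilinear ((*) :: 'a::complex_algebra \<Rightarrow> 'a \<Rightarrow> 'a)"
  by (simp add: cbilinear_def clinear_mult_left clinear_mult_right)

lemma cbilinear_lie_bracket: "cbilinear (lie_bracket :: 'g::complex_lie_algebra \<Rightarrow> 'g \<Rightarrow> 'g)"
  by (rule cbilinearI)
    (simp_all add: lie_bracket_add_left lie_bracket_add_right lie_bracket_scaleC_left lie_bracket_scaleC_right)

lemmas clinear_lie_bracket_left = cbilinear_left[OF cbilinear_lie_bracket]
  and clinear_lie_bracket_right = cbilinear_right[OF cbilinear_lie_bracket]

lemma lie_bracket_swap: "lie_bracket x y = - lie_bracket (y :: 'g::complex_lie_algebra) x"
proof -
  have "lie_bracket (x + y) (x + y) = 0" by (rule lie_bracket_self)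
  then have "lie_bracket x y + lie_bracket y x = 0"
    unfolding lie_bracket_add_left lie_bracket_add_right by (simp add: lie_bracket_self add.commute)
  then show ?thesis by (simp add: eq_neg_iff_add_eq_0)
qed

lemma lie_bracket_derivation:
  "lie_bracket x (lie_bracket y z) = lie_bracket (lie_bracket x y) z + lie_bracket y (lie_bracket (x :: 'g::complex_lie_algebra) z)"
proof -
  have "lie_bracket y (lie_bracket z x) = - lie_bracket y (lie_bracket x z)"
    by (subst lie_bracket_swap[of z x]) (simp add: clinearD[OF clinear_lie_bracket_right])
  moreover have "lie_bracket z (lie_bracket x y) = - lie_bracket (lie_bracket x y) z"
    by (rule lie_bracket_swap)
  ultimately show ?thesis using lie_jacobi[of x y z] by (simp add: algebra_simps)
qed

section \<open>Separating functionals and linear left inverses\<close>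

lemma exists_clinear_nonzero:
  fixes u :: "'a::complex_vector"
  assumes "u \<noteq> 0"
  obtains l :: "'a \<Rightarrow> complex" where "clinear l" "l u \<noteq> 0"
proof -
  interpret vector_space_pair "scaleC :: complex \<Rightarrow> complex \<Rightarrow> complex" "scaleC :: complex \<Rightarrow> 'a \<Rightarrow> 'a"
    by unfold_locales
  have "clinear (\<lambda>c::complex. c *\<^sub>C u)"
    by (simp add: clinear_iff scaleC_add_left scaleC_scaleC)
  moreover have "inj (\<lambda>c::complex. c *\<^sub>C u)"
    using assms by (simp add: inj_on_def)
  ultimately obtain l where "clinear l" "l \<circ> (\<lambda>c. c *\<^sub>C u) = id"
    using linear_injective_left_inverse[of "\<lambda>c. c *\<^sub>C u"] by blast
  then have "l (1 *\<^sub>C u) = 1" by (metis comp_apply id_apply)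
  then show thesis using that[OF \<open>clinear l\<close>] by (simp add: scaleC_one)
qed

text \<open>Reduces vector identities to scalar ones; this is why \<open>mc_defect\<close> can be a
  complex polynomial that depends on a functional.\<close>

lemma clinear_separates:
  assumes "\<And>l :: 'a::complex_vector \<Rightarrow> complex. clinear l \<Longrightarrow> l u = l v"
  shows "u = v"
proof (rule ccontr)
  assume "u \<noteq> v"
  then have "u - v \<noteq> 0" by simp
  then obtain l :: "'a \<Rightarrow> complex" where l: "clinear l" "l (u - v) \<noteq> 0" by (rule exists_clinear_nonzero)
  with assms[OF l(1)] show False by (simp add: clinearD(3))
qed

lemma clinear_left_inverse:
  assumes "clinear f" "inj f"
  obtains r where "clinear r" "\<And>x. r (f x) = x"
proof -
  interpret vector_space_pair "scaleC :: complex \<Rightarrow> 'a \<Rightarrow> 'a" "scaleC :: complex \<Rightarrow> 'b \<Rightarrow> 'b"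
    by unfold_locales
  obtain r where "clinear r" "r \<circ> f = id"
    using linear_injective_left_inverse[OF assms] by blast
  then show thesis using that[of r] by (metis comp_apply id_apply)
qed

lemma scaleC_complex_poly [simp]: "(c *\<^sub>C p :: complex poly) = smult c p"
  by (simp add: scaleC_poly_def)

section \<open>The coefficients of the form \<open>A\<^sub>t\<close>\<close>

text \<open>
  These are the Taylor coefficients of \<open>(1 - exp (-u)) / u\<close>, of its inverse, and of
  \<open>(1 - exp (-tu)) / (1 - exp (-u))\<close>; the last ones are polynomials in \<open>t\<close>.
\<close>

definition dexp_coeff :: "nat \<Rightarrow> complex"
  where "dexp_coeff r = (- 1) ^ r / fact (Suc r)"

definition todd_coeff :: "nat \<Rightarrow> complex"
  where "todd_coeff k = fps_nth (inverse (Abs_fps dexp_coeff)) k"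

definition todd_poly :: "nat \<Rightarrow> complex poly"
  where "todd_poly j = (\<Sum>l\<le>j. monom (todd_coeff l * dexp_coeff (j - l)) (Suc (j - l)))"

lemma dexp_coeff_0 [simp]: "dexp_coeff 0 = 1"
  by (simp add: dexp_coeff_def)

lemma todd_dexp_convolution: "(\<Sum>l\<le>j. todd_coeff l * dexp_coeff (j - l)) = (if j = 0 then 1 else 0)"
proof -
  have "inverse (Abs_fps dexp_coeff) * Abs_fps dexp_coeff = 1"
    by (rule inverse_mult_eq_1) (simp add: dexp_coeff_def)
  then have "fps_nth (inverse (Abs_fps dexp_coeff) * Abs_fps dexp_coeff) j = (if j = 0 then 1 else 0)"
    by simp
  then show ?thesis by (simp add: fps_mult_nth todd_coeff_def atMost_atLeast0)
qed

lemma todd_coeff_0 [simp]: "todd_coeff 0 = 1"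
  by (simp add: todd_coeff_def dexp_coeff_def)

lemma poly_todd_poly_0 [simp]: "poly (todd_poly j) 0 = 0"
  by (simp add: todd_poly_def poly_sum poly_monom)

lemma poly_todd_poly_1 [simp]: "poly (todd_poly j) 1 = (if j = 0 then 1 else 0)"
  by (simp only: todd_poly_def poly_sum poly_monom power_one mult_1_right todd_dexp_convolution)

lemma pderiv_sum: "pderiv (sum F A) = (\<Sum>i\<in>A. pderiv (F i))"
  by (induction A rule: infinite_finite_induct) (simp_all add: pderiv_add)

text \<open>The coefficient of u^j in \<partial>_t A = T - u A for A = (1 - exp(-tu)) / (1 -
  exp(-u)); multiplication by u shifts the index, hence the case distinction.\<close>

lemma pderiv_todd_poly:
  "pderiv (todd_poly j) = [:todd_coeff j:] - (case j of 0 \<Rightarrow> 0 | Suc i \<Rightarrow> todd_poly i)"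
proof (cases j)
  case 0
  then show ?thesis by (simp add: todd_poly_def pderiv_monom dexp_coeff_def monom_0)
next
  case (Suc i)
  have step: "of_nat (Suc (Suc r)) * dexp_coeff (Suc r) = - dexp_coeff r" for r
    using of_nat_neq_0[of r, where 'a = complex] of_nat_neq_0[of "Suc r", where 'a = complex]
    by (simp add: dexp_coeff_def field_simps del: of_nat_Suc)
  have "pderiv (todd_poly j) = (\<Sum>l\<le>i. monom (of_nat (Suc (j - l)) * (todd_coeff l * dexp_coeff (j - l))) (j - l))
      + monom (todd_coeff j) 0"
    by (simp add: todd_poly_def pderiv_sum pderiv_add pderiv_monom Suc del: of_nat_Suc)
  also have "(\<Sum>l\<le>i. monom (of_nat (Suc (j - l)) * (todd_coeff l * dexp_coeff (j - l))) (j - l))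
      = (\<Sum>l\<le>i. - monom (todd_coeff l * dexp_coeff (i - l)) (Suc (i - l)))"
  proof (rule sum.cong[OF refl])
    fix l assume "l \<in> {..i}"
    then have "j - l = Suc (i - l)" by (simp add: Suc Suc_diff_le)
    moreover have "of_nat (Suc (Suc (i - l))) * (todd_coeff l * dexp_coeff (Suc (i - l))) = - (todd_coeff l * dexp_coeff (i - l))"
      using step[of "i - l"] by (metis mult.left_commute mult_minus_right)
    ultimately show "monom (of_nat (Suc (j - l)) * (todd_coeff l * dexp_coeff (j - l))) (j - l)
        = - monom (todd_coeff l * dexp_coeff (i - l)) (Suc (i - l))"
      by (simp only: minus_monom)
  qed
  finally show ?thesis by (simp add: Suc todd_poly_def sum_negf monom_0)
qed

section \<open>The Maurer--Cartan equation\<close>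

abbreviation ad_pow :: "'g::complex_lie_algebra \<Rightarrow> nat \<Rightarrow> 'g \<Rightarrow> 'g"
  where "ad_pow y n \<equiv> lie_bracket y ^^ n"

text \<open>The derivative of \<^term>\<open>ad_pow y n z\<close> with respect to \<open>y\<close> in the direction \<open>w\<close>.\<close>

fun ad_pow_deriv :: "'g::complex_lie_algebra \<Rightarrow> 'g \<Rightarrow> nat \<Rightarrow> 'g \<Rightarrow> 'g" where
  "ad_pow_deriv y w 0 z = 0"
| "ad_pow_deriv y w (Suc n) z = lie_bracket w (ad_pow y n z) + lie_bracket y (ad_pow_deriv y w n z)"

lemma clinear_ad_pow: "clinear (ad_pow y n)"
  by (induction n) (simp_all add: clinear_iff lie_bracket_add_right lie_bracket_scaleC_right)

text \<open>
  The degree-\<open>m\<close> part, tested against a functional \<open>l\<close>, of the Maurer--Cartan equation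
  \<open>\<delta>\<^sub>u (A\<^sub>t v) - \<delta>\<^sub>v (A\<^sub>t u) - A\<^sub>t [u, v] = - [A\<^sub>t u, A\<^sub>t v]\<close>, where \<open>A\<^sub>t\<close> is the series in \<open>ad y\<close> with coefficients
  \<^const>\<open>todd_poly\<close> and \<open>\<delta>\<^sub>u\<close> differentiates in \<open>y\<close> along \<open>T u\<close>, \<open>T\<close> the series with coefficients \<^const>\<open>todd_coeff\<close>.
\<close>

definition mc_defect :: "'g::complex_lie_algebra \<Rightarrow> 'g \<Rightarrow> 'g \<Rightarrow> ('g \<Rightarrow> complex) \<Rightarrow> nat \<Rightarrow> complex poly"
  where "mc_defect y u v l m =
    (\<Sum>k\<le>m. smult (todd_coeff k * l (ad_pow_deriv y (ad_pow y k u) (Suc m - k) v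
        - ad_pow_deriv y (ad_pow y k v) (Suc m - k) u)) (todd_poly (Suc m - k)))
    - smult (l (ad_pow y m (lie_bracket u v))) (todd_poly m)
    + (\<Sum>i\<le>m. smult (l (lie_bracket (ad_pow y i u) (ad_pow y (m - i) v))) (todd_poly i * todd_poly (m - i)))"

text \<open>The degree-m part of [T u, T v] - T [u, v], the bracket being that of vector fields in
  y: T u is a left invariant field. Differentiating \<open>ad_pow y j\<close> along
  \<open>ad_pow y k u\<close> leaves degree k + j - 1 in y, so j is
  \<open>Suc m - k\<close>.\<close>

definition todd_defect :: "'g::complex_lie_algebra \<Rightarrow> 'g \<Rightarrow> 'g \<Rightarrow> nat \<Rightarrow> 'g"
  where "todd_defect y u v m =
    (\<Sum>k\<le>m. (todd_coeff k * todd_coeff (Suc m - k)) *\<^sub>C (ad_pow_deriv y (ad_pow y k u) (Suc m - k) v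
        - ad_pow_deriv y (ad_pow y k v) (Suc m - k) u))
    - todd_coeff m *\<^sub>C ad_pow y m (lie_bracket u v)"


text \<open>The defect E satisfies \<partial>_t E = \<open>todd_defect\<close> - ad y E.
  Differentiating the outermost ad y of ad y A_t v along T u gives [T u, A_t v], which cancels the
  T-part of \<partial>_t [A_t u, A_t v]; the other terms combine because ad y is a
  derivation.\<close>

lemma poly_pderiv_mc_defect:
  assumes l: "clinear l"
  shows "poly (pderiv (mc_defect y u v l m)) t = l (todd_defect y u v m)
    - (case m of 0 \<Rightarrow> 0 | Suc p \<Rightarrow> poly (mc_defect y u v (\<lambda>z. l (lie_bracket y z)) p) t)"
proof -
  note lin = clinearD[OF l]
  define N A where "N = ad_pow y" and "A j = poly (todd_poly j) t" for j
  \<comment> \<open>The coefficients of the series u A_t.\<close>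
  define A' where "A' j = (case j of 0 \<Rightarrow> 0 | Suc i \<Rightarrow> A i)" for j
  define D where "D k j = ad_pow_deriv y (N k u) j v - ad_pow_deriv y (N k v) j u" for k j
  define B where "B i j = l (lie_bracket (N i u) (N j v))" for i j
  have dA: "poly (pderiv (todd_poly j)) t = todd_coeff j - A' j" for j
    by (cases j) (simp_all add: pderiv_todd_poly A_def A'_def)
  have D0: "D k 0 = 0" for k by (simp add: D_def)
  have lD: "l (D k (Suc j)) = B k j + B j k + l (lie_bracket y (D k j))" for k j
  proof -
    have "D k (Suc j) = lie_bracket (N k u) (N j v) - lie_bracket (N k v) (N j u) + lie_bracket y (D k j)"
      by (simp add: D_def N_def clinearD[OF clinear_lie_bracket_right])
    also have "lie_bracket (N k v) (N j u) = - lie_bracket (N j u) (N k v)"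
      by (rule lie_bracket_swap)
    finally show ?thesis by (simp add: lin B_def)
  qed
  have defect: "l (todd_defect y u v m) = (\<Sum>k\<le>m. todd_coeff k * todd_coeff (Suc m - k) * l (D k (Suc m - k)))
      - todd_coeff m * l (N m (lie_bracket u v))"
    by (simp add: todd_defect_def lin clinear_sum[OF l] N_def D_def)
  have "poly (pderiv (mc_defect y u v l m)) t =
      (\<Sum>k\<le>m. todd_coeff k * l (D k (Suc m - k)) * (todd_coeff (Suc m - k) - A' (Suc m - k)))
      - l (N m (lie_bracket u v)) * (todd_coeff m - A' m)
      + (\<Sum>i\<le>m. B i (m - i) * ((todd_coeff i - A' i) * A (m - i) + A i * (todd_coeff (m - i) - A' (m - i))))"
    by (simp add: mc_defect_def pderiv_diff pderiv_add pderiv_sum pderiv_smult pderiv_mult poly_sum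
        dA A_def[symmetric] N_def D_def B_def algebra_simps)
  also have "(\<Sum>k\<le>m. todd_coeff k * l (D k (Suc m - k)) * (todd_coeff (Suc m - k) - A' (Suc m - k)))
      = (\<Sum>k\<le>m. todd_coeff k * todd_coeff (Suc m - k) * l (D k (Suc m - k)))
        - (\<Sum>k\<le>m. todd_coeff k * A (m - k) * B k (m - k)) - (\<Sum>k\<le>m. todd_coeff k * A (m - k) * B (m - k) k)
        - (\<Sum>k\<le>m. todd_coeff k * A (m - k) * l (lie_bracket y (D k (m - k))))"
    unfolding sum_subtractf[symmetric]
  proof (rule sum.cong[OF refl])
    fix k assume "k \<in> {..m}"
    then have "Suc m - k = Suc (m - k)" by (simp add: Suc_diff_le)
    then show "todd_coeff k * l (D k (Suc m - k)) * (todd_coeff (Suc m - k) - A' (Suc m - k))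
      = todd_coeff k * todd_coeff (Suc m - k) * l (D k (Suc m - k)) - todd_coeff k * A (m - k) * B k (m - k)
        - todd_coeff k * A (m - k) * B (m - k) k - todd_coeff k * A (m - k) * l (lie_bracket y (D k (m - k)))"
      by (simp add: A'_def lD algebra_simps)
  qed
  also have "(\<Sum>k\<le>m. todd_coeff k * A (m - k) * B (m - k) k) = (\<Sum>i\<le>m. B i (m - i) * A i * todd_coeff (m - i))"
    by (rule sum.reindex_bij_witness[of _ "\<lambda>i. m - i" "\<lambda>i. m - i"]) auto
  finally have main: "poly (pderiv (mc_defect y u v l m)) t = l (todd_defect y u v m)
      - (\<Sum>k\<le>m. todd_coeff k * A (m - k) * l (lie_bracket y (D k (m - k))))
      + l (N m (lie_bracket u v)) * A' m
      - ((\<Sum>i\<le>m. B i (m - i) * A' i * A (m - i)) + (\<Sum>i\<le>m. B i (m - i) * A i * A' (m - i)))"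
    unfolding defect by (simp add: sum.distrib sum_subtractf algebra_simps)
  show ?thesis
  proof (cases m)
    case 0
    then show ?thesis using main by (simp add: A'_def D0 lin clinearD[OF clinear_lie_bracket_right])
  next
    case (Suc p)
    have "(\<Sum>k\<le>m. todd_coeff k * A (m - k) * l (lie_bracket y (D k (m - k))))
        = (\<Sum>k\<le>p. todd_coeff k * A (Suc p - k) * l (lie_bracket y (D k (Suc p - k))))"
      by (simp add: Suc D0 lin clinearD[OF clinear_lie_bracket_right])
    moreover have "(\<Sum>i\<le>m. B i (m - i) * A' i * A (m - i)) = (\<Sum>i\<le>p. B (Suc i) (p - i) * A i * A (p - i))"
      unfolding Suc by (subst sum.atMost_Suc_shift) (simp add: A'_def)
    moreover have "(\<Sum>i\<le>m. B i (m - i) * A i * A' (m - i)) = (\<Sum>i\<le>p. B i (Suc (p - i)) * A i * A (p - i))"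
      unfolding Suc by (simp add: A'_def Suc_diff_le)
    moreover have "B (Suc i) j + B i (Suc j) = l (lie_bracket y (lie_bracket (N i u) (N j v)))" for i j
      by (subst lie_bracket_derivation) (simp add: B_def N_def lin)
    then have "(\<Sum>i\<le>p. B (Suc i) (p - i) * A i * A (p - i)) + (\<Sum>i\<le>p. B i (Suc (p - i)) * A i * A (p - i))
      = (\<Sum>i\<le>p. l (lie_bracket y (lie_bracket (N i u) (N (p - i) v))) * (A i * A (p - i)))"
      by (simp add: sum.distrib[symmetric] distrib_right[symmetric] mult.assoc)
    moreover have "N m (lie_bracket u v) = lie_bracket y (N p (lie_bracket u v))"
      by (simp add: N_def Suc)
    moreover have "poly (mc_defect y u v (\<lambda>z. l (lie_bracket y z)) p) t
      = (\<Sum>k\<le>p. todd_coeff k * A (Suc p - k) * l (lie_bracket y (D k (Suc p - k))))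
        - l (lie_bracket y (N p (lie_bracket u v))) * A p
        + (\<Sum>i\<le>p. l (lie_bracket y (lie_bracket (N i u) (N (p - i) v))) * (A i * A (p - i)))"
      by (simp add: mc_defect_def poly_sum N_def D_def A_def mult_ac)
    ultimately show ?thesis
      using main by (simp add: Suc A'_def)
  qed
qed

text \<open>
  By induction the defect has constant derivative in \<open>t\<close>; as it vanishes at \<open>0\<close> and at \<open>1\<close>, both the
  defect and that constant are zero.
\<close>

lemma mc_defect_eq_0_and_todd_defect:
  assumes "clinear l"
  shows "mc_defect y u v l m = 0 \<and> l (todd_defect y u v m) = 0"
  using assms
proof (induction m arbitrary: l)
  let ?P = "\<lambda>l m. mc_defect y u v l m"
  have P01: "poly (?P l m) 0 = 0" "poly (?P l m) 1 = 0" if "clinear l" for l m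
  proof -
    show "poly (?P l m) 0 = 0" by (simp add: mc_defect_def poly_sum)
    \<comment> \<open>At t = 1 only index 0 contributes. The derivative terms have order
      \<open>Suc m - k\<close> > 0 and drop out; for m = 0 the terms -[u, v] and [u, v]
      cancel.\<close>
    have "(\<Sum>k\<le>m. todd_coeff k * l (ad_pow_deriv y (ad_pow y k u) (Suc m - k) v
        - ad_pow_deriv y (ad_pow y k v) (Suc m - k) u) * (if Suc m - k = 0 then 1 else 0)) = 0"
      by (rule sum.neutral) auto
    moreover have "(\<Sum>i\<le>m. l (lie_bracket (ad_pow y i u) (ad_pow y (m - i) v)) *
        ((if i = 0 then 1 else 0) * (if m - i = 0 then 1 else 0))) = (if m = 0 then l (lie_bracket u v) else 0)"
      by (cases "m = 0") (simp, auto intro!: sum.neutral)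
    ultimately show "poly (?P l m) 1 = 0"
      by (simp add: mc_defect_def poly_sum)
  qed
  have step: "?P l m = 0 \<and> l (todd_defect y u v m) = 0"
    if l: "clinear l" and d: "\<And>t. poly (pderiv (?P l m)) t = l (todd_defect y u v m)" for l m
  proof -
    define c where "c = l (todd_defect y u v m)"
    have "poly (pderiv (?P l m - [:0, c:])) t = 0" for t
      by (simp add: pderiv_diff d c_def pderiv_pCons)
    then have "pderiv (?P l m - [:0, c:]) = 0"
      by (metis poly_all_0_iff_0)
    then obtain b where "?P l m - [:0, c:] = [:b:]"
      by (meson degree_eq_zeroE pderiv_eq_0_iff)
    then have eq: "?P l m = [:b, c:]" by (simp add: algebra_simps)
    with P01[OF l, of m] have "b = 0" "c = 0" by simp_all
    with eq show ?thesis by (simp add: c_def)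
  qed
  {
    case 0
    show ?case by (rule step[OF 0]) (simp add: poly_pderiv_mc_defect[OF 0])
  next
    case (Suc m)
    \<comment> \<open>The lower defect occurs behind ad y, so the induction has to run over all
      functionals at once.\<close>
    have l': "clinear (\<lambda>z. l (lie_bracket y z))"
      using Suc.prems clinear_lie_bracket_right by (rule clinear_compose2)
    then show ?case using Suc.IH[OF l']
      by (intro step[OF Suc.prems]) (simp add: poly_pderiv_mc_defect[OF Suc.prems])
  }
qed

lemma todd_defect_eq_0: "todd_defect y u v m = 0"
proof (rule clinear_separates)
  fix l :: "'a \<Rightarrow> complex"
  assume l: "clinear l"
  show "l (todd_defect y u v m) = l 0"
    using mc_defect_eq_0_and_todd_defect[OF l] by (simp add: clinearD(5)[OF l])
qed

section \<open>First-order jets of polynomial curves\<close>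

text \<open>Horner form: closure under sums and multilinear maps follows by induction, without
  tracking degrees or coefficients.\<close>

inductive poly_curve :: "(complex \<Rightarrow> 'v::complex_vector) \<Rightarrow> bool" where
  zero: "poly_curve (\<lambda>_. 0)"
| step: "poly_curve c \<Longrightarrow> poly_curve (\<lambda>e. v + e *\<^sub>C c e)"

lemma poly_curve_const: "poly_curve (\<lambda>_. v)"
  using poly_curve.step[OF poly_curve.zero, of v] by simp

lemma poly_curve_shift: "poly_curve c \<Longrightarrow> poly_curve (\<lambda>e. e *\<^sub>C c e)"
  using poly_curve.step[of c 0] by simp

lemma poly_curve_add:
  assumes "poly_curve c" "poly_curve d"
  shows "poly_curve (\<lambda>e. c e + d e)"
  using assms
proof (induction arbitrary: d)
  case zero
  then show ?case by simp
next
  case (step c v)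
  from step.prems show ?case
  proof cases
    case zero
    then show ?thesis using poly_curve.step[OF step.hyps, of v] by simp
  next
    case (step d' v')
    have "poly_curve (\<lambda>e. (v + v') + e *\<^sub>C (c e + d' e))"
      by (intro poly_curve.step step.IH step(2))
    then show ?thesis unfolding step(1) by (simp add: scaleC_add_right add_ac)
  qed
qed

lemma poly_curve_linear:
  assumes L: "clinear L" and "poly_curve c"
  shows "poly_curve (\<lambda>e. L (c e))"
  using assms(2) by induction (simp_all add: clinearD[OF L] poly_curve.intros)

lemma poly_curve_bilinear:
  assumes B: "cbilinear B" and "poly_curve c" "poly_curve d"
  shows "poly_curve (\<lambda>e. B (c e) (d e))"
  using assms(2)
proof induction
  case zero
  then show ?case by (simp add: clinearD(5)[OF cbilinear_left[OF B]] poly_curve.zero)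
next
  case (step c v)
  then show ?case
    by (simp add: cbilinearD[OF B] poly_curve_add poly_curve_shift
        poly_curve_linear[OF cbilinear_right[OF B] assms(3)])
qed

text \<open>Comparing \<open>c(2e)\<close> with \<open>2\<^sup>n c(e)\<close> eliminates the top coefficient.\<close>

lemma subspace_sum_coeffs:
  assumes P: "csubspace P"
  shows "(\<And>e::complex. (\<Sum>k\<le>n. e ^ k *\<^sub>C r k) \<in> P) \<Longrightarrow> k \<le> n \<Longrightarrow> r k \<in> P"
proof (induction n arbitrary: r k)
  case 0
  then show ?case using "0.prems"(1)[of 0] by (simp add: scaleC_one)
next
  case (Suc n)
  let ?c = "\<lambda>e::complex. \<Sum>k\<le>Suc n. e ^ k *\<^sub>C r k"
  have "(\<Sum>k\<le>n. e ^ k *\<^sub>C ((2 ^ k - 2 ^ Suc n) *\<^sub>C r k)) \<in> P" for e :: complex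
  proof -
    have "?c (2 * e) - 2 ^ Suc n *\<^sub>C ?c e \<in> P"
      by (intro complex_vector.subspace_diff[OF P] complex_vector.subspace_scale[OF P] Suc.prems(1))
    also have "?c (2 * e) - 2 ^ Suc n *\<^sub>C ?c e = (\<Sum>k\<le>Suc n. e ^ k *\<^sub>C ((2 ^ k - 2 ^ Suc n) *\<^sub>C r k))"
      unfolding complex_vector.scale_sum_right sum_subtractf[symmetric]
      by (rule sum.cong) (simp_all add: scaleC_scaleC power_mult_distrib algebra_simps
          flip: complex_vector.scale_left_diff_distrib)
    finally show ?thesis by simp
  qed
  then have scaled: "(2 ^ k - 2 ^ Suc n) *\<^sub>C r k \<in> P" if "k \<le> n" for k
    using that by (rule Suc.IH)
  have low: "r k \<in> P" if "k \<le> n" for k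
  proof -
    have "(2::complex) ^ k \<noteq> 2 ^ Suc n"
    proof
      assume "(2::complex) ^ k = 2 ^ Suc n"
      then have "norm ((2::complex) ^ k) = norm ((2::complex) ^ Suc n)" by simp
      then have "(2::real) ^ k = 2 ^ Suc n" by (simp add: norm_power)
      then show False using that power_strict_increasing[of k "Suc n" "2::real"] by simp
    qed
    then have "inverse (2 ^ k - 2 ^ Suc n) *\<^sub>C ((2 ^ k - 2 ^ Suc n) *\<^sub>C r k) = r k"
      by (simp add: scaleC_scaleC scaleC_one)
    then show ?thesis by (metis complex_vector.subspace_scale[OF P scaled[OF that]])
  qed
  have "?c 1 - (\<Sum>k\<le>n. r k) \<in> P"
    by (intro complex_vector.subspace_diff[OF P] complex_vector.subspace_sum[OF P] low Suc.prems(1)) simp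
  then have "r (Suc n) \<in> P" by (simp add: scaleC_one)
  with low Suc.prems(2) show ?case by (cases "k = Suc n") simp_all
qed

lemma poly_curve_coeffs:
  assumes "poly_curve c"
  shows "\<exists>n r. c = (\<lambda>e. \<Sum>k\<le>n. e ^ k *\<^sub>C r k)"
  using assms
proof induction
  case zero
  show ?case by (rule exI[of _ 0], rule exI[of _ "\<lambda>_. 0"]) simp
next
  case (step c v)
  then obtain n r where c: "c = (\<lambda>e. \<Sum>k\<le>n. e ^ k *\<^sub>C r k)" by blast
  show ?case
    by (rule exI[of _ "Suc n"], rule exI[of _ "\<lambda>k. case k of 0 \<Rightarrow> v | Suc j \<Rightarrow> r j"])
      (simp add: c sum.atMost_Suc_shift complex_vector.scale_sum_right scaleC_scaleC scaleC_one
        del: sum.atMost_Suc)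
qed

text \<open>An algebraic derivative at e = 0: value v, velocity w, and a polynomial remainder of
  order e^2.\<close>

definition jet :: "(complex \<Rightarrow> 'v::complex_vector) \<Rightarrow> 'v \<Rightarrow> 'v \<Rightarrow> bool"
  where "jet c v w \<longleftrightarrow> (\<exists>r. poly_curve r \<and> c = (\<lambda>e. v + e *\<^sub>C (w + e *\<^sub>C r e)))"

lemma jet_affine: "jet (\<lambda>e. v + e *\<^sub>C w) v w"
  unfolding jet_def by (rule exI[of _ "\<lambda>_. 0"]) (simp add: poly_curve.zero)

lemma jet_const: "jet (\<lambda>e. v) v 0"
  using jet_affine[of v 0] by simp

lemma jet_add:
  assumes "jet c v w" "jet d v' w'"
  shows "jet (\<lambda>e. c e + d e) (v + v') (w + w')"
proof -
  obtain r where r: "poly_curve r" "c = (\<lambda>e. v + e *\<^sub>C (w + e *\<^sub>C r e))"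
    using assms(1) by (auto simp: jet_def)
  obtain s where s: "poly_curve s" "d = (\<lambda>e. v' + e *\<^sub>C (w' + e *\<^sub>C s e))"
    using assms(2) by (auto simp: jet_def)
  show ?thesis
    unfolding jet_def by (rule exI[of _ "\<lambda>e. r e + s e"])
      (simp add: r s poly_curve_add scaleC_add_right add_ac)
qed

lemma jet_linear:
  assumes L: "clinear L" and "jet c v w"
  shows "jet (\<lambda>e. L (c e)) (L v) (L w)"
proof -
  obtain r where r: "poly_curve r" "c = (\<lambda>e. v + e *\<^sub>C (w + e *\<^sub>C r e))"
    using assms(2) by (auto simp: jet_def)
  show ?thesis
    unfolding jet_def by (rule exI[of _ "\<lambda>e. L (r e)"])
      (simp add: r clinearD[OF L] poly_curve_linear[OF L])
qed

lemma jet_bilinear: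
  assumes B: "cbilinear B" and c: "jet c v w" and d: "jet d v' w'"
  shows "jet (\<lambda>e. B (c e) (d e)) (B v v') (B w v' + B v w')"
proof -
  obtain r where r: "poly_curve r" "c = (\<lambda>e. v + e *\<^sub>C (w + e *\<^sub>C r e))"
    using c by (auto simp: jet_def)
  obtain s where s: "poly_curve s" "d = (\<lambda>e. v' + e *\<^sub>C (w' + e *\<^sub>C s e))"
    using d by (auto simp: jet_def)
  let ?q = "\<lambda>e. B w w' + B (r e) v' + B v (s e) + e *\<^sub>C (B (r e) w' + B w (s e) + e *\<^sub>C B (r e) (s e))"
  have "poly_curve ?q"
    by (intro poly_curve_add poly_curve_shift poly_curve_const poly_curve_bilinear[OF B] r s)
  moreover have "(\<lambda>e. B (c e) (d e)) = (\<lambda>e. B v v' + e *\<^sub>C (B w v' + B v w' + e *\<^sub>C ?q e))"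
    by (simp add: r s cbilinearD[OF B] scaleC_add_right scaleC_scaleC fun_eq_iff add_ac mult_ac)
  ultimately show ?thesis unfolding jet_def by blast
qed

lemma jet_sum:
  "(\<And>i. i \<in> A \<Longrightarrow> jet (c i) (v i) (w i)) \<Longrightarrow> jet (\<lambda>e. \<Sum>i\<in>A. c i e) (\<Sum>i\<in>A. v i) (\<Sum>i\<in>A. w i)"
proof (induction A rule: infinite_finite_induct)
  case (insert a A)
  then show ?case by (simp add: jet_add)
qed (simp_all add: jet_const)

text \<open>Every coefficient of a polynomial curve inside a subspace lies in that subspace. This
  puts derivatives of divided powers into the span of divided powers.\<close>

lemma jet_in_subspace:
  assumes P: "csubspace P" and "jet c v w" and "\<And>e. c e \<in> P"
  shows "w \<in> P"
proof -
  obtain r where r: "poly_curve r" "c = (\<lambda>e. v + e *\<^sub>C (w + e *\<^sub>C r e))"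
    using assms(2) by (auto simp: jet_def)
  have "poly_curve c" unfolding r(2) by (intro poly_curve.step r(1))
  obtain n q where q: "r = (\<lambda>e. \<Sum>k\<le>n. e ^ k *\<^sub>C q k)" using poly_curve_coeffs[OF r(1)] by blast
  define p where "p k = (case k of 0 \<Rightarrow> v | Suc j \<Rightarrow> (case j of 0 \<Rightarrow> w | Suc i \<Rightarrow> q i))" for k
  have "c e = (\<Sum>k\<le>Suc (Suc n). e ^ k *\<^sub>C p k)" for e
    by (simp add: r(2) q p_def sum.atMost_Suc_shift complex_vector.scale_sum_right scaleC_scaleC scaleC_one
        scaleC_add_right mult_ac del: sum.atMost_Suc)
  then have "p 1 \<in> P"
    using subspace_sum_coeffs[OF P, where n = "Suc (Suc n)" and r = p and k = 1] assms(3) by auto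
  then show ?thesis by (simp add: p_def)
qed

text \<open>The difference of the two expansions is a curve in the zero subspace. Uniqueness lets a
  formula be differentiated on both sides.\<close>

lemma jet_unique:
  assumes "jet c v w" "jet c v' w'"
  shows "w = w'"
proof -
  have "csubspace {0 :: 'a}" by (rule complex_vector.subspace_single_0)
  moreover have "jet (\<lambda>e. c e + (-1) *\<^sub>C c e) (v + (-1) *\<^sub>C v') (w + (-1) *\<^sub>C w')"
    by (intro jet_add assms jet_linear[OF clinear_scaleC[OF clinear_ident]])
  ultimately have "w + (-1) *\<^sub>C w' \<in> {0}"
    by (rule jet_in_subspace) (simp add: scaleC_one)
  then show ?thesis by (simp add: scaleC_one)
qed

lemma jet_power:
  fixes y w :: "'a::complex_algebra"
  shows "jet (\<lambda>e. (y + e *\<^sub>C w) ^ n) (y ^ n) (\<Sum>i<n. y ^ i * w * y ^ (n - Suc i))"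
proof (induction n)
  case 0
  then show ?case by (simp add: jet_const)
next
  case (Suc n)
  have "jet (\<lambda>e. (y + e *\<^sub>C w) * (y + e *\<^sub>C w) ^ n) (y * y ^ n)
      (w * y ^ n + y * (\<Sum>i<n. y ^ i * w * y ^ (n - Suc i)))"
    by (rule jet_bilinear[OF cbilinear_mult jet_affine Suc.IH])
  then show ?case
    by (simp add: sum.lessThan_Suc_shift sum_distrib_left mult.assoc del: sum.lessThan_Suc)
qed

lemma jet_ad_pow:
  "jet (\<lambda>e. ad_pow (y + e *\<^sub>C w) n z) (ad_pow y n z) (ad_pow_deriv y w n z)"
proof (induction n)
  case 0
  then show ?case by (simp add: jet_const)
next
  case (Suc n)
  show ?case
    using jet_bilinear[OF cbilinear_lie_bracket jet_affine Suc.IH, of y w] by simp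
qed

section \<open>Powers span the enveloping algebra\<close>

definition divpow :: "'g::complex_lie_algebra \<Rightarrow> nat \<Rightarrow> 'g uea"
  where "divpow y n = (1 / fact n) *\<^sub>C uea_incl y ^ n"

text \<open>The derivative of \<^term>\<open>divpow y n\<close> with respect to \<open>y\<close> in the direction \<open>w\<close>.\<close>

definition divpow_deriv :: "'g::complex_lie_algebra \<Rightarrow> 'g \<Rightarrow> nat \<Rightarrow> 'g uea"
  where "divpow_deriv y w n =
    (1 / fact n) *\<^sub>C (\<Sum>i<n. uea_incl y ^ i * uea_incl w * uea_incl y ^ (n - Suc i))"

lemmas uea_incl_linear = clinearD[OF clinear_uea_incl]

lemma jet_divpow: "jet (\<lambda>e. divpow (y + e *\<^sub>C w) n) (divpow y n) (divpow_deriv y w n)"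
  unfolding divpow_def divpow_deriv_def uea_incl_linear
  by (rule jet_linear[OF clinear_scaleC[OF clinear_ident] jet_power])

lemma divpow_0 [simp]: "divpow y 0 = 1"
  by (simp add: divpow_def scaleC_one)

lemma divpow_1 [simp]: "divpow y (Suc 0) = uea_incl y"
  by (simp add: divpow_def scaleC_one)

lemma divpow_Suc: "of_nat (Suc n) *\<^sub>C divpow y (Suc n) = uea_incl y * divpow y n"
proof -
  have "of_nat (Suc n) * (1 / fact (Suc n)) = (1 / fact n :: complex)"
    by (simp add: fact_Suc del: of_nat_Suc)
  then show ?thesis by (simp only: divpow_def scaleC_scaleC power_Suc scaleC_mult_right)
qed

lemma divpow_Suc2: "of_nat (Suc n) *\<^sub>C divpow y (Suc n) = divpow y n * uea_incl y"
  unfolding divpow_Suc by (simp add: divpow_def scaleC_mult_left scaleC_mult_right power_commutes)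

lemma divpow_deriv_Suc:
  "of_nat (Suc n) *\<^sub>C divpow_deriv y w (Suc n) = uea_incl w * divpow y n + uea_incl y * divpow_deriv y w n"
proof -
  have "of_nat (Suc n) * (1 / fact (Suc n)) = (1 / fact n :: complex)"
    by (simp add: fact_Suc del: of_nat_Suc)
  then show ?thesis
    by (simp only: divpow_deriv_def divpow_def scaleC_scaleC sum.lessThan_Suc_shift)
      (simp add: scaleC_mult_right scaleC_add_right sum_distrib_left mult.assoc)
qed

lemma scaleC_of_nat_cancel: "of_nat (Suc n) *\<^sub>C x = of_nat (Suc n) *\<^sub>C y \<Longrightarrow> x = y"
  by (simp del: of_nat_Suc)

text \<open>Degree n of w exp(y) = exp(y) (exp(-ad y) w).\<close>

lemma incl_mult_divpow:
  "uea_incl w * divpow y n = (\<Sum>k\<le>n. ((- 1) ^ k / fact k) *\<^sub>C (divpow y (n - k) * uea_incl (ad_pow y k w)))"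
proof (induction n)
  case 0
  then show ?case by (simp add: scaleC_one)
next
  case (Suc n)
  let ?N = "\<lambda>k. uea_incl (ad_pow y k w)" and ?c = "\<lambda>k. (- 1) ^ k / fact k :: complex"
  have comm: "?N k * uea_incl y = uea_incl y * ?N k - ?N (Suc k)" for k
    by (simp add: uea_incl_bracket)
  have "of_nat (Suc n) *\<^sub>C (uea_incl w * divpow y (Suc n)) = (uea_incl w * divpow y n) * uea_incl y"
    by (simp only: scaleC_mult_right[symmetric] divpow_Suc2 mult.assoc)
  also have "\<dots> = (\<Sum>k\<le>n. ?c k *\<^sub>C (divpow y (n - k) * (uea_incl y * ?N k - ?N (Suc k))))"
    by (simp only: Suc.IH sum_distrib_right scaleC_mult_left mult.assoc comm)
  also have "\<dots> = (\<Sum>k\<le>n. (?c k * of_nat (Suc n - k)) *\<^sub>C (divpow y (Suc n - k) * ?N k))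
      + (\<Sum>k\<le>n. (?c (Suc k) * of_nat (Suc k)) *\<^sub>C (divpow y (Suc n - Suc k) * ?N (Suc k)))"
    unfolding sum.distrib[symmetric]
  proof (rule sum.cong[OF refl])
    fix k assume "k \<in> {..n}"
    then have k: "Suc n - k = Suc (n - k)" by (simp add: Suc_diff_le)
    have "divpow y (n - k) * (uea_incl y * ?N k) = of_nat (Suc n - k) *\<^sub>C (divpow y (Suc n - k) * ?N k)"
      by (simp only: mult.assoc[symmetric] divpow_Suc2[symmetric] scaleC_mult_left k)
    moreover have "?c (Suc k) * of_nat (Suc k) = - ?c k"
      by (simp add: fact_Suc del: of_nat_Suc)
    ultimately show "?c k *\<^sub>C (divpow y (n - k) * (uea_incl y * ?N k - ?N (Suc k)))
        = (?c k * of_nat (Suc n - k)) *\<^sub>C (divpow y (Suc n - k) * ?N k)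
          + (?c (Suc k) * of_nat (Suc k)) *\<^sub>C (divpow y (Suc n - Suc k) * ?N (Suc k))"
      by (simp add: right_diff_distrib complex_vector.scale_right_diff_distrib scaleC_scaleC
          del: of_nat_Suc fact_Suc funpow.simps)
  qed
  also have "(\<Sum>k\<le>n. (?c k * of_nat (Suc n - k)) *\<^sub>C (divpow y (Suc n - k) * ?N k))
      = (\<Sum>k\<le>Suc n. (?c k * of_nat (Suc n - k)) *\<^sub>C (divpow y (Suc n - k) * ?N k))"
    by simp
  also have "(\<Sum>k\<le>n. (?c (Suc k) * of_nat (Suc k)) *\<^sub>C (divpow y (Suc n - Suc k) * ?N (Suc k)))
      = (\<Sum>k\<le>Suc n. (?c k * of_nat k) *\<^sub>C (divpow y (Suc n - k) * ?N k))"
    by (subst sum.atMost_Suc_shift) simp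
  \<comment> \<open>The weights n + 1 - k and k add up to the factor n + 1 introduced at the start,
    which then cancels.\<close>
  also have "(\<Sum>k\<le>Suc n. (?c k * of_nat (Suc n - k)) *\<^sub>C (divpow y (Suc n - k) * ?N k))
      + (\<Sum>k\<le>Suc n. (?c k * of_nat k) *\<^sub>C (divpow y (Suc n - k) * ?N k))
    = of_nat (Suc n) *\<^sub>C (\<Sum>k\<le>Suc n. ?c k *\<^sub>C (divpow y (Suc n - k) * ?N k))"
    unfolding sum.distrib[symmetric] complex_vector.scale_sum_right
  proof (rule sum.cong[OF refl])
    fix k assume "k \<in> {..Suc n}"
    then have "of_nat (Suc n - k) + of_nat k = (of_nat (Suc n) :: complex)"
      by (simp only: of_nat_add[symmetric]) simp
    then have "?c k * of_nat (Suc n - k) + ?c k * of_nat k = of_nat (Suc n) * ?c k"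
      unfolding distrib_left[symmetric] by (simp only: mult.commute)
    then show "(?c k * of_nat (Suc n - k)) *\<^sub>C (divpow y (Suc n - k) * ?N k)
        + (?c k * of_nat k) *\<^sub>C (divpow y (Suc n - k) * ?N k)
      = of_nat (Suc n) *\<^sub>C (?c k *\<^sub>C (divpow y (Suc n - k) * ?N k))"
      by (simp only: scaleC_add_left[symmetric] scaleC_scaleC)
  qed
  finally show ?case by (rule scaleC_of_nat_cancel)
qed

text \<open>The derivative of the exponential, \<open>d exp\<^sub>y w = exp y \<cdot> (1 - exp (- ad y)) / ad y \<cdot> w\<close>, and its inversion.\<close>

lemma divpow_deriv_eq:
  "divpow_deriv y w (Suc n) = (\<Sum>k\<le>n. dexp_coeff k *\<^sub>C (divpow y (n - k) * uea_incl (ad_pow y k w)))"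
proof (induction n)
  case 0
  then show ?case by (simp add: divpow_deriv_def scaleC_one)
next
  case (Suc n)
  let ?X = "\<lambda>k. divpow y (Suc n - k) * uea_incl (ad_pow y k w)"
  have "of_nat (Suc (Suc n)) *\<^sub>C divpow_deriv y w (Suc (Suc n))
    = uea_incl w * divpow y (Suc n) + uea_incl y * divpow_deriv y w (Suc n)"
    by (rule divpow_deriv_Suc)
  also have "uea_incl y * divpow_deriv y w (Suc n) = (\<Sum>k\<le>n. (dexp_coeff k * of_nat (Suc n - k)) *\<^sub>C ?X k)"
    unfolding Suc.IH sum_distrib_left
  proof (rule sum.cong[OF refl])
    fix k assume "k \<in> {..n}"
    then have "uea_incl y * divpow y (n - k) = of_nat (Suc n - k) *\<^sub>C divpow y (Suc n - k)"
      using divpow_Suc[of "n - k" y] by (simp add: Suc_diff_le)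
    then show "uea_incl y * dexp_coeff k *\<^sub>C (divpow y (n - k) * uea_incl (ad_pow y k w))
        = (dexp_coeff k * of_nat (Suc n - k)) *\<^sub>C ?X k"
      by (simp only: scaleC_mult_right mult.assoc[symmetric] scaleC_mult_left scaleC_scaleC)
  qed
  also have "\<dots> = (\<Sum>k\<le>Suc n. (dexp_coeff k * of_nat (Suc n - k)) *\<^sub>C ?X k)"
    by simp
  also have "uea_incl w * divpow y (Suc n) = (\<Sum>k\<le>Suc n. (dexp_coeff k * of_nat (Suc k)) *\<^sub>C ?X k)"
    unfolding incl_mult_divpow by (rule sum.cong) (simp_all add: dexp_coeff_def fact_Suc del: of_nat_Suc)
  also have "(\<Sum>k\<le>Suc n. (dexp_coeff k * of_nat (Suc k)) *\<^sub>C ?X k) + (\<Sum>k\<le>Suc n. (dexp_coeff k * of_nat (Suc n - k)) *\<^sub>C ?X k)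
    = of_nat (Suc (Suc n)) *\<^sub>C (\<Sum>k\<le>Suc n. dexp_coeff k *\<^sub>C ?X k)"
    unfolding sum.distrib[symmetric] complex_vector.scale_sum_right
  proof (rule sum.cong[OF refl])
    fix k assume "k \<in> {..Suc n}"
    then have "of_nat (Suc k) + of_nat (Suc n - k) = (of_nat (Suc (Suc n)) :: complex)"
      by (simp only: of_nat_add[symmetric]) simp
    then have "dexp_coeff k * of_nat (Suc k) + dexp_coeff k * of_nat (Suc n - k) = of_nat (Suc (Suc n)) * dexp_coeff k"
      unfolding distrib_left[symmetric] by (simp only: mult.commute)
    then show "(dexp_coeff k * of_nat (Suc k)) *\<^sub>C ?X k + (dexp_coeff k * of_nat (Suc n - k)) *\<^sub>C ?X k
      = of_nat (Suc (Suc n)) *\<^sub>C (dexp_coeff k *\<^sub>C ?X k)"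
      by (simp only: scaleC_add_left[symmetric] scaleC_scaleC)
  qed
  finally show ?case by (rule scaleC_of_nat_cancel)
qed

lemma sum_triangle:
  fixes F :: "nat \<Rightarrow> nat \<Rightarrow> 'a::comm_monoid_add"
  shows "(\<Sum>k\<le>n. \<Sum>r\<le>n - k. F k r) = (\<Sum>q\<le>n. \<Sum>k\<le>q. F k (q - k))"
proof -
  have "(\<Sum>k\<le>n. \<Sum>r\<le>n - k. F k r) = (\<Sum>(k, r)\<in>Sigma {..n} (\<lambda>k. {..n - k}). F k r)"
    by (rule sum.Sigma) auto
  also have "Sigma {..n} (\<lambda>k. {..n - k}) = {(i, j). i + j \<le> n}" by auto
  also have "(\<Sum>(k, r)\<in>{(i, j). i + j \<le> n}. F k r) = (\<Sum>q\<le>n. \<Sum>k\<le>q. F k (q - k))"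
    by (rule sum.triangle_reindex_eq)
  finally show ?thesis .
qed

text \<open>Right multiplication by g is the derivative of exp along T g: in
  \<open>divpow_deriv_eq\<close> the series T cancels (1 - exp(-ad y)) / ad y, leaving only the
  summand q = 0.\<close>

lemma divpow_mult_incl:
  "divpow y n * uea_incl g = (\<Sum>k\<le>n. todd_coeff k *\<^sub>C divpow_deriv y (ad_pow y k g) (Suc n - k))"
proof -
  let ?X = "\<lambda>q. divpow y (n - q) * uea_incl (ad_pow y q g)"
  have "(\<Sum>k\<le>n. todd_coeff k *\<^sub>C divpow_deriv y (ad_pow y k g) (Suc n - k))
    = (\<Sum>k\<le>n. \<Sum>r\<le>n - k. (todd_coeff k * dexp_coeff r) *\<^sub>C ?X (r + k))"
  proof (rule sum.cong[OF refl])
    fix k assume "k \<in> {..n}"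
    then show "todd_coeff k *\<^sub>C divpow_deriv y (ad_pow y k g) (Suc n - k)
      = (\<Sum>r\<le>n - k. (todd_coeff k * dexp_coeff r) *\<^sub>C ?X (r + k))"
      by (simp add: Suc_diff_le divpow_deriv_eq complex_vector.scale_sum_right scaleC_scaleC
          funpow_add diff_diff_add add.commute)
  qed
  also have "\<dots> = (\<Sum>q\<le>n. \<Sum>k\<le>q. (todd_coeff k * dexp_coeff (q - k)) *\<^sub>C ?X q)"
    unfolding sum_triangle by (rule sum.cong[OF refl], rule sum.cong[OF refl]) simp
  also have "\<dots> = (\<Sum>q\<le>n. (if q = 0 then 1 else 0) *\<^sub>C ?X q)"
    by (simp only: complex_vector.scale_sum_left[symmetric] todd_dexp_convolution)
  also have "\<dots> = ?X 0"
    by (subst sum.mono_neutral_right[of _ "{0}"]) (auto simp: scaleC_one)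
  finally show ?thesis by simp
qed

lemma uea_subalgebra_UNIV:
  assumes Q: "csubspace Q" and one: "1 \<in> Q" and incl: "\<And>g. uea_incl g \<in> Q"
    and mult: "\<And>x y. x \<in> Q \<Longrightarrow> y \<in> Q \<Longrightarrow> x * y \<in> Q"
  shows "u \<in> Q"
proof -
  obtain p where u: "u = abs_uea p" by (rule uea_obtain_rep)
  have words: "abs_uea (Poly_Mapping.single (Word xs) 1) \<in> Q" for xs
  proof (induction xs)
    case Nil
    have "abs_uea (Poly_Mapping.single (Word []) 1) = (1 :: 'a uea)"
      by (simp only: one_uea.abs_eq zero_free_monoid_def[symmetric] single_one)
    then show ?case using one by simp
  next
    case (Cons x xs)
    then show ?case
      using mult[OF incl[of x]] by (simp add: word_Cons_eq uea_incl.abs_eq flip: times_uea.abs_eq)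
  qed
  have lin: "clinear abs_uea"
    by (simp add: clinear_iff flip: plus_uea.abs_eq scaleC_uea.abs_eq)
  have "abs_uea p = (\<Sum>k\<in>Poly_Mapping.keys p. Poly_Mapping.lookup p k *\<^sub>C abs_uea (Poly_Mapping.single k 1))"
    by (subst free_expansion) (simp only: clinear_sum[OF lin] clinearD[OF lin])
  also have "\<dots> \<in> Q"
  proof (intro complex_vector.subspace_sum[OF Q] complex_vector.subspace_scale[OF Q])
    fix k
    show "abs_uea (Poly_Mapping.single k 1) \<in> Q" using words[of "letters k"] by simp
  qed
  finally show ?thesis by (simp only: u)
qed

text \<open>The span P of divided powers is stable under right multiplication by \<gg>, since
  \<open>divpow_mult_incl\<close> writes the product through derivatives of divided powers, which
  stay in P. As P contains 1, it is everything.\<close>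

lemma uea_divpow_induct:
  fixes Q :: "'g::complex_lie_algebra uea set"
  assumes Q: "csubspace Q" and gen: "\<And>y n. divpow y n \<in> Q"
  shows "u \<in> Q"
proof -
  define P where "P = cspan {divpow y n | (y :: 'g) n. True}"
  have P: "csubspace P" unfolding P_def by (rule complex_vector.subspace_span)
  have P_gen: "divpow y n \<in> P" for y n
    unfolding P_def by (rule complex_vector.span_base) blast
  have deriv: "divpow_deriv y w n \<in> P" for y w n
    by (rule jet_in_subspace[OF P jet_divpow P_gen])
  have incl: "x * uea_incl g \<in> P" if "x \<in> P" for x g
  proof -
    have "csubspace {x. x * uea_incl g \<in> P}"
      using P by (simp add: complex_vector.subspace_def distrib_right scaleC_mult_left)
    moreover have "divpow y n * uea_incl g \<in> P" for y n
      unfolding divpow_mult_incl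
      by (intro complex_vector.subspace_sum[OF P] complex_vector.subspace_scale[OF P] deriv)
    ultimately have "P \<subseteq> {x. x * uea_incl g \<in> P}"
      unfolding P_def by (intro complex_vector.span_minimal) auto
    with that show ?thesis by blast
  qed
  \<comment> \<open>The right stabilizer of P is a subalgebra that contains the generators.\<close>
  have "u \<in> {u. \<forall>x\<in>P. x * u \<in> P}"
  proof (rule uea_subalgebra_UNIV)
    show "csubspace {u. \<forall>x\<in>P. x * u \<in> P}"
      using P by (simp add: complex_vector.subspace_def distrib_left scaleC_mult_right)
    show "x * y \<in> {u. \<forall>x\<in>P. x * u \<in> P}"
      if "x \<in> {u. \<forall>x\<in>P. x * u \<in> P}" "y \<in> {u. \<forall>x\<in>P. x * u \<in> P}" for x y
      using that by (simp add: mult.assoc[symmetric])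
  qed (simp_all add: incl)
  then have "divpow y 0 * u \<in> P" for y using P_gen[of y 0] by blast
  then have "u \<in> P" by simp
  then show ?thesis
    using complex_vector.span_minimal[OF _ Q, of "{divpow y n | (y :: 'g) n. True}"] gen
    by (auto simp: P_def)
qed

lemma uea_divpow_ext:
  assumes "clinear F" "clinear G" "\<And>y n. F (divpow y n) = G (divpow y n)"
  shows "F u = G u"
proof -
  have "csubspace {u. F u = G u}"
    unfolding complex_vector.subspace_def
    using clinearD[OF assms(1)] clinearD[OF assms(2)] by simp
  then have "u \<in> {u. F u = G u}"
    by (rule uea_divpow_induct) (simp add: assms(3))
  then show ?thesis by simp
qed

text \<open>Differentiates a formula for F on divided powers. Together with
  \<open>divpow_mult_incl\<close> this computes F on products with elements of \<gg>.\<close>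

lemma clinear_jet_divpow:
  assumes F: "clinear F" and J: "jet (\<lambda>e. F (divpow (y + e *\<^sub>C w) n)) v v'"
  shows "F (divpow_deriv y w n) = v'"
  by (rule jet_unique[OF jet_linear[OF F jet_divpow] J])

section \<open>The Eulerian idempotent on powers\<close>

lemma algebra_homD:
  assumes "algebra_hom F"
  shows "clinear F" "F 1 = 1" "F (x * y) = F x * F y"
  using assms by (simp_all add: algebra_hom_def)

lemmas clinear_comult = algebra_homD(1)[OF comult(1)]
  and clinear_counit = algebra_homD(1)[OF counit(1)]

text \<open>exp y is group-like because y is primitive; with divided powers no binomial coefficients
  appear.\<close>

lemma comult_divpow: "comult (divpow y n) = (\<Sum>i\<le>n. divpow y i \<otimes> divpow y (n - i))"
proof (induction n)
  case 0
  show ?case by (simp add: algebra_homD(2)[OF comult(1)] one_tensor_def)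
next
  case (Suc n)
  let ?E = "divpow y" and ?Y = "uea_incl y"
  have hom: "comult (c *\<^sub>C u) = c *\<^sub>C comult u" "comult (u * v) = comult u * comult v" for c and u v :: "'a uea"
    by (simp_all add: algebra_homD(3)[OF comult(1)] clinearD[OF clinear_comult])
  have "of_nat (Suc n) *\<^sub>C comult (?E (Suc n)) = comult (?E n) * comult ?Y"
    by (simp only: hom(1)[symmetric] hom(2)[symmetric] divpow_Suc2)
  also have "\<dots> = (\<Sum>i\<le>n. (?E i * ?Y) \<otimes> ?E (n - i)) + (\<Sum>i\<le>n. ?E i \<otimes> (?E (n - i) * ?Y))"
    by (simp add: Suc.IH comult(2) sum_distrib_right distrib_left pure_tensor_mult sum.distrib)
  also have "(\<Sum>i\<le>n. (?E i * ?Y) \<otimes> ?E (n - i)) = (\<Sum>i\<le>Suc n. of_nat i *\<^sub>C (?E i \<otimes> ?E (Suc n - i)))"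
    by (subst sum.atMost_Suc_shift)
      (simp add: divpow_Suc2[symmetric] pure_tensor_bilinear del: of_nat_Suc)
  also have "(\<Sum>i\<le>n. ?E i \<otimes> (?E (n - i) * ?Y)) = (\<Sum>i\<le>Suc n. of_nat (Suc n - i) *\<^sub>C (?E i \<otimes> ?E (Suc n - i)))"
  proof -
    have "?E i \<otimes> (?E (n - i) * ?Y) = of_nat (Suc n - i) *\<^sub>C (?E i \<otimes> ?E (Suc n - i))" if "i \<le> n" for i
      by (simp only: divpow_Suc2[symmetric] pure_tensor_bilinear Suc_diff_le[OF that])
    then show ?thesis by simp
  qed
  also have "(\<Sum>i\<le>Suc n. of_nat i *\<^sub>C (?E i \<otimes> ?E (Suc n - i))) + (\<Sum>i\<le>Suc n. of_nat (Suc n - i) *\<^sub>C (?E i \<otimes> ?E (Suc n - i)))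
    = (\<Sum>i\<le>Suc n. of_nat (Suc n) *\<^sub>C (?E i \<otimes> ?E (Suc n - i)))"
    unfolding sum.distrib[symmetric]
  proof (rule sum.cong[OF refl])
    fix i assume "i \<in> {..Suc n}"
    then have "of_nat i + of_nat (Suc n - i) = (of_nat (Suc n) :: complex)"
      by (simp only: of_nat_add[symmetric]) simp
    then show "of_nat i *\<^sub>C (?E i \<otimes> ?E (Suc n - i)) + of_nat (Suc n - i) *\<^sub>C (?E i \<otimes> ?E (Suc n - i))
      = of_nat (Suc n) *\<^sub>C (?E i \<otimes> ?E (Suc n - i))"
      by (simp only: scaleC_add_left[symmetric])
  qed
  finally show ?case
    unfolding complex_vector.scale_sum_right[symmetric] by (rule scaleC_of_nat_cancel)
qed

lemma tensor_lift_sum_pure: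
  "cbilinear B \<Longrightarrow> tensor_lift B (\<Sum>i\<in>A. a i \<otimes> b i) = (\<Sum>i\<in>A. B (a i) (b i))"
  by (simp add: clinear_sum tensor_lift)

lemma tensor_lift_comult_divpow:
  "cbilinear B \<Longrightarrow> tensor_lift B (comult (divpow y n)) = (\<Sum>i\<le>n. B (divpow y i) (divpow y (n - i)))"
  unfolding comult_divpow by (rule tensor_lift_sum_pure)

lemma clinear_tensor_lift_comult: "cbilinear B \<Longrightarrow> clinear (\<lambda>x. tensor_lift B (comult x))"
  by (rule clinear_compose2[OF tensor_lift(1) clinear_comult])

lemma cbilinear_compose:
  assumes "cbilinear B" "clinear F" "clinear G"
  shows "cbilinear (\<lambda>a b. B (F a) (G b))"
  using assms by (simp add: cbilinear_def clinear_iff)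

lemma counit_divpow: "counit (divpow y n) = (if n = 0 then 1 else 0)"
proof -
  have hom: "counit (c *\<^sub>C u) = c * counit u" "counit (u * v) = counit u * counit v" "counit 1 = 1"
    for c and u v :: "'a uea"
    by (simp_all add: algebra_homD(2,3)[OF counit(1)] clinearD[OF clinear_counit])
  have "counit (uea_incl y ^ n) = (if n = 0 then 1 else 0)"
    by (cases n) (simp_all add: hom counit(2))
  then show ?thesis by (simp add: divpow_def hom)
qed

text \<open>
  On the maps with \<open>F (y\<^sup>n / n!) = c\<^sub>n y\<^sup>n\<close>, convolution is multiplication of the series \<open>\<Sum> c\<^sub>n u\<^sup>n\<close>:
  \<open>Id - \<eta>\<epsilon>\<close> becomes \<open>exp u - 1\<close>, and its logarithm \<open>pr\<close> becomes \<open>u\<close>.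
\<close>

definition power_diagonal :: "('g::complex_lie_algebra uea \<Rightarrow> 'g uea) \<Rightarrow> complex fps \<Rightarrow> bool"
  where "power_diagonal F c \<longleftrightarrow> clinear F \<and> (\<forall>y n. F (divpow y n) = fps_nth c n *\<^sub>C uea_incl y ^ n)"

lemma power_diagonalD:
  assumes "power_diagonal F c"
  shows "clinear F" "F (divpow y n) = fps_nth c n *\<^sub>C uea_incl y ^ n"
  using assms by (simp_all add: power_diagonal_def)

lemma power_diagonal_counit: "power_diagonal (\<lambda>x. counit x *\<^sub>C 1) 1"
  unfolding power_diagonal_def
  by (simp add: counit_divpow clinear_iff clinearD[OF clinear_counit] scaleC_add_left scaleC_scaleC scaleC_one)

lemma power_diagonal_reduced: "power_diagonal (\<lambda>x. x - counit x *\<^sub>C 1) (fps_exp 1 - 1)"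
proof -
  have "clinear (\<lambda>x. x - counit x *\<^sub>C 1)"
    by (intro clinear_minus clinear_ident power_diagonalD(1)[OF power_diagonal_counit])
  moreover have "divpow y n - counit (divpow y n) *\<^sub>C 1 = fps_nth (fps_exp 1 - 1) n *\<^sub>C uea_incl y ^ n"
    for y :: "'a::complex_lie_algebra" and n
    unfolding counit_divpow by (cases "n = 0") (simp_all add: divpow_def scaleC_one)
  ultimately show ?thesis by (simp add: power_diagonal_def)
qed

lemma power_diagonal_convolution:
  assumes F: "power_diagonal F c" and G: "power_diagonal G d"
  shows "power_diagonal (convolution F G) (c * d)"
proof -
  have B: "cbilinear (\<lambda>a b. F a * G b)"
    using F G by (intro cbilinear_compose[OF cbilinear_mult]) (simp_all add: power_diagonal_def)
  have lin: "clinear (convolution F G)"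
    unfolding convolution_def by (rule clinear_tensor_lift_comult[OF B])
  have "convolution F G (divpow y n) = fps_nth (c * d) n *\<^sub>C uea_incl y ^ n" for y n
  proof -
    have "convolution F G (divpow y n) = (\<Sum>i\<le>n. F (divpow y i) * G (divpow y (n - i)))"
      unfolding convolution_def by (rule tensor_lift_comult_divpow[OF B])
    also have "\<dots> = (\<Sum>i\<le>n. (fps_nth c i * fps_nth d (n - i)) *\<^sub>C uea_incl y ^ n)"
      using F G by (intro sum.cong)
        (simp_all add: power_diagonal_def scaleC_mult_left scaleC_mult_right scaleC_scaleC flip: power_add)
    finally show ?thesis
      by (simp add: fps_mult_nth atMost_atLeast0 complex_vector.scale_sum_left)
  qed
  with lin show ?thesis by (simp add: power_diagonal_def)
qed

lemma power_diagonal_conv_power: "power_diagonal F c \<Longrightarrow> power_diagonal (conv_power F n) (c ^ n)"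
  by (induction n) (simp_all add: power_diagonal_counit power_diagonal_convolution)

lemma clinear_Sum_any:
  assumes lin: "\<And>k. clinear (G k)" and fin: "\<And>x. finite {k. G k x \<noteq> 0}"
  shows "clinear (\<lambda>x. Sum_any (\<lambda>k. G k x))"
proof (rule clinearI)
  fix x y c
  show "Sum_any (\<lambda>k. G k (x + y)) = Sum_any (\<lambda>k. G k x) + Sum_any (\<lambda>k. G k y)"
    unfolding clinearD(1)[OF lin] by (rule Sum_any.distrib[OF fin fin])
  have "{k. G k (c *\<^sub>C x) \<noteq> 0} \<subseteq> {k. G k x \<noteq> 0}"
    by (auto simp: clinearD(2)[OF lin])
  then show "Sum_any (\<lambda>k. G k (c *\<^sub>C x)) = c *\<^sub>C Sum_any (\<lambda>k. G k x)"
    by (simp add: Sum_any.expand_superset[OF fin] Sum_any.expand_set[of "\<lambda>k. G k x"]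
        clinearD(2)[OF lin] complex_vector.scale_sum_right)
qed

text \<open>A series without constant term has an n-th power starting in degree n, so the n-th
  convolution power kills \<open>divpow y m\<close> for n > m. Spanning extends this local
  nilpotence to all of U\<gg> and gives the \<open>Sum_any\<close> series their meaning.\<close>

lemma finite_conv_power:
  assumes F: "power_diagonal F c" and c: "fps_nth c 0 = 0"
  shows "finite {n. conv_power F n x \<noteq> 0}"
proof -
  note diag = power_diagonal_conv_power[OF F]
  let ?Q = "{x. \<exists>N. \<forall>n\<ge>N. conv_power F n x = 0}"
  have "x \<in> ?Q"
  proof (rule uea_divpow_induct)
    show "csubspace ?Q"
      unfolding complex_vector.subspace_def
    proof (intro conjI ballI allI)
      show "0 \<in> ?Q" using diag by (auto simp: power_diagonal_def clinear_zero)
      fix u v assume "u \<in> ?Q" "v \<in> ?Q"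
      then obtain N M where "\<forall>n\<ge>N. conv_power F n u = 0" "\<forall>n\<ge>M. conv_power F n v = 0" by blast
      then have "\<forall>n\<ge>max N M. conv_power F n (u + v) = 0"
        using diag by (simp add: power_diagonal_def clinear_iff)
      then show "u + v \<in> ?Q" by blast
    next
      fix a u assume "u \<in> ?Q"
      then show "a *\<^sub>C u \<in> ?Q" using diag by (auto simp: power_diagonal_def clinear_iff)
    qed
    fix y m
    have "conv_power F n (divpow y m) = 0" if "n \<ge> Suc m" for n
      using diag[of n] startsby_zero_power_prefix[OF c, of n] that by (simp add: power_diagonal_def)
    then show "divpow y m \<in> ?Q" by blast
  qed
  then obtain N where "\<forall>n\<ge>N. conv_power F n x = 0" by blast
  then have "{n. conv_power F n x \<noteq> 0} \<subseteq> {..<N}" by (auto simp: not_le[symmetric])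
  then show ?thesis by (rule finite_subset) simp
qed

lemma power_diagonal_eulerian: "power_diagonal eulerian fps_X"
proof -
  let ?J = "\<lambda>x. x - counit x *\<^sub>C 1 :: 'a uea" and ?c = "\<lambda>k. (- 1) ^ k / of_nat (k + 1) :: complex"
  let ?e = "fps_exp 1 - 1 :: complex fps"
  have fin: "finite {n. conv_power ?J n x \<noteq> 0}" for x
    by (rule finite_conv_power[OF power_diagonal_reduced]) simp
  have "clinear (\<lambda>x. Sum_any (\<lambda>k. ?c k *\<^sub>C conv_power ?J (k + 1) x))"
  proof (rule clinear_Sum_any)
    show "clinear (\<lambda>x. ?c k *\<^sub>C conv_power ?J (k + 1) x)" for k
      by (intro clinear_scaleC power_diagonalD(1)[OF power_diagonal_conv_power[OF power_diagonal_reduced]])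
    have "{k. ?c k *\<^sub>C conv_power ?J (k + 1) x \<noteq> 0} \<subseteq> Suc -` {n. conv_power ?J n x \<noteq> 0}" for x
      by auto
    then show "finite {k. ?c k *\<^sub>C conv_power ?J (k + 1) x \<noteq> 0}" for x
      by (rule finite_subset) (intro finite_vimageI fin inj_Suc)
  qed
  then have lin: "clinear (eulerian :: 'a uea \<Rightarrow> _)"
    unfolding eulerian_def .
  have "eulerian (divpow y n) = fps_nth fps_X n *\<^sub>C uea_incl y ^ n" for y :: 'a and n
  proof -
    have pow: "conv_power ?J k (divpow y n) = fps_nth (?e ^ k) n *\<^sub>C uea_incl y ^ n" for k
      by (rule power_diagonalD(2)[OF power_diagonal_conv_power[OF power_diagonal_reduced]])
    have zero: "fps_nth (?e ^ Suc k) n = 0" if "n \<le> k" for k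
      using startsby_zero_power_prefix[of ?e "Suc k"] that by simp
    have "eulerian (divpow y n) = (\<Sum>k<n. ?c k *\<^sub>C conv_power ?J (k + 1) (divpow y n))"
      unfolding eulerian_def
      by (rule Sum_any.expand_superset) (auto simp only: pow zero Suc_eq_plus1[symmetric] not_le[symmetric]
          mem_Collect_eq lessThan_iff complex_vector.scale_zero_left complex_vector.scale_zero_right finite_lessThan)
    also have "\<dots> = (\<Sum>k<n. ?c k * fps_nth (?e ^ Suc k) n) *\<^sub>C uea_incl y ^ n"
      by (simp only: pow scaleC_scaleC complex_vector.scale_sum_left Suc_eq_plus1)
    \<comment> \<open>This is log(1 + z) at z = exp u - 1. The terms k >= n are absent because
      z^(k+1) starts in degree k + 1, and the index shift skips the vanishing constant term of the
      logarithm.\<close>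
    also have "(\<Sum>k<n. ?c k * fps_nth (?e ^ Suc k) n) = fps_nth (fps_ln 1 oo ?e) n"
    proof (cases n)
      case (Suc m)
      have "fps_nth (fps_ln 1 oo ?e) n = (\<Sum>k\<le>n. fps_nth (fps_ln 1) k * fps_nth (?e ^ k) n)"
        by (simp add: fps_compose_nth atMost_atLeast0)
      also have "\<dots> = (\<Sum>k\<le>m. fps_nth (fps_ln 1) (Suc k) * fps_nth (?e ^ Suc k) n)"
        unfolding Suc by (subst sum.atMost_Suc_shift) (simp add: fps_ln_nth)
      finally show ?thesis by (simp add: Suc fps_ln_nth lessThan_Suc_atMost)
    qed (simp add: fps_ln_nth)
    also have "fps_ln 1 oo ?e = fps_X"
      unfolding fps_ln_fps_exp_inv[of 1, simplified] by (rule fps_inv) simp_all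
    finally show ?thesis .
  qed
  with lin show ?thesis by (simp add: power_diagonal_def)
qed

text \<open>Divided by n!, these are the projectors onto the spans of the n-th powers; they separate
  the degrees in U\<gg>.\<close>

lemma conv_power_eulerian_divpow:
  "conv_power eulerian n (divpow y m) = (if m = n then uea_incl y ^ n else 0)"
  by (simp add: power_diagonalD(2)[OF power_diagonal_conv_power[OF power_diagonal_eulerian]]
      scaleC_one)

lemma finite_conv_power_eulerian: "finite {n. conv_power eulerian n x \<noteq> 0}"
  by (rule finite_conv_power[OF power_diagonal_eulerian]) simp

lemma clinear_eulerian: "clinear eulerian"
  by (rule power_diagonalD(1)[OF power_diagonal_eulerian])

lemma clinear_conv_power_eulerian: "clinear (conv_power eulerian n)"
  by (rule power_diagonalD(1)[OF power_diagonal_conv_power[OF power_diagonal_eulerian]])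

lemma eulerian_divpow: "eulerian (divpow y n) = (if n = 1 then uea_incl y else 0)"
  by (subst power_diagonalD(2)[OF power_diagonal_eulerian]) (simp add: scaleC_one)

lemma clinear_phi: "clinear (phi s)"
  unfolding phi_def
proof (rule clinear_Sum_any)
  show "clinear (\<lambda>x. conv_power eulerian n x \<otimes> smult (1 / fact n) (s ^ n))" for n
    by (rule clinear_compose2[OF cbilinear_left[OF cbilinear_pure_tensor] clinear_conv_power_eulerian])
  have "{n. conv_power eulerian n x \<otimes> smult (1 / fact n) (s ^ n) \<noteq> 0} \<subseteq> {n. conv_power eulerian n x \<noteq> 0}" for x
    by (auto simp: clinear_zero[OF cbilinear_left[OF cbilinear_pure_tensor]])
  then show "finite {n. conv_power eulerian n x \<otimes> smult (1 / fact n) (s ^ n) \<noteq> 0}" for x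
    by (rule finite_subset[OF _ finite_conv_power_eulerian])
qed

lemma phi_divpow: "phi s (divpow y m) = divpow y m \<otimes> s ^ m"
proof -
  have "phi s (divpow y m) = (\<Sum>n\<in>{m}. conv_power eulerian n (divpow y m) \<otimes> smult (1 / fact n) (s ^ n))"
    unfolding phi_def
    by (rule Sum_any.expand_superset)
      (auto simp: conv_power_eulerian_divpow clinear_zero[OF cbilinear_left[OF cbilinear_pure_tensor]])
  also have "\<dots> = uea_incl y ^ m \<otimes> ((1 / fact m) *\<^sub>C s ^ m)"
    by (simp add: conv_power_eulerian_divpow)
  also have "\<dots> = divpow y m \<otimes> s ^ m"
    by (simp only: pure_tensor_bilinear divpow_def)
  finally show ?thesis .
qed

section \<open>The Poincare--Birkhoff--Witt embedding\<close>

text \<open>\<open>uea_lift\<close> maps into a type of class \<open>complex_algebra\<close>, so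
  representations of U\<gg> require the linear endomorphisms as such a type.\<close>

typedef (overloaded) 'a cendo = "{F :: 'a::complex_vector \<Rightarrow> 'a. clinear F}"
  morphisms cendo_apply Abs_cendo
  using clinear_ident by blast

lemma clinear_cendo_apply: "clinear (cendo_apply F)"
  using cendo_apply by blast

lemma cendo_apply_Abs: "clinear F \<Longrightarrow> cendo_apply (Abs_cendo F) = F"
  by (simp add: Abs_cendo_inverse)

lemma cendo_eqI: "(\<And>x. cendo_apply F x = cendo_apply G x) \<Longrightarrow> F = G"
  by (simp add: cendo_apply_inject[symmetric] fun_eq_iff)

text \<open>The product is composition in the opposite order, which turns right modules into representations.\<close>

instantiation cendo :: (complex_vector) complex_algebra
begin
definition "0 = Abs_cendo (\<lambda>x::'a. 0)"
definition "1 = Abs_cendo (\<lambda>x::'a. x)"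
definition "F + G = Abs_cendo (\<lambda>x::'a. cendo_apply F x + cendo_apply G x)"
definition "F - G = Abs_cendo (\<lambda>x::'a. cendo_apply F x - cendo_apply G x)"
definition "- F = Abs_cendo (\<lambda>x::'a. - cendo_apply F x)"
definition "c *\<^sub>C F = Abs_cendo (\<lambda>x::'a. c *\<^sub>C cendo_apply F x)"
definition "F * G = Abs_cendo (\<lambda>x::'a. cendo_apply G (cendo_apply F x))"
instance
proof -
  have z: "cendo_apply (0 :: 'a cendo) = (\<lambda>x. 0)"
    unfolding zero_cendo_def by (rule cendo_apply_Abs[OF clinear_const_zero])
  have o: "cendo_apply (1 :: 'a cendo) = (\<lambda>x. x)"
    unfolding one_cendo_def by (rule cendo_apply_Abs[OF clinear_ident])
  have a: "cendo_apply (F + G) = (\<lambda>x. cendo_apply F x + cendo_apply G x)" for F G :: "'a cendo"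
    unfolding plus_cendo_def by (intro cendo_apply_Abs clinear_add clinear_cendo_apply)
  have m: "cendo_apply (F - G) = (\<lambda>x. cendo_apply F x - cendo_apply G x)" for F G :: "'a cendo"
    unfolding minus_cendo_def by (intro cendo_apply_Abs clinear_minus clinear_cendo_apply)
  have u: "cendo_apply (- F) = (\<lambda>x. - cendo_apply F x)" for F :: "'a cendo"
    unfolding uminus_cendo_def
    using clinear_minus[OF clinear_const_zero clinear_cendo_apply[of F]] by (simp add: cendo_apply_Abs)
  have s: "cendo_apply (c *\<^sub>C F) = (\<lambda>x. c *\<^sub>C cendo_apply F x)" for c and F :: "'a cendo"
    unfolding scaleC_cendo_def by (intro cendo_apply_Abs clinear_scaleC clinear_cendo_apply)
  have t: "cendo_apply (F * G) = (\<lambda>x. cendo_apply G (cendo_apply F x))" for F G :: "'a cendo"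
    unfolding times_cendo_def
    by (rule cendo_apply_Abs[OF clinear_compose2[OF clinear_cendo_apply clinear_cendo_apply]])
  note lin = clinearD[OF clinear_cendo_apply]
  show "OFCLASS('a cendo, complex_algebra_class)"
  proof
    fix F G H :: "'a cendo" and c d :: complex
    show "F + G + H = F + (G + H)" "F + G = G + F" "0 + F = F" "- F + F = 0" "F - G = F + - G"
      by (rule cendo_eqI, simp add: z a m u add_ac)+
    show "c *\<^sub>C (F + G) = c *\<^sub>C F + c *\<^sub>C G" "(c + d) *\<^sub>C F = c *\<^sub>C F + d *\<^sub>C F"
      "c *\<^sub>C (d *\<^sub>C F) = (c * d) *\<^sub>C F" "1 *\<^sub>C F = F"
      by (rule cendo_eqI, simp add: a s scaleC_add_right scaleC_add_left scaleC_scaleC scaleC_one)+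
    show "F * G * H = F * (G * H)" "(F + G) * H = F * H + G * H" "F * (G + H) = F * G + F * H" "1 * F = F" "F * 1 = F"
      by (rule cendo_eqI, simp add: o a t lin)+
    show "c *\<^sub>C F * G = c *\<^sub>C (F * G)" "F * c *\<^sub>C G = c *\<^sub>C (F * G)"
      by (rule cendo_eqI, simp add: s t lin)+
  qed
qed
end

lemma cendo_apply_simps:
  "cendo_apply (1 :: 'a::complex_vector cendo) x = x"
  "cendo_apply (F - G) x = cendo_apply F x - cendo_apply G x"
  "cendo_apply (c *\<^sub>C F) x = c *\<^sub>C cendo_apply F x"
  "cendo_apply (F + G) x = cendo_apply F x + cendo_apply G x"
  "cendo_apply (F * G) x = cendo_apply G (cendo_apply F x)"
  by (simp_all add: one_cendo_def minus_cendo_def scaleC_cendo_def plus_cendo_def times_cendo_def cendo_apply_Abs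
      clinear_ident clinear_minus clinear_scaleC clinear_add clinear_cendo_apply
      clinear_compose2[OF clinear_cendo_apply clinear_cendo_apply])

text \<open>The minus sign compensates for the reversed product and makes this a
  representation.\<close>

definition neg_ad :: "'g::complex_lie_algebra \<Rightarrow> 'g cendo"
  where "neg_ad g = Abs_cendo (\<lambda>v. - lie_bracket g v)"

lemma neg_ad_apply: "cendo_apply (neg_ad g) v = - lie_bracket g v"
  using clinear_minus[OF clinear_const_zero clinear_lie_bracket_right[of g]]
  by (simp add: neg_ad_def cendo_apply_Abs)

lemma uea_lift_neg_ad:
  fixes g :: "'a::complex_lie_algebra"
  shows "algebra_hom (uea_lift (neg_ad :: 'a \<Rightarrow> _))" "uea_lift neg_ad (uea_incl g) = neg_ad g"
proof -
  have lin: "clinear (neg_ad :: 'a \<Rightarrow> _)"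
  proof (rule clinearI)
    fix x y :: 'a and c
    show "neg_ad (x + y) = neg_ad x + neg_ad y" "neg_ad (c *\<^sub>C x) = c *\<^sub>C neg_ad x"
      by (rule cendo_eqI, simp add: neg_ad_apply cendo_apply_simps lie_bracket_add_left lie_bracket_scaleC_left)+
  qed
  have br: "neg_ad (lie_bracket x y) = neg_ad x * neg_ad y - neg_ad y * neg_ad x" for x y :: 'a
  proof (rule cendo_eqI)
    fix v
    show "cendo_apply (neg_ad (lie_bracket x y)) v = cendo_apply (neg_ad x * neg_ad y - neg_ad y * neg_ad x) v"
      using lie_bracket_derivation[of x y v]
      by (simp add: neg_ad_apply cendo_apply_simps clinearD[OF clinear_lie_bracket_right])
  qed
  show "algebra_hom (uea_lift (neg_ad :: 'a \<Rightarrow> _))"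
    by (rule uea_lift(1)) (rule lin, rule br)
  show "uea_lift neg_ad (uea_incl g) = neg_ad g"
    by (rule uea_lift(2)) (rule lin, rule br)
qed

lemma uea_lift_neg_ad_power:
  "cendo_apply (uea_lift neg_ad (uea_incl y ^ n)) v = (- 1) ^ n *\<^sub>C ad_pow y n v"
proof (induction n)
  case 0
  then show ?case by (simp add: algebra_homD(2)[OF uea_lift_neg_ad(1)] cendo_apply_simps scaleC_one)
next
  case (Suc n)
  have "uea_lift neg_ad (uea_incl y ^ Suc n) = uea_lift neg_ad (uea_incl y ^ n) * neg_ad y"
    by (simp only: power_Suc2 algebra_homD(3)[OF uea_lift_neg_ad(1)] uea_lift_neg_ad(2))
  then show ?case
    by (simp add: cendo_apply_simps Suc.IH neg_ad_apply lie_bracket_scaleC_right)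
qed

text \<open>The powers y^n satisfy many linear relations; rescaling them by degree is nevertheless a
  well-defined linear map because the Eulerian projectors separate the degrees.\<close>

definition power_scale :: "(nat \<Rightarrow> complex) \<Rightarrow> 'g::complex_lie_algebra uea \<Rightarrow> 'g uea"
  where "power_scale c x = Sum_any (\<lambda>n. c n *\<^sub>C conv_power eulerian n x)"

lemma clinear_power_scale: "clinear (power_scale c)"
  unfolding power_scale_def
proof (rule clinear_Sum_any)
  show "clinear (\<lambda>x. c n *\<^sub>C conv_power eulerian n x)" for n
    by (intro clinear_scaleC clinear_conv_power_eulerian)
  have "{n. c n *\<^sub>C conv_power eulerian n x \<noteq> 0} \<subseteq> {n. conv_power eulerian n x \<noteq> 0}" for x
    by auto
  then show "finite {n. c n *\<^sub>C conv_power eulerian n x \<noteq> 0}" for x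
    by (rule finite_subset[OF _ finite_conv_power_eulerian])
qed

lemma power_scale_divpow: "power_scale c (divpow y m) = c m *\<^sub>C uea_incl y ^ m"
proof -
  have "power_scale c (divpow y m) = (\<Sum>n\<in>{m}. c n *\<^sub>C conv_power eulerian n (divpow y m))"
    unfolding power_scale_def
    by (rule Sum_any.expand_superset) (auto simp: conv_power_eulerian_divpow)
  then show ?thesis by (simp add: conv_power_eulerian_divpow)
qed

text \<open>This is \<open>x, g \<mapsto> pr (x g)\<close>, with values in the Lie algebra before it is known to embed.\<close>

definition todd_act :: "'g::complex_lie_algebra uea \<Rightarrow> 'g \<Rightarrow> 'g"
  where "todd_act x g = cendo_apply (uea_lift neg_ad (power_scale (\<lambda>n. (- 1) ^ n * todd_coeff n) x)) g"

lemma clinear_todd_act_left: "clinear (\<lambda>x. todd_act x g)"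
  unfolding todd_act_def
  by (rule clinearI)
    (simp_all add: clinearD[OF clinear_power_scale] clinearD[OF algebra_homD(1)[OF uea_lift_neg_ad(1)]]
      cendo_apply_simps)

lemma clinear_todd_act_right: "clinear (todd_act x)"
  unfolding todd_act_def by (rule clinear_cendo_apply)

lemma todd_act_divpow: "todd_act (divpow y n) g = todd_coeff n *\<^sub>C ad_pow y n g"
proof -
  \<comment> \<open>The sign in the scaling factors undoes the sign that \<open>neg_ad\<close>
    produces on y^n.\<close>
  have "(- 1) ^ n * todd_coeff n * (- 1) ^ n = todd_coeff n"
    by (simp add: mult.commute mult.left_commute flip: power_mult_distrib)
  then show ?thesis
    by (simp only: todd_act_def power_scale_divpow clinearD[OF algebra_homD(1)[OF uea_lift_neg_ad(1)]]
        cendo_apply_simps uea_lift_neg_ad_power scaleC_scaleC)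
qed

lemma todd_act_divpow_deriv: "todd_act (divpow_deriv y w n) g = todd_coeff n *\<^sub>C ad_pow_deriv y w n g"
  by (rule clinear_jet_divpow[OF clinear_todd_act_left])
    (unfold todd_act_divpow, rule jet_linear[OF clinear_scaleC[OF clinear_ident] jet_ad_pow])

text \<open>On exp y, right multiplication by u differentiates T v along T u, so the identity is the
  vanishing of \<open>todd_defect\<close>.\<close>

lemma todd_act_commutator:
  "todd_act (x * uea_incl u) v - todd_act (x * uea_incl v) u = todd_act x (lie_bracket u v)"
proof (rule uea_divpow_ext[of "\<lambda>x. todd_act (x * uea_incl u) v - todd_act (x * uea_incl v) u"])
  show "clinear (\<lambda>x. todd_act (x * uea_incl u) v - todd_act (x * uea_incl v) u)"
    by (intro clinear_minus clinear_compose2[OF clinear_todd_act_left clinear_mult_left])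
  show "clinear (\<lambda>x. todd_act x (lie_bracket u v))" by (rule clinear_todd_act_left)
  fix y :: 'a and n
  have "todd_act (divpow y n * uea_incl a) b
    = (\<Sum>k\<le>n. (todd_coeff k * todd_coeff (Suc n - k)) *\<^sub>C ad_pow_deriv y (ad_pow y k a) (Suc n - k) b)" for a b
    by (simp only: divpow_mult_incl clinear_sum[OF clinear_todd_act_left] clinearD[OF clinear_todd_act_left]
        todd_act_divpow_deriv scaleC_scaleC)
  then have "todd_act (divpow y n * uea_incl u) v - todd_act (divpow y n * uea_incl v) u
      - todd_act (divpow y n) (lie_bracket u v) = todd_defect y u v n"
    by (simp add: todd_defect_def todd_act_divpow sum_subtractf complex_vector.scale_right_diff_distrib)
  then show "todd_act (divpow y n * uea_incl u) v - todd_act (divpow y n * uea_incl v) u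
      = todd_act (divpow y n) (lie_bracket u v)"
    by (simp add: todd_defect_eq_0)
qed

text \<open>
  By \<open>todd_act_commutator\<close>, \<open>(x, v) \<cdot> g = (x g, todd_act x g)\<close> makes \<open>U\<gg> \<oplus> \<gg>\<close> a right \<open>\<gg>\<close>-module, hence a
  right \<open>U\<gg>\<close>-module, in which \<open>(1, 0) \<cdot> g\<close> has second component \<open>g\<close>.
\<close>

theorem inj_uea_incl: "inj uea_incl"
proof (rule injI)
  fix a b :: 'a
  assume ab: "uea_incl a = uea_incl b"
  define R where "R g = Abs_cendo (\<lambda>p :: 'a uea \<times> 'a. (fst p * uea_incl g, todd_act (fst p) g))" for g
  have lin: "clinear (\<lambda>p :: 'a uea \<times> 'a. (fst p * uea_incl g, todd_act (fst p) g))" for g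
    by (rule clinearI)
      (simp_all add: distrib_right scaleC_prod_def scaleC_mult_left clinearD[OF clinear_todd_act_left])
  have R: "cendo_apply (R g) p = (fst p * uea_incl g, todd_act (fst p) g)" for g p
    by (simp add: R_def cendo_apply_Abs[OF lin])
  have linR: "clinear R"
  proof (rule clinearI)
    fix x y c
    show "R (x + y) = R x + R y" "R (c *\<^sub>C x) = c *\<^sub>C R x"
      by (rule cendo_eqI, simp add: R cendo_apply_simps uea_incl_linear distrib_left scaleC_mult_right
          scaleC_prod_def clinearD[OF clinear_todd_act_right])+
  qed
  have br: "R (lie_bracket x y) = R x * R y - R y * R x" for x y
    by (rule cendo_eqI)
      (simp add: R cendo_apply_simps uea_incl_bracket right_diff_distrib mult.assoc todd_act_commutator)
  have "snd (cendo_apply (R g) (1, 0)) = g" for g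
    using todd_act_divpow[of 0 0 g] by (simp add: R scaleC_one)
  then have "snd (cendo_apply (uea_lift R (uea_incl g)) (1, 0)) = g" for g
    by (subst uea_lift(2)) (rule linR, rule br)
  then show "a = b" using ab by metis
qed

section \<open>The forms \<open>A\<^sub>t\<close> on powers\<close>

lemma csubspace_vimage_range:
  assumes F: "clinear F" and G: "clinear G"
  shows "csubspace {x. F x \<in> range G}"
  unfolding complex_vector.subspace_def
proof (intro conjI ballI allI)
  show "0 \<in> {x. F x \<in> range G}"
    using clinearD(5)[OF F] clinearD(5)[OF G] by (simp add: image_iff) metis
next
  fix x y c assume "x \<in> {x. F x \<in> range G}" "y \<in> {x. F x \<in> range G}"
  then obtain a b where "F x = G a" "F y = G b" by blast
  then have "F (x + y) = G (a + b)"
    by (simp add: clinearD(1)[OF F] clinearD(1)[OF G])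
  then show "x + y \<in> {x. F x \<in> range G}" by blast
next
  fix x c assume "x \<in> {x. F x \<in> range G}"
  then obtain a where "F x = G a" by blast
  then have "F (c *\<^sub>C x) = G (c *\<^sub>C a)"
    by (simp add: clinearD(2)[OF F] clinearD(2)[OF G])
  then show "c *\<^sub>C x \<in> {x. F x \<in> range G}" by blast
qed

lemma eulerian_range: "eulerian x \<in> range uea_incl"
proof -
  have *: "eulerian (divpow y n) = uea_incl (if n = 1 then y else 0)" for y :: 'a and n
    by (simp add: eulerian_divpow uea_incl_linear)
  have "x \<in> {x. eulerian x \<in> range uea_incl}"
    by (rule uea_divpow_induct[OF csubspace_vimage_range[OF clinear_eulerian clinear_uea_incl]]) (simp add: *)
  then show ?thesis by simp
qed

lemma uea_incl_pr: "uea_incl (pr x) = eulerian x"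
  unfolding pr_def by (rule f_inv_into_f[OF eulerian_range])

lemma clinear_pr: "clinear pr"
proof (rule clinearI)
  fix x y :: "'a uea" and c
  show "pr (x + y) = pr x + pr y" "pr (c *\<^sub>C x) = c *\<^sub>C pr x"
    by (rule injD[OF inj_uea_incl], simp add: uea_incl_pr uea_incl_linear clinearD[OF clinear_eulerian])+
qed

lemma pr_divpow: "pr (divpow y n) = (if n = 1 then y else 0)"
  by (rule injD[OF inj_uea_incl]) (simp add: uea_incl_pr eulerian_divpow uea_incl_linear)

lemma tensor_map:
  assumes "clinear F" "clinear G"
  shows "clinear (tensor_map F G)" and "tensor_map F G (a \<otimes> b) = F a \<otimes> G b"
  unfolding tensor_map_def
  by (rule tensor_lift[OF cbilinear_compose[OF cbilinear_pure_tensor assms]])+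

text \<open>A linear splitting of \<open>uea_incl\<close> survives tensoring, so the inverse in
  \<open>A_form\<close> is taken of an injective map.\<close>

lemma tensor_map_incl_left_inverse:
  obtains R where "clinear R"
    "\<And>u. R (tensor_map uea_incl (\<lambda>p. p) (u :: ('g::complex_lie_algebra, 'p::complex_vector) tensor)) = u"
proof -
  obtain r :: "'g uea \<Rightarrow> 'g" where r: "clinear r" "\<And>x. r (uea_incl x) = x"
    using clinear_left_inverse[OF clinear_uea_incl inj_uea_incl] by blast
  note T = tensor_map[OF clinear_uea_incl clinear_ident] and R = tensor_map[OF r(1) clinear_ident]
  have "tensor_map r (\<lambda>p. p) (tensor_map uea_incl (\<lambda>p. p) u) = u" for u :: "('g, 'p) tensor"
    by (rule tensor_clinear_eqI[OF clinear_compose2[OF R(1) T(1)] clinear_ident])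
      (simp add: T(2) R(2) r(2))
  then show thesis using that[OF R(1)] by blast
qed

text \<open>A_t before it is pulled back to \<gg>; here linearity and values can be computed without
  any inverse.\<close>

definition A_form_uea :: "'g::complex_lie_algebra uea \<Rightarrow> 'g \<Rightarrow> ('g uea, complex poly) tensor"
  where "A_form_uea x g =
    tensor_lift (\<lambda>x1 x2. phi (- [:0, 1:]) x1 * phi [:0, 1:] (x2 * uea_incl g)) (comult x)"

lemma cbilinear_A_form_uea:
  "cbilinear (\<lambda>x1 x2. phi (- [:0, 1:]) x1 * phi [:0, 1:] (x2 * uea_incl g))"
  by (rule cbilinear_compose[OF cbilinear_mult clinear_phi clinear_compose2[OF clinear_phi clinear_mult_left]])

lemma clinear_A_form_uea: "clinear (\<lambda>x. A_form_uea x g)"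
  unfolding A_form_uea_def by (rule clinear_tensor_lift_comult[OF cbilinear_A_form_uea])

lemma phi_divpow_deriv: "phi s (divpow_deriv y w n) = divpow_deriv y w n \<otimes> s ^ n"
  by (rule clinear_jet_divpow[OF clinear_phi])
    (unfold phi_divpow, rule jet_linear[OF cbilinear_left[OF cbilinear_pure_tensor] jet_divpow])

lemma divpow_mult: "divpow y i * divpow y j = of_nat ((i + j) choose i) *\<^sub>C divpow y (i + j)"
proof -
  have "of_nat ((i + j) choose i) * (1 / fact (i + j)) = (1 / fact i * (1 / fact j) :: complex)"
    by (simp add: binomial_fact)
  then show ?thesis
    by (simp only: divpow_def scaleC_mult_left scaleC_mult_right scaleC_scaleC power_add mult.commute)
qed

text \<open>\<phi>_s(exp(y) g) = exp(s y) A_s g: the map \<phi>_s turns the derivative of exp y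
  along T g into that of exp(s y), which is exp(s y) times (1 - exp(-s ad y)) / ad y applied to T g.
  As s is itself a polynomial, A_s is a composition.\<close>

lemma phi_divpow_mult_incl:
  "phi s (divpow y n * uea_incl g) =
    (\<Sum>q\<le>n. (divpow y (n - q) \<otimes> s ^ (n - q)) * (uea_incl (ad_pow y q g) \<otimes> pcompose (todd_poly q) s))"
proof -
  let ?X = "\<lambda>q. divpow y (n - q) * uea_incl (ad_pow y q g)"
  have summand: "todd_coeff k *\<^sub>C phi s (divpow_deriv y (ad_pow y k g) (Suc n - k))
      = (\<Sum>r\<le>n - k. ?X (r + k) \<otimes> smult (todd_coeff k * dexp_coeff r) (s ^ (n - (r + k)) * s ^ Suc r))"
    if "k \<le> n" for k
  proof -
    have k: "Suc n - k = Suc (n - k)" using that by (simp add: Suc_diff_le)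
    have D: "divpow_deriv y (ad_pow y k g) (Suc (n - k)) = (\<Sum>r\<le>n - k. dexp_coeff r *\<^sub>C ?X (r + k))"
      unfolding divpow_deriv_eq by (simp add: funpow_add add.commute)
    \<comment> \<open>The exponent splits into the degree n - (r + k) of exp(s y) and the r + 1 that
      belongs to A_s.\<close>
    have pw: "s ^ Suc (n - k) = s ^ (n - (r + k)) * s ^ Suc r" if "r \<le> n - k" for r
    proof -
      have "Suc (n - k) = (n - (r + k)) + Suc r" using that by simp
      then show ?thesis by (simp only: power_add)
    qed
    have "todd_coeff k *\<^sub>C phi s (divpow_deriv y (ad_pow y k g) (Suc n - k))
      = (\<Sum>r\<le>n - k. ?X (r + k) \<otimes> smult (todd_coeff k * dexp_coeff r) (s ^ Suc (n - k)))"
    proof -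
      have "todd_coeff k *\<^sub>C phi s (divpow_deriv y (ad_pow y k g) (Suc n - k))
        = todd_coeff k *\<^sub>C ((\<Sum>r\<le>n - k. dexp_coeff r *\<^sub>C ?X (r + k)) \<otimes> s ^ Suc (n - k))"
        by (simp only: k phi_divpow_deriv) (simp only: D)
      also have "\<dots> = (\<Sum>r\<le>n - k. todd_coeff k *\<^sub>C ((dexp_coeff r *\<^sub>C ?X (r + k)) \<otimes> s ^ Suc (n - k)))"
        by (simp only: clinear_sum[OF cbilinear_left[OF cbilinear_pure_tensor]] complex_vector.scale_sum_right)
      also have "\<dots> = (\<Sum>r\<le>n - k. ?X (r + k) \<otimes> smult (todd_coeff k * dexp_coeff r) (s ^ Suc (n - k)))"
        by (simp only: scaleC_complex_poly[symmetric] pure_tensor_bilinear scaleC_scaleC)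
      finally show ?thesis .
    qed
    also have "\<dots> = (\<Sum>r\<le>n - k. ?X (r + k) \<otimes> smult (todd_coeff k * dexp_coeff r) (s ^ (n - (r + k)) * s ^ Suc r))"
      by (rule sum.cong[OF refl]) (simp only: pw atMost_iff)
    finally show ?thesis .
  qed
  have "phi s (divpow y n * uea_incl g)
    = (\<Sum>k\<le>n. todd_coeff k *\<^sub>C phi s (divpow_deriv y (ad_pow y k g) (Suc n - k)))"
    by (simp only: divpow_mult_incl clinear_sum[OF clinear_phi] clinearD(2)[OF clinear_phi])
  also have "\<dots> = (\<Sum>k\<le>n. \<Sum>r\<le>n - k. ?X (r + k) \<otimes> smult (todd_coeff k * dexp_coeff r) (s ^ (n - (r + k)) * s ^ Suc r))"
    by (rule sum.cong[OF refl]) (simp only: summand atMost_iff)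
  also have "\<dots> = (\<Sum>q\<le>n. \<Sum>k\<le>q. ?X q \<otimes> smult (todd_coeff k * dexp_coeff (q - k)) (s ^ (n - q) * s ^ Suc (q - k)))"
    by (rule trans[OF sum_triangle], rule sum.cong[OF refl], rule sum.cong[OF refl])
      (simp only: le_add_diff_inverse2 atMost_iff)
  also have "\<dots> = (\<Sum>q\<le>n. (divpow y (n - q) \<otimes> s ^ (n - q)) * (uea_incl (ad_pow y q g) \<otimes> pcompose (todd_poly q) s))"
  proof (rule sum.cong[OF refl])
    fix q
    have "pcompose (monom c k) s = smult c (s ^ k)" for c k
      by (induction k) (simp_all add: monom_0 monom_Suc pcompose_pCons)
    then have "pcompose (todd_poly q) s = (\<Sum>k\<le>q. smult (todd_coeff k * dexp_coeff (q - k)) (s ^ Suc (q - k)))"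
      by (simp only: todd_poly_def pcompose_sum)
    then have "s ^ (n - q) * pcompose (todd_poly q) s
      = (\<Sum>k\<le>q. smult (todd_coeff k * dexp_coeff (q - k)) (s ^ (n - q) * s ^ Suc (q - k)))"
      by (simp only: sum_distrib_left mult_smult_right)
    then show "(\<Sum>k\<le>q. ?X q \<otimes> smult (todd_coeff k * dexp_coeff (q - k)) (s ^ (n - q) * s ^ Suc (q - k)))
      = (divpow y (n - q) \<otimes> s ^ (n - q)) * (uea_incl (ad_pow y q g) \<otimes> pcompose (todd_poly q) s)"
      by (simp only: pure_tensor_mult clinear_sum[OF cbilinear_right[OF cbilinear_pure_tensor]])
  qed
  finally show ?thesis .
qed

text \<open>exp(-s y) exp(s y) = 1, which in degree n is the binomial theorem for (-s +
  s)^n.\<close>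

lemma phi_minus_phi_convolution:
  fixes s :: "complex poly"
  shows "(\<Sum>i\<le>n. (divpow y i \<otimes> (- s) ^ i) * (divpow y (n - i) \<otimes> s ^ (n - i))) = (if n = 0 then 1 else 0)"
proof -
  have "(\<Sum>i\<le>n. (divpow y i \<otimes> (- s) ^ i) * (divpow y (n - i) \<otimes> s ^ (n - i)))
    = (\<Sum>i\<le>n. divpow y n \<otimes> (of_nat (n choose i) * (- s) ^ i * s ^ (n - i)))"
  proof (rule sum.cong[OF refl])
    fix i assume "i \<in> {..n}"
    then have "divpow y i * divpow y (n - i) = of_nat (n choose i) *\<^sub>C divpow y n"
      by (simp add: divpow_mult)
    then have "(divpow y i \<otimes> (- s) ^ i) * (divpow y (n - i) \<otimes> s ^ (n - i))
      = divpow y n \<otimes> smult (of_nat (n choose i)) ((- s) ^ i * s ^ (n - i))"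
      by (simp only: pure_tensor_mult pure_tensor_bilinear flip: scaleC_complex_poly)
    also have "smult (of_nat (n choose i)) ((- s) ^ i * s ^ (n - i)) = of_nat (n choose i) * (- s) ^ i * s ^ (n - i)"
      by (simp add: of_nat_poly mult.assoc)
    finally show "(divpow y i \<otimes> (- s) ^ i) * (divpow y (n - i) \<otimes> s ^ (n - i))
      = divpow y n \<otimes> (of_nat (n choose i) * (- s) ^ i * s ^ (n - i))" .
  qed
  also have "\<dots> = divpow y n \<otimes> (- s + s) ^ n"
    by (simp only: clinear_sum[OF cbilinear_right[OF cbilinear_pure_tensor], symmetric] binomial_ring)
  also have "\<dots> = (if n = 0 then 1 else 0)"
    using clinear_zero[OF cbilinear_right[OF cbilinear_pure_tensor]]
    by (auto simp: one_tensor_def power_0_left)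
  finally show ?thesis .
qed

lemma sum_flip_atMost: "(\<Sum>k\<le>q. G k) = (\<Sum>k\<le>q. G (q - k))" for G :: "nat \<Rightarrow> 'a::comm_monoid_add"
  by (rule sum.reindex_bij_witness[of _ "\<lambda>k. q - k" "\<lambda>k. q - k"]) auto

lemma sum_triangle_swap:
  fixes F :: "nat \<Rightarrow> nat \<Rightarrow> 'a::comm_monoid_add"
  shows "(\<Sum>i\<le>n. \<Sum>q\<le>n - i. F i q) = (\<Sum>q\<le>n. \<Sum>i\<le>n - q. F i q)"
proof -
  have "(\<Sum>i\<le>n. \<Sum>q\<le>n - i. F i q) = (\<Sum>q\<le>n. \<Sum>k\<le>q. F (q - k) (q - (q - k)))"
    by (rule trans[OF sum_triangle], rule sum.cong[OF refl], rule sum_flip_atMost)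
  also have "\<dots> = (\<Sum>q\<le>n. \<Sum>i\<le>n - q. F i q)"
    by (rule sym, rule trans[OF sum_triangle]) (simp cong: sum.cong_simp)
  finally show ?thesis .
qed

text \<open>exp(-t y) cancels exp(t y) in exp(-t y) exp(t y) A_t g; summing over i first isolates
  this product.\<close>

lemma A_form_uea_divpow:
  "A_form_uea (divpow y n) g = uea_incl (ad_pow y n g) \<otimes> todd_poly n"
proof -
  let ?t = "[:0, 1:] :: complex poly"
  let ?E = "\<lambda>s i. divpow y i \<otimes> s ^ i" and ?V = "\<lambda>q. uea_incl (ad_pow y q g) \<otimes> todd_poly q"
  have "A_form_uea (divpow y n) g = (\<Sum>i\<le>n. ?E (- ?t) i * (\<Sum>q\<le>n - i. ?E ?t (n - i - q) * ?V q))"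
    unfolding A_form_uea_def tensor_lift_comult_divpow[OF cbilinear_A_form_uea] phi_divpow_mult_incl
    by (simp only: phi_divpow pcompose_idR)
  also have "\<dots> = (\<Sum>i\<le>n. \<Sum>q\<le>n - i. ?E (- ?t) i * ?E ?t (n - i - q) * ?V q)"
    by (simp only: sum_distrib_left mult.assoc)
  also have "\<dots> = (\<Sum>q\<le>n. \<Sum>i\<le>n - q. ?E (- ?t) i * ?E ?t (n - i - q) * ?V q)"
    by (rule sum_triangle_swap)
  also have "\<dots> = (\<Sum>q\<le>n. (\<Sum>i\<le>n - q. ?E (- ?t) i * ?E ?t (n - q - i)) * ?V q)"
    by (simp only: sum_distrib_right diff_commute)
  also have "\<dots> = (\<Sum>q\<le>n. (if n - q = 0 then 1 else 0) * ?V q)"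
    by (simp only: phi_minus_phi_convolution)
  also have "\<dots> = (\<Sum>q\<in>{n}. (if n - q = 0 then 1 else 0) * ?V q)"
    by (rule sum.mono_neutral_right) auto
  finally show ?thesis by simp
qed

lemma A_form_incl: "tensor_map uea_incl (\<lambda>p. p) (A_form x g) = A_form_uea x g"
  and clinear_A_form: "clinear (\<lambda>x. A_form x g)"
proof -
  let ?T = "tensor_map uea_incl (\<lambda>p. p) :: ('a, complex poly) tensor \<Rightarrow> _"
  have T: "clinear ?T" "\<And>a b. ?T (a \<otimes> b) = uea_incl a \<otimes> b"
    by (rule tensor_map[OF clinear_uea_incl clinear_ident])+
  obtain R where R: "clinear R" "\<And>u. R (?T u) = u"
    using tensor_map_incl_left_inverse by blast
  have inj: "inj ?T" by (metis R(2) injI)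
  have E: "A_form_uea (divpow y n) g = ?T (ad_pow y n g \<otimes> todd_poly n)" for y n
    by (simp only: A_form_uea_divpow T(2))
  have "x \<in> {x. A_form_uea x g \<in> range ?T}" for x
    by (rule uea_divpow_induct[OF csubspace_vimage_range[OF clinear_A_form_uea T(1)]]) (simp add: E)
  then have range: "A_form_uea x g \<in> range ?T" for x by simp
  have A: "A_form x g = inv ?T (A_form_uea x g)" for x
    by (simp add: A_form_def A_form_uea_def)
  then have *: "?T (A_form x g) = A_form_uea x g" for x
    using range by (simp add: f_inv_into_f)
  then show "?T (A_form x g) = A_form_uea x g" .
  \<comment> \<open>On the range the inverse agrees with a linear left inverse, hence it is linear
    there.\<close>
  have "A_form x g = R (A_form_uea x g)" for x using R(2) *[of x] by metis
  then show "clinear (\<lambda>x. A_form x g)"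
    using clinear_compose2[OF R(1) clinear_A_form_uea] by simp
qed

lemma A_form_divpow: "A_form (divpow y n) g = ad_pow y n g \<otimes> todd_poly n"
proof -
  obtain R where "clinear R" and R: "\<And>u. R (tensor_map uea_incl (\<lambda>p. p) (u :: ('a, complex poly) tensor)) = u"
    using tensor_map_incl_left_inverse by blast
  have "tensor_map uea_incl (\<lambda>p. p) (A_form (divpow y n) g)
    = tensor_map uea_incl (\<lambda>p. p) (ad_pow y n g \<otimes> todd_poly n)"
    by (simp only: A_form_incl A_form_uea_divpow tensor_map(2)[OF clinear_uea_incl clinear_ident])
  then show ?thesis using R by metis
qed

section \<open>The integrand on powers\<close>

lemma clinear_tensor_lift_param:
  assumes bil: "\<And>p. cbilinear (B p)" and lin: "\<And>a b. clinear (\<lambda>p. B p a b)"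
  shows "clinear (\<lambda>p. tensor_lift (B p) w)"
proof (rule clinearI)
  fix p q c
  show "tensor_lift (B (p + q)) w = tensor_lift (B p) w + tensor_lift (B q) w"
    by (rule tensor_clinear_eqI[OF tensor_lift(1)[OF bil] clinear_add[OF tensor_lift(1)[OF bil] tensor_lift(1)[OF bil]]])
      (simp add: tensor_lift(2)[OF bil] clinearD(1)[OF lin])
  show "tensor_lift (B (c *\<^sub>C p)) w = c *\<^sub>C tensor_lift (B p) w"
    by (rule tensor_clinear_eqI[OF tensor_lift(1)[OF bil] clinear_scaleC[OF tensor_lift(1)[OF bil]]])
      (simp only: tensor_lift(2)[OF bil] clinearD(2)[OF lin])
qed

definition ctrilinear :: "('a::complex_vector \<Rightarrow> 'b::complex_vector \<Rightarrow> 'c::complex_vector \<Rightarrow> 'd::complex_vector) \<Rightarrow> bool"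
  where "ctrilinear T \<longleftrightarrow> (\<forall>b c. clinear (\<lambda>a. T a b c)) \<and> (\<forall>a c. clinear (\<lambda>b. T a b c)) \<and> (\<forall>a b. clinear (T a b))"

lemma ctrilinearD:
  assumes "ctrilinear T"
  shows "clinear (\<lambda>a. T a b c)" "clinear (\<lambda>b. T a b c)" "clinear (T a b)" "cbilinear (T a)"
  using assms by (simp_all add: ctrilinear_def cbilinear_def)

lemma cbilinear_tensor_lift_ctrilinear:
  assumes "ctrilinear T"
  shows "cbilinear (\<lambda>a. tensor_lift (T a))"
  unfolding cbilinear_def
  using tensor_lift(1)[OF ctrilinearD(4)[OF assms]]
    clinear_tensor_lift_param[OF ctrilinearD(4)[OF assms] ctrilinearD(1)[OF assms]] by blast

text \<open>A trilinear map is bilinear in its first argument and the tensor product of the other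
  two, so the bilinear product rule applies twice.\<close>

lemma jet_ctrilinear:
  assumes T: "ctrilinear T" and "jet c1 v1 w1" "jet c2 v2 w2" "jet c3 v3 w3"
  shows "jet (\<lambda>e. T (c1 e) (c2 e) (c3 e)) (T v1 v2 v3) (T w1 v2 v3 + (T v1 w2 v3 + T v1 v2 w3))"
proof -
  note B = cbilinear_tensor_lift_ctrilinear[OF T] and L = tensor_lift[OF ctrilinearD(4)[OF T]]
  have "jet (\<lambda>e. tensor_lift (T (c1 e)) (c2 e \<otimes> c3 e)) (tensor_lift (T v1) (v2 \<otimes> v3))
      (tensor_lift (T w1) (v2 \<otimes> v3) + tensor_lift (T v1) (w2 \<otimes> v3 + v2 \<otimes> w3))"
    by (rule jet_bilinear[OF B assms(2) jet_bilinear[OF cbilinear_pure_tensor assms(3,4)]])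
  then show ?thesis by (simp only: L(2) clinearD(1)[OF L(1)])
qed

lemma smult_sum_right: "smult c (sum P A) = (\<Sum>i\<in>A. smult c (P i))"
  by (induction A rule: infinite_finite_induct) (simp_all add: smult_add_right)

lemma poly_extend:
  assumes f: "ctrilinear f"
  shows "ctrilinear (poly_extend f)"
    and "poly_extend f (a \<otimes> p) (b \<otimes> q) (c \<otimes> r) = smult (f a b c) (p * q * r)"
proof -
  have f_add: "f (a + a') b c = f a b c + f a' b c" "f a (b + b') c = f a b c + f a b' c"
      "f a b (c + c') = f a b c + f a b c'"
    and f_scale: "f (s *\<^sub>C a) b c = s * f a b c" "f a (s *\<^sub>C b) c = s * f a b c" "f a b (s *\<^sub>C c) = s * f a b c"
    for a a' b b' c c' s
    using clinearD(1,2)[OF ctrilinearD(1)[OF f]] clinearD(1,2)[OF ctrilinearD(2)[OF f]]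
      clinearD(1,2)[OF ctrilinearD(3)[OF f]] by simp_all
  define C1 where "C1 w a p b q = tensor_lift (\<lambda>c r. smult (f a b c) (p * q * r)) w" for w a p b q
  have b1: "cbilinear (\<lambda>c r. smult (f a b c) (p * q * r))" for a b p q
    by (rule cbilinearI) (simp_all add: f_add f_scale smult_add_left algebra_simps smult_add_right)
  have C1_w: "clinear (\<lambda>w. C1 w a p b q)" for a p b q
    unfolding C1_def by (rule tensor_lift(1)[OF b1])
  have C1_pure: "C1 (c \<otimes> r) a p b q = smult (f a b c) (p * q * r)" for c r a p b q
    unfolding C1_def by (rule tensor_lift(2)[OF b1])
  have C1_a: "clinear (\<lambda>a. C1 w a p b q)" for w p b q
    unfolding C1_def by (rule clinear_tensor_lift_param[OF b1])
      (simp add: clinear_iff f_add f_scale smult_add_left)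
  have C1_p: "clinear (\<lambda>p. C1 w a p b q)" for w a b q
    unfolding C1_def by (rule clinear_tensor_lift_param[OF b1])
      (simp add: clinear_iff algebra_simps smult_add_right)
  have C1_b: "clinear (\<lambda>b. C1 w a p b q)" for w a p q
    unfolding C1_def by (rule clinear_tensor_lift_param[OF b1])
      (simp add: clinear_iff f_add f_scale smult_add_left)
  have C1_q: "clinear (\<lambda>q. C1 w a p b q)" for w a p b
    unfolding C1_def by (rule clinear_tensor_lift_param[OF b1])
      (simp add: clinear_iff algebra_simps smult_add_right)
  have b2: "cbilinear (C1 w a p)" for w a p
    using C1_b C1_q by (simp add: cbilinear_def)
  define C2 where "C2 v w a p = tensor_lift (C1 w a p) v" for v w a p
  have C2_v: "clinear (\<lambda>v. C2 v w a p)" for w a p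
    unfolding C2_def by (rule tensor_lift(1)[OF b2])
  have C2_pure: "C2 (b \<otimes> q) w a p = C1 w a p b q" for b q w a p
    unfolding C2_def by (rule tensor_lift(2)[OF b2])
  have C2_w: "clinear (\<lambda>w. C2 v w a p)" for v a p
    unfolding C2_def by (rule clinear_tensor_lift_param[OF b2 C1_w])
  have C2_a: "clinear (\<lambda>a. C2 v w a p)" for v w p
    unfolding C2_def by (rule clinear_tensor_lift_param[OF b2 C1_a])
  have C2_p: "clinear (\<lambda>p. C2 v w a p)" for v w a
    unfolding C2_def by (rule clinear_tensor_lift_param[OF b2 C1_p])
  have b3: "cbilinear (C2 v w)" for v w
    using C2_a C2_p by (simp add: cbilinear_def)
  have pe: "poly_extend f u v w = tensor_lift (C2 v w) u" for u v w
    unfolding poly_extend_def C2_def C1_def ..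
  show "ctrilinear (poly_extend f)"
    unfolding ctrilinear_def pe
    by (intro conjI allI tensor_lift(1)[OF b3] clinear_tensor_lift_param[OF b3 C2_v] clinear_tensor_lift_param[OF b3 C2_w])
  show "poly_extend f (a \<otimes> p) (b \<otimes> q) (c \<otimes> r) = smult (f a b c) (p * q * r)"
    unfolding pe tensor_lift(2)[OF b3] C2_pure C1_pure ..
qed

lemma alpha_integrand:
  assumes f: "ctrilinear f"
  shows "clinear (alpha_integrand f g1 g2)"
    and "alpha_integrand f g1 g2 (divpow y n) =
      (\<Sum>j<n. smult (f y (ad_pow y j g1) (ad_pow y (n - Suc j) g2)) (todd_poly j * todd_poly (n - Suc j)))"
proof -
  define G where "G x1 x2 x3 = poly_extend f (pr x1 \<otimes> 1) (A_form x2 g1) (A_form x3 g2)" for x1 x2 x3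
  note P = poly_extend[OF f]
  have "clinear (\<lambda>x. pr x \<otimes> (1 :: complex poly))"
    by (rule clinear_compose2[OF cbilinear_left[OF cbilinear_pure_tensor] clinear_pr])
  then have G: "ctrilinear G"
    unfolding ctrilinear_def G_def
    using clinear_compose2[OF ctrilinearD(1)[OF P(1)]] clinear_compose2[OF ctrilinearD(2)[OF P(1)] clinear_A_form]
      clinear_compose2[OF ctrilinearD(3)[OF P(1)] clinear_A_form] by blast
  note H = cbilinear_tensor_lift_ctrilinear[OF G]
  note M = tensor_map[OF clinear_ident clinear_comult]
  have ai: "alpha_integrand f g1 g2 x = tensor_lift (\<lambda>x1. tensor_lift (G x1)) (comult3 x)" for x
    by (simp only: alpha_integrand_def G_def[abs_def])
  show "clinear (alpha_integrand f g1 g2)"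
    unfolding ai[abs_def] comult3_def
    by (rule clinear_compose2[OF tensor_lift(1)[OF H] clinear_compose2[OF M(1) clinear_comult]])
  have "alpha_integrand f g1 g2 (divpow y n) = (\<Sum>i\<le>n. tensor_lift (G (divpow y i)) (comult (divpow y (n - i))))"
    unfolding ai comult3_def comult_divpow[of y n] clinear_sum[OF M(1)] M(2)
    by (rule tensor_lift_sum_pure[OF H])
  also have "\<dots> = (\<Sum>i\<le>n. \<Sum>j\<le>n - i. G (divpow y i) (divpow y j) (divpow y (n - i - j)))"
    by (simp only: tensor_lift_comult_divpow[OF ctrilinearD(4)[OF G]])
  \<comment> \<open>\<open>pr\<close> leaves only degree i = 1 in the first Sweedler factor. For n =
    0 the index set is empty, matching the empty sum over j < 0.\<close>
  also have "\<dots> = (\<Sum>i\<in>{1..n} \<inter> {1}. \<Sum>j\<le>n - i. G (divpow y i) (divpow y j) (divpow y (n - i - j)))"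
  proof (rule sum.mono_neutral_right)
    show "\<forall>i\<in>{..n} - {1..n} \<inter> {1}. (\<Sum>j\<le>n - i. G (divpow y i) (divpow y j) (divpow y (n - i - j))) = 0"
    proof
      fix i assume "i \<in> {..n} - {1..n} \<inter> {1}"
      then have "i \<noteq> 1" by auto
      then have "pr (divpow y i) = 0" by (simp add: pr_divpow)
      then have "pr (divpow y i) \<otimes> (1 :: complex poly) = 0"
        by (simp only: clinearD(5)[OF cbilinear_left[OF cbilinear_pure_tensor]])
      then show "(\<Sum>j\<le>n - i. G (divpow y i) (divpow y j) (divpow y (n - i - j))) = 0"
        by (simp add: G_def clinearD(5)[OF ctrilinearD(1)[OF P(1)]])
    qed
  qed auto
  also have "\<dots> = (\<Sum>j<n. smult (f y (ad_pow y j g1) (ad_pow y (n - Suc j) g2)) (todd_poly j * todd_poly (n - Suc j)))"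
  proof (cases n)
    case (Suc m)
    then have "{1..n} \<inter> {1} = {1::nat}" by auto
    then show ?thesis
      by (simp add: Suc G_def pr_divpow A_form_divpow P(2) lessThan_Suc_atMost del: divpow_1)
  qed simp
  finally show "alpha_integrand f g1 g2 (divpow y n) =
      (\<Sum>j<n. smult (f y (ad_pow y j g1) (ad_pow y (n - Suc j) g2)) (todd_poly j * todd_poly (n - Suc j)))" .
qed

lemma alpha_integrand_divpow_deriv:
  assumes f: "ctrilinear f"
  shows "alpha_integrand f g1 g2 (divpow_deriv y w n) =
    (\<Sum>j<n. smult (f w (ad_pow y j g1) (ad_pow y (n - Suc j) g2)
        + (f y (ad_pow_deriv y w j g1) (ad_pow y (n - Suc j) g2)
          + f y (ad_pow y j g1) (ad_pow_deriv y w (n - Suc j) g2)))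
      (todd_poly j * todd_poly (n - Suc j)))"
proof (rule clinear_jet_divpow[OF alpha_integrand(1)[OF f]])
  have lin: "clinear (\<lambda>c. smult c P)" for P :: "complex poly"
    by (simp add: clinear_iff smult_add_left)
  show "jet (\<lambda>e. alpha_integrand f g1 g2 (divpow (y + e *\<^sub>C w) n))
     (\<Sum>j<n. smult (f y (ad_pow y j g1) (ad_pow y (n - Suc j) g2)) (todd_poly j * todd_poly (n - Suc j)))
     (\<Sum>j<n. smult (f w (ad_pow y j g1) (ad_pow y (n - Suc j) g2)
        + (f y (ad_pow_deriv y w j g1) (ad_pow y (n - Suc j) g2)
          + f y (ad_pow y j g1) (ad_pow_deriv y w (n - Suc j) g2)))
      (todd_poly j * todd_poly (n - Suc j)))"
    unfolding alpha_integrand(2)[OF f]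
    by (intro jet_sum jet_linear[OF lin] jet_ctrilinear[OF f] jet_affine jet_ad_pow)
qed

section \<open>The transgression formula\<close>

definition triple_sum :: "nat \<Rightarrow> (nat \<Rightarrow> nat \<Rightarrow> nat \<Rightarrow> 'a::comm_monoid_add) \<Rightarrow> 'a"
  where "triple_sum n F = (\<Sum>i\<le>n. \<Sum>j\<le>n - i. F i j (n - i - j))"

lemma triple_sum_alt: "triple_sum n F = (\<Sum>(i, j, k)\<in>{(i, j, k). i + j + k = n}. F i j k)"
proof -
  have "triple_sum n F = (\<Sum>(i, j)\<in>Sigma {..n} (\<lambda>i. {..n - i}). F i j (n - i - j))"
    unfolding triple_sum_def by (rule sum.Sigma) auto
  also have "\<dots> = (\<Sum>(i, j, k)\<in>{(i, j, k). i + j + k = n}. F i j k)"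
    by (rule sum.reindex_bij_witness[of _ "\<lambda>(i, j, k). (i, j)" "\<lambda>(i, j). (i, j, n - i - j)"]) auto
  finally show ?thesis .
qed

lemma triple_sum_rotate: "triple_sum n (\<lambda>i j k. F j k i) = triple_sum n F"
  unfolding triple_sum_alt
  by (rule sum.reindex_bij_witness[of _ "\<lambda>(i, j, k). (k, i, j)" "\<lambda>(i, j, k). (j, k, i)"]) auto

lemma triple_sum_rotate2: "triple_sum n (\<lambda>i j k. F k i j) = triple_sum n F"
  using triple_sum_rotate[of n "\<lambda>i j k. F k i j"] by simp

lemma triple_sum_swap: "triple_sum n (\<lambda>i j k. F i k j) = triple_sum n F"
  unfolding triple_sum_alt
  by (rule sum.reindex_bij_witness[of _ "\<lambda>(i, j, k). (i, k, j)" "\<lambda>(i, j, k). (i, k, j)"]) auto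

lemma triple_sum_shift:
  "triple_sum n (\<lambda>i j k. case i of 0 \<Rightarrow> 0 | Suc i \<Rightarrow> F i j k) = (case n of 0 \<Rightarrow> 0 | Suc p \<Rightarrow> triple_sum p F)"
  by (cases n) (simp_all add: triple_sum_def sum.atMost_Suc_shift del: sum.atMost_Suc)

lemma triple_sum_shift2:
  "triple_sum n (\<lambda>i j k. case j of 0 \<Rightarrow> 0 | Suc j \<Rightarrow> F i j k) = (case n of 0 \<Rightarrow> 0 | Suc p \<Rightarrow> triple_sum p F)"
proof -
  have "triple_sum n (\<lambda>i j k. case j of 0 \<Rightarrow> 0 | Suc j \<Rightarrow> F i j k)
    = triple_sum n (\<lambda>a b c. case a of 0 \<Rightarrow> 0 | Suc a \<Rightarrow> F c a b)"
    by (rule triple_sum_rotate)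
  also have "\<dots> = (case n of 0 \<Rightarrow> 0 | Suc p \<Rightarrow> triple_sum p (\<lambda>a b c. F c a b))"
    by (rule triple_sum_shift)
  finally show ?thesis by (simp only: triple_sum_rotate2[of _ F])
qed

lemma triple_sum_shift3:
  "triple_sum n (\<lambda>i j k. case k of 0 \<Rightarrow> 0 | Suc k \<Rightarrow> F i j k) = (case n of 0 \<Rightarrow> 0 | Suc p \<Rightarrow> triple_sum p F)"
proof -
  have "triple_sum n (\<lambda>i j k. case k of 0 \<Rightarrow> 0 | Suc k \<Rightarrow> F i j k)
    = triple_sum n (\<lambda>a b c. case a of 0 \<Rightarrow> 0 | Suc a \<Rightarrow> F b c a)"
    by (rule triple_sum_rotate2)
  also have "\<dots> = (case n of 0 \<Rightarrow> 0 | Suc p \<Rightarrow> triple_sum p (\<lambda>a b c. F b c a))"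
    by (rule triple_sum_shift)
  finally show ?thesis by (simp only: triple_sum_rotate[of _ F])
qed

lemma triple_sum_add: "triple_sum n (\<lambda>i j k. F i j k + G i j k) = triple_sum n F + triple_sum n G"
  by (simp add: triple_sum_def sum.distrib)

lemma triple_sum_diff:
  fixes F G :: "nat \<Rightarrow> nat \<Rightarrow> nat \<Rightarrow> 'a::ab_group_add"
  shows "triple_sum n (\<lambda>i j k. F i j k - G i j k) = triple_sum n F - triple_sum n G"
  by (simp add: triple_sum_def sum_subtractf)

lemma triple_sum_uminus:
  fixes F :: "nat \<Rightarrow> nat \<Rightarrow> nat \<Rightarrow> 'a::ab_group_add"
  shows "triple_sum n (\<lambda>i j k. - F i j k) = - triple_sum n F"
  by (simp add: triple_sum_def sum_negf)

section \<open>The cocycle identity and the coboundary of the integrand\<close>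

locale three_cocycle =
  fixes f :: "'g::complex_lie_algebra \<Rightarrow> 'g \<Rightarrow> 'g \<Rightarrow> complex"
  assumes cocycle: "f \<in> ce_Z3 UNIV trivial_act"
begin

lemma ctrilinear: "ctrilinear f"
proof -
  have "f \<in> ce_C3 UNIV" using cocycle by (simp add: ce_Z3_def)
  then show ?thesis
    unfolding ctrilinear_def clinear_iff
    by (simp add: ce_C3_def cbilinear_on_def clinear_on_def)
qed

lemma alternating: "f x x y = 0" "f x y y = 0" "f x y x = 0"
  using cocycle by (simp_all add: ce_Z3_def ce_C3_def)

lemmas linear1 = clinearD[OF ctrilinearD(1)[OF ctrilinear]]
  and linear2 = clinearD[OF ctrilinearD(2)[OF ctrilinear]]
  and linear3 = clinearD[OF ctrilinearD(3)[OF ctrilinear]]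

lemma swap12: "f x y z = - f y x z"
proof -
  have "f (x + y) (x + y) z = 0" by (rule alternating)
  then have "f x y z + f y x z = 0"
    unfolding linear1(1) linear2(1) by (simp add: alternating add.commute)
  then show ?thesis by (simp add: eq_neg_iff_add_eq_0)
qed

lemma swap23: "f x y z = - f x z y"
proof -
  have "f x (y + z) (y + z) = 0" by (rule alternating)
  then have "f x y z + f x z y = 0"
    unfolding linear2(1) linear3(1) by (simp add: alternating add.commute)
  then show ?thesis by (simp add: eq_neg_iff_add_eq_0)
qed

lemma rotate: "f x y z = f y z x"
  using swap12[of x y z] swap23[of y x z] by simp

text \<open>Cartan's formula for a closed form: the Lie derivative of f along y is the coboundary of
  the contraction of f with y.\<close>

lemma cocycle_derivation:
  "f (lie_bracket y a) b c + f a (lie_bracket y b) c + f a b (lie_bracket y c)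
    = f y (lie_bracket a b) c + f y (lie_bracket b c) a + f y (lie_bracket c a) b"
proof -
  have "ce_d3 trivial_act f y a b c = 0" using cocycle by (simp add: ce_Z3_def)
  then have "- f (lie_bracket y a) b c + f (lie_bracket y b) a c - f (lie_bracket y c) a b
    - f (lie_bracket a b) y c + f (lie_bracket a c) y b - f (lie_bracket b c) y a = 0"
    by (simp add: ce_d3_def trivial_act_def)
  moreover have "f (lie_bracket y b) a c = - f a (lie_bracket y b) c" by (rule swap12)
  moreover have "f (lie_bracket y c) a b = f a b (lie_bracket y c)" by (rule rotate)
  moreover have "f (lie_bracket a b) y c = - f y (lie_bracket a b) c" by (rule swap12)
  moreover have "f (lie_bracket b c) y a = - f y (lie_bracket b c) a" by (rule swap12)
  moreover have "f (lie_bracket a c) y b = f y (lie_bracket c a) b"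
    by (subst lie_bracket_swap, subst swap12) (simp add: linear2)
  ultimately show ?thesis by (simp add: algebra_simps)
qed

text \<open>The Chevalley-Eilenberg coboundary of the integrand in cyclic form, before integration
  over t.\<close>

definition int_coboundary :: "'g \<Rightarrow> 'g \<Rightarrow> 'g \<Rightarrow> 'g uea \<Rightarrow> complex poly"
  where "int_coboundary u v w x =
    (alpha_integrand f v w (x * uea_incl u) - alpha_integrand f (lie_bracket u v) w x)
    + (alpha_integrand f w u (x * uea_incl v) - alpha_integrand f (lie_bracket v w) u x)
    + (alpha_integrand f u v (x * uea_incl w) - alpha_integrand f (lie_bracket w u) v x)"

context
  fixes y :: 'g and t :: complex and n :: nat
begin

definition A where "A j = poly (todd_poly j) t"

text \<open>
  Right multiplication by \<open>u\<close> differentiates \<open>f (y, A\<^sub>t v, A\<^sub>t w)\<close> along \<open>T u\<close>: \<open>W\<close> is the part where the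
  derivative hits \<open>y\<close>, \<open>V\<close> the part where it hits \<open>A\<^sub>t v\<close>. The Maurer--Cartan equation turns
  antisymmetrized \<open>V\<close> into \<open>X\<close>.
\<close>

definition V where "V u v w = triple_sum n (\<lambda>k j l.
  todd_coeff k * A j * A l * f y (ad_pow_deriv y (ad_pow y k u) j v) (ad_pow y l w))"

definition W where "W u v w = triple_sum n (\<lambda>k j l.
  todd_coeff k * A j * A l * f (ad_pow y k u) (ad_pow y j v) (ad_pow y l w))"

definition X where "X p u v w = triple_sum p (\<lambda>i j l.
  A i * A j * A l * f y (lie_bracket (ad_pow y i u) (ad_pow y j v)) (ad_pow y l w))"

text \<open>Product rule along T u. Antisymmetry of f moves a derivative hitting the third argument
  into the second, where it is again a \<open>V\<close>.\<close>

lemma integrand_translate: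
  "poly (alpha_integrand f v w (divpow y n * uea_incl u)) t = W u v w + V u v w - V u w v"
proof -
  note lin = alpha_integrand(1)[OF ctrilinear]
  have "poly (alpha_integrand f v w (divpow y n * uea_incl u)) t
    = (\<Sum>k\<le>n. todd_coeff k * poly (alpha_integrand f v w (divpow_deriv y (ad_pow y k u) (Suc n - k))) t)"
    by (simp add: divpow_mult_incl clinear_sum[OF lin] clinearD(2)[OF lin] poly_sum)
  also have "\<dots> = triple_sum n (\<lambda>k j l. todd_coeff k * A j * A l * f (ad_pow y k u) (ad_pow y j v) (ad_pow y l w)
      + (todd_coeff k * A j * A l * f y (ad_pow_deriv y (ad_pow y k u) j v) (ad_pow y l w)
      + todd_coeff k * A j * A l * f y (ad_pow y j v) (ad_pow_deriv y (ad_pow y k u) l w)))"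
    unfolding triple_sum_def
  proof (rule sum.cong[OF refl])
    fix k assume "k \<in> {..n}"
    then have k: "Suc n - k = Suc (n - k)" by (simp add: Suc_diff_le)
    show "todd_coeff k * poly (alpha_integrand f v w (divpow_deriv y (ad_pow y k u) (Suc n - k))) t
      = (\<Sum>j\<le>n - k. todd_coeff k * A j * A (n - k - j) * f (ad_pow y k u) (ad_pow y j v) (ad_pow y (n - k - j) w)
      + (todd_coeff k * A j * A (n - k - j) * f y (ad_pow_deriv y (ad_pow y k u) j v) (ad_pow y (n - k - j) w)
      + todd_coeff k * A j * A (n - k - j) * f y (ad_pow y j v) (ad_pow_deriv y (ad_pow y k u) (n - k - j) w)))"
      unfolding k alpha_integrand_divpow_deriv[OF ctrilinear] poly_sum sum_distrib_left lessThan_Suc_atMost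
      by (rule sum.cong[OF refl]) (simp add: A_def algebra_simps)
  qed
  also have "\<dots> = W u v w + (V u v w + triple_sum n (\<lambda>k j l.
      todd_coeff k * A j * A l * f y (ad_pow y j v) (ad_pow_deriv y (ad_pow y k u) l w)))"
    by (simp only: triple_sum_add W_def V_def)
  also have "triple_sum n (\<lambda>k j l. todd_coeff k * A j * A l * f y (ad_pow y j v) (ad_pow_deriv y (ad_pow y k u) l w))
    = - V u w v"
  proof -
    have "triple_sum n (\<lambda>k j l. todd_coeff k * A j * A l * f y (ad_pow y j v) (ad_pow_deriv y (ad_pow y k u) l w))
      = triple_sum n (\<lambda>k l j. todd_coeff k * A j * A l * f y (ad_pow y j v) (ad_pow_deriv y (ad_pow y k u) l w))"
      by (rule triple_sum_swap[symmetric])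
    also have "\<dots> = triple_sum n (\<lambda>k l j. - (todd_coeff k * A l * A j * f y (ad_pow_deriv y (ad_pow y k u) l w) (ad_pow y j v)))"
      by (subst swap23) (simp add: mult_ac)
    finally show ?thesis by (simp only: triple_sum_uminus V_def)
  qed
  finally show ?thesis by simp
qed

text \<open>For each l this is the Maurer-Cartan equation tested against the functional
  \<open>\<lambda>z. f y z (ad_pow y l w)\<close>. One degree in y is taken by the first argument of
  f, so the equation is used in degree n - 1 - l.\<close>

lemma V_antisym:
  "V u v w - V v u w = poly (alpha_integrand f (lie_bracket u v) w (divpow y n)) t
    - (case n of 0 \<Rightarrow> 0 | Suc p \<Rightarrow> X p u v w)"
proof -
  define D where "D k j = ad_pow_deriv y (ad_pow y k u) j v - ad_pow_deriv y (ad_pow y k v) j u" for k j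
  have D0: "D k 0 = 0" for k by (simp add: D_def)
  have "V u v w - V v u w = triple_sum n (\<lambda>k j l. todd_coeff k * A j * A l * f y (D k j) (ad_pow y l w))"
    unfolding V_def triple_sum_diff[symmetric] D_def linear2 by (simp add: algebra_simps)
  also have "\<dots> = triple_sum n (\<lambda>l k j. todd_coeff k * A j * A l * f y (D k j) (ad_pow y l w))"
    by (rule triple_sum_rotate[symmetric])
  also have "\<dots> = (\<Sum>l\<le>n. \<Sum>k\<le>n - l. todd_coeff k * A (n - l - k) * A l * f y (D k (n - l - k)) (ad_pow y l w))"
    by (simp add: triple_sum_def)
  also have "\<dots> = poly (alpha_integrand f (lie_bracket u v) w (divpow y n)) t
    - (case n of 0 \<Rightarrow> 0 | Suc p \<Rightarrow> X p u v w)"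
  proof (cases n)
    case 0
    then show ?thesis by (simp add: D0 linear2 alpha_integrand(2)[OF ctrilinear] del: divpow_0)
  next
    case (Suc p)
    have mc: "(\<Sum>k\<le>n - l. todd_coeff k * A (n - l - k) * A l * f y (D k (n - l - k)) (ad_pow y l w))
      = A (p - l) * A l * f y (ad_pow y (p - l) (lie_bracket u v)) (ad_pow y l w)
        - (\<Sum>i\<le>p - l. A i * A (p - l - i) * A l
            * f y (lie_bracket (ad_pow y i u) (ad_pow y (p - l - i) v)) (ad_pow y l w))" if "l \<le> p" for l
    proof -
      let ?l = "\<lambda>z. f y z (ad_pow y l w)"
      have nl: "n - l = Suc (p - l)" using that by (simp add: Suc Suc_diff_le)
      have "poly (mc_defect y u v ?l (p - l)) t = 0"
        using mc_defect_eq_0_and_todd_defect[OF ctrilinearD(2)[OF ctrilinear]] by simp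
      then have "(\<Sum>k\<le>p - l. todd_coeff k * ?l (D k (Suc (p - l) - k)) * A (Suc (p - l) - k))
        = ?l (ad_pow y (p - l) (lie_bracket u v)) * A (p - l)
          - (\<Sum>i\<le>p - l. ?l (lie_bracket (ad_pow y i u) (ad_pow y (p - l - i) v)) * (A i * A (p - l - i)))"
        by (simp add: mc_defect_def poly_sum D_def A_def add_eq_0_iff)
      then have "A l * (\<Sum>k\<le>p - l. todd_coeff k * ?l (D k (Suc (p - l) - k)) * A (Suc (p - l) - k))
        = A l * (?l (ad_pow y (p - l) (lie_bracket u v)) * A (p - l)
          - (\<Sum>i\<le>p - l. ?l (lie_bracket (ad_pow y i u) (ad_pow y (p - l - i) v)) * (A i * A (p - l - i))))"
        by (rule arg_cong)
      then show ?thesis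
        unfolding nl by (simp add: D0 linear2 sum_distrib_left right_diff_distrib mult_ac)
    qed
    \<comment> \<open>For l = n only derivatives of order 0 remain, and they vanish.\<close>
    have last: "(\<Sum>k\<le>n - n. todd_coeff k * A (n - n - k) * A n * f y (D k (n - n - k)) (ad_pow y n w)) = 0"
      by (simp add: D0 linear2)
    have "(\<Sum>l\<le>n. \<Sum>k\<le>n - l. todd_coeff k * A (n - l - k) * A l * f y (D k (n - l - k)) (ad_pow y l w))
      = (\<Sum>l\<le>p. \<Sum>k\<le>n - l. todd_coeff k * A (n - l - k) * A l * f y (D k (n - l - k)) (ad_pow y l w))"
      using last unfolding Suc sum.atMost_Suc by simp
    also have "\<dots> = (\<Sum>l\<le>p. A (p - l) * A l * f y (ad_pow y (p - l) (lie_bracket u v)) (ad_pow y l w))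
      - (\<Sum>l\<le>p. \<Sum>i\<le>p - l. A i * A (p - l - i) * A l
            * f y (lie_bracket (ad_pow y i u) (ad_pow y (p - l - i) v)) (ad_pow y l w))"
      unfolding sum_subtractf[symmetric] by (rule sum.cong[OF refl]) (simp only: mc atMost_iff)
    also have "(\<Sum>l\<le>p. \<Sum>i\<le>p - l. A i * A (p - l - i) * A l
            * f y (lie_bracket (ad_pow y i u) (ad_pow y (p - l - i) v)) (ad_pow y l w))
      = triple_sum p (\<lambda>l i j. A i * A j * A l * f y (lie_bracket (ad_pow y i u) (ad_pow y j v)) (ad_pow y l w))"
      by (simp add: triple_sum_def)
    also have "\<dots> = X p u v w"
      unfolding X_def by (rule triple_sum_rotate)
    also have "(\<Sum>l\<le>p. A (p - l) * A l * f y (ad_pow y (p - l) (lie_bracket u v)) (ad_pow y l w))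
      = (\<Sum>l\<le>p. A l * A (p - l) * f y (ad_pow y l (lie_bracket u v)) (ad_pow y (p - l) w))"
      by (rule sum.reindex_bij_witness[of _ "\<lambda>l. p - l" "\<lambda>l. p - l"]) auto
    also have "\<dots> = poly (alpha_integrand f (lie_bracket u v) w (divpow y n)) t"
      by (simp add: alpha_integrand(2)[OF ctrilinear] Suc lessThan_Suc_atMost poly_sum A_def mult_ac
          del: sum.lessThan_Suc)
    finally show ?thesis by (simp add: Suc)
  qed
  finally show ?thesis .
qed

text \<open>Insert \<partial>_t A_t = T - ad y A_t into each argument of f(A_t u, A_t v, A_t w). The
  T-parts are the \<open>W\<close> terms; the ad y parts become the \<open>X\<close> terms, one
  degree lower, by \<open>cocycle_derivation\<close>.\<close>

lemma poly_pderiv_primitive: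
  "poly (pderiv (triple_sum n (\<lambda>i j k. smult (f (ad_pow y i u) (ad_pow y j v) (ad_pow y k w))
      (todd_poly i * todd_poly j * todd_poly k)))) t
    = W u v w + W v w u + W w u v
      - (case n of 0 \<Rightarrow> 0 | Suc p \<Rightarrow> X p u v w + X p v w u + X p w u v)"
proof -
  let ?F = "\<lambda>i j k. f (ad_pow y i u) (ad_pow y j v) (ad_pow y k w)"
  have F1: "?F i j k = f (ad_pow y j v) (ad_pow y k w) (ad_pow y i u)"
    and F2: "?F i j k = f (ad_pow y k w) (ad_pow y i u) (ad_pow y j v)" for i j k
    by (rule rotate, rule rotate[symmetric])
  define A' where "A' j = (case j of 0 \<Rightarrow> 0 | Suc i \<Rightarrow> A i)" for j
  have dA: "poly (pderiv (todd_poly j)) t = todd_coeff j - A' j" for j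
    by (cases j) (simp_all add: pderiv_todd_poly A_def A'_def)
  have "poly (pderiv (triple_sum n (\<lambda>i j k. smult (?F i j k) (todd_poly i * todd_poly j * todd_poly k)))) t
    = triple_sum n (\<lambda>i j k. todd_coeff i * A j * A k * ?F i j k + todd_coeff j * A k * A i * ?F i j k
        + todd_coeff k * A i * A j * ?F i j k
        - (A' i * A j * A k * ?F i j k + A' j * A k * A i * ?F i j k + A' k * A i * A j * ?F i j k))"
    unfolding triple_sum_def pderiv_sum poly_sum
    by (intro sum.cong refl) (simp add: pderiv_smult pderiv_mult dA A_def[symmetric] algebra_simps)
  also have "\<dots> = triple_sum n (\<lambda>i j k. todd_coeff i * A j * A k * ?F i j k)
        + triple_sum n (\<lambda>i j k. todd_coeff j * A k * A i * ?F i j k)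
        + triple_sum n (\<lambda>i j k. todd_coeff k * A i * A j * ?F i j k)
        - (triple_sum n (\<lambda>i j k. A' i * A j * A k * ?F i j k) + triple_sum n (\<lambda>i j k. A' j * A k * A i * ?F i j k)
          + triple_sum n (\<lambda>i j k. A' k * A i * A j * ?F i j k))"
    by (simp only: triple_sum_diff triple_sum_add)
  also have "triple_sum n (\<lambda>i j k. todd_coeff i * A j * A k * ?F i j k) = W u v w"
    by (simp only: W_def)
  also have "triple_sum n (\<lambda>i j k. todd_coeff j * A k * A i * ?F i j k) = W v w u"
    unfolding F1 W_def by (rule triple_sum_rotate)
  also have "triple_sum n (\<lambda>i j k. todd_coeff k * A i * A j * ?F i j k) = W w u v"
    unfolding F2 W_def by (rule triple_sum_rotate2)
  also have "triple_sum n (\<lambda>i j k. A' i * A j * A k * ?F i j k) + triple_sum n (\<lambda>i j k. A' j * A k * A i * ?F i j k)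
          + triple_sum n (\<lambda>i j k. A' k * A i * A j * ?F i j k)
    = (case n of 0 \<Rightarrow> 0 | Suc p \<Rightarrow> X p u v w + X p v w u + X p w u v)"
  proof -
    have s1: "A' i * A j * A k * ?F i j k = (case i of 0 \<Rightarrow> 0 | Suc i \<Rightarrow> A i * A j * A k * ?F (Suc i) j k)"
      and s2: "A' j * A k * A i * ?F i j k = (case j of 0 \<Rightarrow> 0 | Suc j \<Rightarrow> A i * A j * A k * ?F i (Suc j) k)"
      and s3: "A' k * A i * A j * ?F i j k = (case k of 0 \<Rightarrow> 0 | Suc k \<Rightarrow> A i * A j * A k * ?F i j (Suc k))" for i j k
      by (simp_all add: A'_def split: nat.split)
    show ?thesis
    proof (cases n)
      case 0
      then show ?thesis by (simp add: triple_sum_def A'_def)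
    next
      case (Suc p)
      let ?G = "\<lambda>a b c i j k. A i * A j * A k * f y (lie_bracket (ad_pow y i a) (ad_pow y j b)) (ad_pow y k c)"
      have "triple_sum n (\<lambda>i j k. A' i * A j * A k * ?F i j k) + triple_sum n (\<lambda>i j k. A' j * A k * A i * ?F i j k)
          + triple_sum n (\<lambda>i j k. A' k * A i * A j * ?F i j k)
        = triple_sum p (\<lambda>i j k. A i * A j * A k * ?F (Suc i) j k + A i * A j * A k * ?F i (Suc j) k
            + A i * A j * A k * ?F i j (Suc k))"
        unfolding s1 s2 s3 triple_sum_shift triple_sum_shift2 triple_sum_shift3 triple_sum_add by (simp add: Suc)
      also have "\<dots> = triple_sum p (\<lambda>i j k. ?G u v w i j k + ?G v w u j k i + ?G w u v k i j)"
      proof -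
        have "A i * A j * A k * ?F (Suc i) j k + A i * A j * A k * ?F i (Suc j) k + A i * A j * A k * ?F i j (Suc k)
          = A i * A j * A k * (?F (Suc i) j k + ?F i (Suc j) k + ?F i j (Suc k))" for i j k
          by (simp only: distrib_left)
        moreover have "?F (Suc i) j k + ?F i (Suc j) k + ?F i j (Suc k)
          = f y (lie_bracket (ad_pow y i u) (ad_pow y j v)) (ad_pow y k w)
            + f y (lie_bracket (ad_pow y j v) (ad_pow y k w)) (ad_pow y i u)
            + f y (lie_bracket (ad_pow y k w) (ad_pow y i u)) (ad_pow y j v)" for i j k
          using cocycle_derivation[of y "ad_pow y i u" "ad_pow y j v" "ad_pow y k w"] by simp
        ultimately show ?thesis by (simp only: distrib_left mult_ac)
      qed
      also have "\<dots> = X p u v w + X p v w u + X p w u v"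
        unfolding triple_sum_add X_def
        by (simp only: triple_sum_rotate[of p "?G v w u"] triple_sum_rotate2[of p "?G w u v"])
      finally show ?thesis by (simp add: Suc)
    qed
  qed
  finally show ?thesis .
qed

text \<open>In the cyclic sum the \<open>V\<close> terms pair into the differences of
  \<open>V_antisym\<close>. Their integrand parts cancel the bracket terms of the coboundary, and
  what is left is the sum of the \<open>W\<close> minus the sum of the \<open>X\<close>.\<close>

lemma poly_int_coboundary:
  "poly (int_coboundary u v w (divpow y n)) t
    = poly (pderiv (triple_sum n (\<lambda>i j k. smult (f (ad_pow y i u) (ad_pow y j v) (ad_pow y k w))
      (todd_poly i * todd_poly j * todd_poly k)))) t"
proof -
  have V: "V a b c = V b a c + poly (alpha_integrand f (lie_bracket a b) c (divpow y n)) t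
      - (case n of 0 \<Rightarrow> 0 | Suc p \<Rightarrow> X p a b c)" for a b c
    using V_antisym[of a b c] by (simp add: algebra_simps)
  show ?thesis
    unfolding poly_pderiv_primitive int_coboundary_def poly_add poly_diff integrand_translate
      V[of u v w] V[of v w u] V[of w u v]
    by (cases n) simp_all
qed

end

lemma int_coboundary_divpow:
  "int_coboundary u v w (divpow y n)
    = pderiv (triple_sum n (\<lambda>i j k. smult (f (ad_pow y i u) (ad_pow y j v) (ad_pow y k w))
      (todd_poly i * todd_poly j * todd_poly k)))"
  using poly_int_coboundary by (simp add: poly_eq_poly_eq_iff[symmetric] fun_eq_iff)

end

section \<open>Yoneda products\<close>

lemma clinear_onD:
  assumes "clinear_on S T F" "x \<in> S" "y \<in> S"
  shows "F x \<in> T" "F (x + y) = F x + F y" "F (c *\<^sub>C x) = c *\<^sub>C F x"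
  using assms by (auto simp: clinear_on_def)

lemma clinear_on_diff:
  assumes "clinear_on S T F" "csubspace S" "x \<in> S" "y \<in> S"
  shows "F (x - y) = F x - F y" "F (- x) = - F x" "F 0 = 0"
proof -
  have m: "F (- a) = - F a" if "a \<in> S" for a
    using clinear_onD(3)[OF assms(1) that that, of "- 1"] by (simp add: scaleC_one)
  show "F (- x) = - F x" by (rule m[OF assms(3)])
  have "- y \<in> S" by (rule complex_vector.subspace_neg[OF assms(2,4)])
  then show "F (x - y) = F x - F y"
    using clinear_onD(2)[OF assms(1,3), of "- y"] m[OF assms(4)] by simp
  show "F 0 = 0"
    using clinear_onD(3)[OF assms(1,3,3), of 0] by simp
qed

lemma clinear_on_UNIV: "clinear_on UNIV T F \<longleftrightarrow> clinear F \<and> range F \<subseteq> T"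
  by (auto simp: clinear_on_def clinear_iff)

lemma lie_algebra_on_UNIV: "lie_algebra_on UNIV (lie_bracket :: 'g::complex_lie_algebra \<Rightarrow> 'g \<Rightarrow> 'g)"
proof
  show "cbilinear_on UNIV UNIV UNIV (lie_bracket :: 'g \<Rightarrow> _)"
    by (simp add: cbilinear_on_def clinear_on_UNIV clinear_lie_bracket_left clinear_lie_bracket_right)
qed (simp_all add: complex_vector.subspace_UNIV lie_bracket_self lie_jacobi)

lemma g_moduleI:
  assumes "csubspace V" "cbilinear_on UNIV V V act"
    and "\<And>x y v. v \<in> V \<Longrightarrow> act (lie_bracket x y) v = act x (act y v) - act y (act x v)"
  shows "g_module V act"
  using assms by (intro lie_module_on.intro lie_algebra_on_UNIV lie_module_on_axioms.intro) auto

lemma g_moduleD: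
  assumes "g_module V act"
  shows "csubspace V" "clinear_on V V (act x)" "v \<in> V \<Longrightarrow> clinear_on UNIV V (\<lambda>x. act x v)"
    "v \<in> V \<Longrightarrow> act (lie_bracket x y) v = act x (act y v) - act y (act x v)"
proof -
  interpret lie_module_on UNIV lie_bracket V act by (rule assms)
  show "csubspace V" by (rule module_subspace)
  show "clinear_on V V (act x)" "v \<in> V \<Longrightarrow> clinear_on UNIV V (\<lambda>x. act x v)"
    using act_bilinear by (simp_all add: cbilinear_on_def)
  show "v \<in> V \<Longrightarrow> act (lie_bracket x y) v = act x (act y v) - act y (act x v)"
    by (rule act_bracket) simp_all
qed

lemma ce_C2D:
  assumes "b \<in> ce_C2 V"
  shows "clinear (b x)" "clinear (\<lambda>x. b x y)" "b x y \<in> V" "b x x = 0"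
  using assms by (auto simp: ce_C2_def cbilinear_on_def clinear_on_UNIV)

lemma ce_C2_antisym:
  assumes "b \<in> ce_C2 V"
  shows "b x y = - b y x"
proof -
  have "b (x + y) (x + y) = 0" using assms by (simp add: ce_C2_def)
  moreover have "b (x + y) (x + y) = b x x + b x y + (b y x + b y y)"
    using clinearD(1)[OF ce_C2D(1)[OF assms]] clinearD(1)[OF ce_C2D(2)[OF assms]]
    by (simp add: add_ac)
  moreover have "b x x = 0" "b y y = 0" using assms by (simp_all add: ce_C2_def)
  ultimately show ?thesis by (simp add: eq_neg_iff_add_eq_0)
qed

lemma ce_C2I:
  assumes "\<And>x. clinear (b x)" "\<And>y. clinear (\<lambda>x. b x y)" "\<And>x y. b x y \<in> V" "\<And>x. b x x = 0"
  shows "b \<in> ce_C2 V"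
  using assms by (auto simp: ce_C2_def cbilinear_on_def clinear_on_UNIV)

text \<open>The degree-two coboundary on alternating cochains, in the shape shared by
  \<open>crossed_cocycle\<close> and \<open>int_coboundary\<close>.\<close>

definition ce_cycl :: "('g::complex_lie_algebra \<Rightarrow> 'v \<Rightarrow> 'v) \<Rightarrow> ('g \<Rightarrow> 'g \<Rightarrow> 'v) \<Rightarrow> 'g \<Rightarrow> 'g \<Rightarrow> 'g \<Rightarrow> 'v::complex_vector"
  where "ce_cycl act b x y z = (act x (b y z) - b (lie_bracket x y) z)
    + (act y (b z x) - b (lie_bracket y z) x) + (act z (b x y) - b (lie_bracket z x) y)"

lemma ce_d2_eq_cycl:
  assumes V: "g_module V act" and b: "b \<in> ce_C2 V"
  shows "ce_d2 act b x y z = ce_cycl act b x y z"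
proof -
  have "act y (b x z) = - act y (b z x)"
    using clinear_on_diff(2)[OF g_moduleD(2,1)[OF V] ce_C2D(3,3)[OF b], of y z x]
    by (simp add: ce_C2_antisym[OF b, of x z])
  moreover have "b (lie_bracket x z) y = - b (lie_bracket z x) y"
    by (subst lie_bracket_swap) (simp add: clinearD(4)[OF ce_C2D(2)[OF b]])
  ultimately show ?thesis by (simp add: ce_d2_def ce_cycl_def)
qed

lemma ext_lie_algebra:
  assumes V: "g_module V act" and \<alpha>: "\<alpha> \<in> ce_Z2 V act"
  shows "lie_algebra_on (ext_carrier V) (ext_bracket act \<alpha>)"
proof
  have C2: "\<alpha> \<in> ce_C2 V" and d2: "ce_d2 act \<alpha> x y z = 0" for x y z
    using \<alpha> by (simp_all add: ce_Z2_def)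
  note sub = g_moduleD(1)[OF V] and br = g_moduleD(4)[OF V] and \<alpha>lin = ce_C2D[OF C2]
  have act1: "act x (c *\<^sub>C u) = c *\<^sub>C act x u" "act x u \<in> V"
    "act (x + y) u = act x u + act y u" "act (c *\<^sub>C x) u = c *\<^sub>C act x u" if "u \<in> V" for x y u c
    using clinear_onD[OF g_moduleD(2)[OF V] that that] clinear_onD[OF g_moduleD(3)[OF V that]] by auto
  have act2: "act x (u + v) = act x u + act x v" "act x (u - v) = act x u - act x v" if "u \<in> V" "v \<in> V" for x u v
    using clinear_onD[OF g_moduleD(2)[OF V] that] clinear_on_diff[OF g_moduleD(2)[OF V] sub that] by auto
  note act = act1 act2
  note closed = complex_vector.subspace_add[OF sub] complex_vector.subspace_diff[OF sub]
    complex_vector.subspace_scale[OF sub]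
  show "csubspace (ext_carrier V)"
    using sub by (auto simp: ext_carrier_def complex_vector.subspace_def scaleC_prod_def zero_prod_def)
  show "cbilinear_on (ext_carrier V) (ext_carrier V) (ext_carrier V) (ext_bracket act \<alpha>)"
    unfolding cbilinear_on_def clinear_on_def
    by (auto simp: ext_carrier_def ext_bracket_def closed act scaleC_prod_def clinearD[OF \<alpha>lin(1)]
        clinearD[OF \<alpha>lin(2)] \<alpha>lin(3) lie_bracket_add_left lie_bracket_add_right lie_bracket_scaleC_left
        lie_bracket_scaleC_right scaleC_add_right complex_vector.scale_right_diff_distrib)
  show "ext_bracket act \<alpha> p p = 0" if "p \<in> ext_carrier V" for p
    by (auto simp: ext_bracket_def \<alpha>lin(4) lie_bracket_self zero_prod_def split: prod.split)
  show "ext_bracket act \<alpha> p (ext_bracket act \<alpha> q r) + ext_bracket act \<alpha> q (ext_bracket act \<alpha> r p)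
      + ext_bracket act \<alpha> r (ext_bracket act \<alpha> p q) = 0"
    if pqr: "p \<in> ext_carrier V" "q \<in> ext_carrier V" "r \<in> ext_carrier V" for p q r
  proof -
    obtain h x h' y h'' z where eq: "p = (h, x)" "q = (h', y)" "r = (h'', z)"
      by (cases p, cases q, cases r) blast
    have mem: "h \<in> V" "h' \<in> V" "h'' \<in> V" using pqr by (auto simp: eq ext_carrier_def)
    have "\<alpha> x (lie_bracket y z) = - \<alpha> (lie_bracket y z) x" "\<alpha> y (lie_bracket z x) = - \<alpha> (lie_bracket z x) y"
      "\<alpha> z (lie_bracket x y) = - \<alpha> (lie_bracket x y) z"
      by (rule ce_C2_antisym[OF C2])+
    \<comment> \<open>The terms with \<alpha> in the Jacobi sum make up its coboundary, so
      closedness of \<alpha> is what is needed.\<close>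
    moreover have "act x (\<alpha> y z) - \<alpha> (lie_bracket x y) z + (act y (\<alpha> z x) - \<alpha> (lie_bracket y z) x)
      + (act z (\<alpha> x y) - \<alpha> (lie_bracket z x) y) = 0"
      using d2[of x y z] ce_d2_eq_cycl[OF V C2] by (simp add: ce_cycl_def)
    ultimately show ?thesis
      using lie_jacobi[of x y z]
      by (simp add: eq ext_bracket_def zero_prod_def act mem closed \<alpha>lin(3) br algebra_simps)
  qed
qed

lemma g_module_short_exactD:
  assumes "g_module_short_exact A actA i B actB d C actC"
  shows "g_module A actA" "g_module B actB" "g_module C actC" "clinear_on A B i" "clinear_on B C d"
    "inj_on i A" "i ` A = {b \<in> B. d b = 0}" "d ` B = C"
    "a \<in> A \<Longrightarrow> i (actA g a) = actB g (i a)" "b \<in> B \<Longrightarrow> d (actB g b) = actC g (d b)"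
  using assms by (auto simp: g_module_short_exact_def short_exact_def)

lemma yoneda_crossed_extension:
  assumes se: "g_module_short_exact A actA i B actB d C actC" and \<alpha>: "\<alpha> \<in> ce_Z2 C actC"
  shows "crossed_extension A actA i B (\<lambda>_ _. 0) (yoneda_map d)
    (ext_carrier C) (ext_bracket actC \<alpha>) (yoneda_act actB) snd"
proof -
  note E = g_module_short_exactD[OF se]
  note subB = g_moduleD(1)[OF E(2)] and subC = g_moduleD(1)[OF E(3)]
  have C2: "\<alpha> \<in> ce_C2 C" using \<alpha> by (simp add: ce_Z2_def)
  have actB0: "actB 0 b = 0" if "b \<in> B" for b
    using clinear_on_diff(3)[OF g_moduleD(3)[OF E(2) that] complex_vector.subspace_UNIV] by simp
  have actC0: "actC 0 b = 0" if "b \<in> C" for b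
    using clinear_on_diff(3)[OF g_moduleD(3)[OF E(3) that] complex_vector.subspace_UNIV] by simp
  have d: "d b \<in> C" "d (b + b') = d b + d b'" "d (c *\<^sub>C b) = c *\<^sub>C d b" if "b \<in> B" "b' \<in> B" for b b' c
    using clinear_onD[OF E(5) that] by auto
  have d0: "d 0 = 0"
    using clinear_on_diff(3)[OF E(5) subB] complex_vector.subspace_0[OF subB] by blast
  have \<alpha>0: "\<alpha> x 0 = 0" for x by (rule clinearD(5)[OF ce_C2D(1)[OF C2]])
  have \<alpha>0': "\<alpha> 0 x = 0" for x using clinearD(5)[OF ce_C2D(2)[OF C2]] .
  have lb0: "lie_bracket x 0 = 0" "lie_bracket 0 x = 0" for x :: 'b
    by (simp_all add: clinearD[OF clinear_lie_bracket_left] clinearD[OF clinear_lie_bracket_right])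
  show ?thesis
  proof (intro crossed_extension.intro lie_crossed_module.intro crossed_extension_axioms.intro
      lie_crossed_module_axioms.intro lie_module_on.intro lie_module_on_axioms.intro)
    show "lie_algebra_on B (\<lambda>_ _. 0)"
      using subB by unfold_locales (auto simp: cbilinear_on_def clinear_on_def complex_vector.subspace_0)
    show "lie_algebra_on (ext_carrier C) (ext_bracket actC \<alpha>)"
      by (rule ext_lie_algebra[OF E(3) \<alpha>])
    show "csubspace B" by (rule subB)
    show "cbilinear_on (ext_carrier C) B B (yoneda_act actB)"
      unfolding cbilinear_on_def
    proof (intro conjI ballI)
      fix p show "clinear_on B B (yoneda_act actB p)"
        using g_moduleD(2)[OF E(2), of "snd p"] by (simp add: yoneda_act_def split_def)
    next
      fix b assume "b \<in> B"
      from clinear_onD[OF g_moduleD(3)[OF E(2) this]]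
      show "clinear_on (ext_carrier C) B (\<lambda>p. yoneda_act actB p b)"
        by (simp add: clinear_on_def yoneda_act_def split_def scaleC_prod_def)
    qed
    show "yoneda_act actB (ext_bracket actC \<alpha> p q) b
        = yoneda_act actB p (yoneda_act actB q b) - yoneda_act actB q (yoneda_act actB p b)" if "b \<in> B" for p q b
      using g_moduleD(4)[OF E(2) that] by (simp add: yoneda_act_def ext_bracket_def split_def)
    show "lie_hom_on B (\<lambda>_ _. 0) (ext_carrier C) (ext_bracket actC \<alpha>) (yoneda_map d)"
      unfolding lie_hom_on_def clinear_on_def
      by (auto simp: yoneda_map_def ext_carrier_def ext_bracket_def d d0 actC0 \<alpha>0 lb0 scaleC_prod_def zero_prod_def)
    \<comment> \<open>The derivation property for the zero bracket.\<close>
    show "yoneda_act actB p 0 = 0 + 0" for p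
      using clinear_on_diff(3)[OF g_moduleD(2)[OF E(2)] subB] complex_vector.subspace_0[OF subB]
      by (simp add: yoneda_act_def split_def)
    show "yoneda_map d (yoneda_act actB p b) = ext_bracket actC \<alpha> p (yoneda_map d b)"
      if "p \<in> ext_carrier C" "b \<in> B" for p b
      using that by (auto simp: yoneda_map_def yoneda_act_def ext_bracket_def ext_carrier_def split_def
          E(10) d actC0 \<alpha>0 lb0)
    \<comment> \<open>The Peiffer identity: the image of \<mu> has \<gg>-component 0, hence acts by
      zero on the abelian algebra.\<close>
    show "yoneda_act actB (yoneda_map d b) b' = 0" if "b' \<in> B" for b b'
      using that by (simp add: yoneda_act_def yoneda_map_def actB0)
    show "lie_algebra_on UNIV (lie_bracket :: 'b \<Rightarrow> _)" by (rule lie_algebra_on_UNIV)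
    show "csubspace A" by (rule g_moduleD(1)[OF E(1)])
    show "cbilinear_on UNIV A A actA"
      using g_moduleD(2,3)[OF E(1)] by (simp add: cbilinear_on_def)
    show "actA (lie_bracket x y) v = actA x (actA y v) - actA y (actA x v)" if "v \<in> A" for x y v
      by (rule g_moduleD(4)[OF E(1) that])
    show "clinear_on A B i" "inj_on i A" by (rule E)+
    show "i ` A = {m \<in> B. yoneda_map d m = 0}"
      using E(7) by (auto simp: yoneda_map_def zero_prod_def)
    show "yoneda_map d ` B = {n \<in> ext_carrier C. snd n = 0}"
      unfolding yoneda_map_def ext_carrier_def using E(8) by auto
    show "lie_hom_on (ext_carrier C) (ext_bracket actC \<alpha>) UNIV lie_bracket snd"
      by (auto simp: lie_hom_on_def clinear_on_def ext_bracket_def scaleC_prod_def)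
    show "snd ` ext_carrier C = UNIV"
      using complex_vector.subspace_0[OF subC] by (force simp: ext_carrier_def)
    show "i (actA (snd n) v) = yoneda_act actB n (i v)" if "v \<in> A" for n v
      using E(9)[OF that] by (simp add: yoneda_act_def split_def)
  qed
qed

section \<open>The class of a Yoneda product\<close>

lemma clinear_plus: "clinear F \<Longrightarrow> clinear G \<Longrightarrow> clinear (F + G)"
  by (simp add: clinear_iff scaleC_add_right add_ac)

lemma ce_d2_trivial:
  "ce_d2 trivial_act b x y z = - b (lie_bracket x y) z + b (lie_bracket x z) y - b (lie_bracket y z) x"
  by (simp add: ce_d2_def trivial_act_def)

lemma ce_d2_trivial_in_Z3:
  fixes b :: "'g::complex_lie_algebra \<Rightarrow> 'g \<Rightarrow> 'v::complex_vector"
  assumes b: "b \<in> ce_C2 UNIV"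
  shows "ce_d2 trivial_act b \<in> ce_Z3 UNIV trivial_act"
proof -
  note lin1 = clinearD[OF ce_C2D(2)[OF b]] and lin2 = clinearD[OF ce_C2D(1)[OF b]]
  note br = clinearD[OF clinear_lie_bracket_left] clinearD[OF clinear_lie_bracket_right]
  let ?c = "ce_d2 trivial_act b :: 'g \<Rightarrow> 'g \<Rightarrow> 'g \<Rightarrow> 'v"
  have "clinear (?c x y)" "clinear (\<lambda>y. ?c x y z)" "clinear (\<lambda>x. ?c x y z)" for x y z
    by (rule clinearI; simp add: ce_d2_trivial lin1 lin2 br complex_vector.scale_right_diff_distrib
        scaleC_add_right complex_vector.scale_minus_right algebra_simps)+
  moreover have "?c x x y = 0" "?c x y y = 0" "?c x y x = 0" for x y
    using lie_bracket_swap[of y x] by (simp_all add: ce_d2_trivial lie_bracket_self lin1)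
  ultimately have C3: "?c \<in> ce_C3 UNIV"
    by (simp add: ce_C3_def cbilinear_on_def clinear_on_UNIV)
  have "ce_d3 trivial_act ?c w x y z = 0" for w x y z
  proof -
    \<comment> \<open>The iterated brackets group by the letter s left outside them, and each group
      is a Jacobi sum; the remaining terms pair off by antisymmetry of b.\<close>
    define J where "J p q r s = b (lie_bracket (lie_bracket p q) r) s - b (lie_bracket (lie_bracket p r) q) s
      + b (lie_bracket (lie_bracket q r) p) s" for p q r s
    have J: "J p q r s = 0" for p q r s
    proof -
      have "lie_bracket (lie_bracket p q) r = lie_bracket (lie_bracket p r) q - lie_bracket (lie_bracket q r) p"
      proof -
        have "lie_bracket p (lie_bracket q r) = - lie_bracket (lie_bracket q r) p"
          "lie_bracket r (lie_bracket p q) = - lie_bracket (lie_bracket p q) r"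
          by (rule lie_bracket_swap)+
        moreover have "lie_bracket q (lie_bracket r p) = lie_bracket (lie_bracket p r) q"
          by (subst lie_bracket_swap, subst lie_bracket_swap[of r p]) (simp add: br)
        ultimately show ?thesis using lie_jacobi[of p q r] by (simp add: algebra_simps)
      qed
      then show ?thesis by (simp add: J_def lin1)
    qed
    have S: "b p q + b q p = 0" for p q
      using ce_C2_antisym[OF b, of p q] by simp
    have "ce_d3 trivial_act ?c w x y z = J w x y z - J w x z y + J w y z x - J x y z w
        + (b (lie_bracket y z) (lie_bracket w x) + b (lie_bracket w x) (lie_bracket y z))
        - (b (lie_bracket x z) (lie_bracket w y) + b (lie_bracket w y) (lie_bracket x z))
        + (b (lie_bracket x y) (lie_bracket w z) + b (lie_bracket w z) (lie_bracket x y))"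
      by (simp add: ce_d3_def ce_d2_trivial trivial_act_def J_def algebra_simps)
    then show ?thesis by (simp only: J S) simp
  qed
  with C3 show ?thesis by (simp add: ce_Z3_def)
qed

lemma ce_Z3_add:
  fixes f g :: "'g::complex_lie_algebra \<Rightarrow> 'g \<Rightarrow> 'g \<Rightarrow> 'v::complex_vector"
  assumes "f \<in> ce_Z3 UNIV trivial_act" "g \<in> ce_Z3 UNIV trivial_act"
  shows "f + g \<in> ce_Z3 UNIV trivial_act"
proof -
  have "ce_d3 trivial_act (f + g) w x y z = ce_d3 trivial_act f w x y z + ce_d3 trivial_act g w x y z" for w x y z
    by (simp add: ce_d3_def trivial_act_def algebra_simps)
  then show ?thesis
    using assms
    by (auto simp: ce_Z3_def ce_C3_def cbilinear_on_def clinear_on_UNIV clinear_plus clinear_add)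
qed

lemma ce_class3_add_coboundary:
  fixes f :: "'g::complex_lie_algebra \<Rightarrow> 'g \<Rightarrow> 'g \<Rightarrow> 'v::complex_vector"
  assumes e: "e \<in> ce_C2 UNIV"
  shows "ce_class3 UNIV trivial_act (f + ce_d2 trivial_act e) = ce_class3 UNIV trivial_act f"
proof -
  have d2: "ce_d2 trivial_act (a + s *\<^sub>C b) = ce_d2 trivial_act a + s *\<^sub>C ce_d2 trivial_act b"
    for a b :: "'g \<Rightarrow> 'g \<Rightarrow> 'v" and s
    by (simp add: fun_eq_iff ce_d2_trivial scaleC_fun_def algebra_simps scaleC_add_right
        complex_vector.scale_right_diff_distrib)
  have mem: "a + s *\<^sub>C e \<in> ce_C2 UNIV" if "a \<in> ce_C2 UNIV" for a s
    using ce_C2D[OF that] ce_C2D[OF e]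
    by (intro ce_C2I) (simp_all add: scaleC_fun_def clinear_plus clinear_add clinear_scaleC)
  have shift: "u + s *\<^sub>C ce_d2 trivial_act e \<in> ce_B3 UNIV trivial_act" if "u \<in> ce_B3 UNIV trivial_act" for u s
    using that mem by (auto simp: ce_B3_def simp flip: d2)
  have "h - (f + ce_d2 trivial_act e) \<in> ce_B3 UNIV trivial_act \<longleftrightarrow> h - f \<in> ce_B3 UNIV trivial_act" for h
  proof
    assume "h - (f + ce_d2 trivial_act e) \<in> ce_B3 UNIV trivial_act"
    from shift[OF this, of 1] show "h - f \<in> ce_B3 UNIV trivial_act" by (simp add: scaleC_one)
  next
    assume "h - f \<in> ce_B3 UNIV trivial_act"
    from shift[OF this, of "- 1"] show "h - (f + ce_d2 trivial_act e) \<in> ce_B3 UNIV trivial_act"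
      by (simp add: scaleC_one diff_diff_add)
  qed
  then show ?thesis by (simp add: ce_class3_def)
qed

text \<open>f is the image of \<alpha> under the connecting homomorphism. The section (0, x) with
  the lift \<beta> gives f itself. Any other section has a first component h, lifted to a 1-cochain
  k in B; then b differs from \<beta> by the coboundary of k, which contributes nothing, and by a
  scalar-type cochain e with values in the kernel, which changes f by its coboundary.\<close>

lemma yoneda_represents_class:
  fixes i :: "'v::complex_vector \<Rightarrow> 'b::complex_vector" and f :: "'g::complex_lie_algebra \<Rightarrow> 'g \<Rightarrow> 'g \<Rightarrow> 'v"
  assumes se: "g_module_short_exact UNIV trivial_act i B actB d C actC"
    and f: "f \<in> ce_Z3 UNIV trivial_act"
    and \<beta>: "\<beta> \<in> ce_C2 B" and d\<beta>: "\<And>x y. d (\<beta> x y) = \<alpha> x y"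
    and cob: "\<And>x y z. ce_d2 actB \<beta> x y z = i (f x y z)"
    and s: "clinear_on C B s" "\<And>c. c \<in> C \<Longrightarrow> d (s c) = c"
  shows "represents_class UNIV trivial_act i B (yoneda_map d) (ext_carrier C) (ext_bracket actC \<alpha>)
    (yoneda_act actB) snd f"
proof -
  note E = g_module_short_exactD[OF se]
  note subB = g_moduleD(1)[OF E(2)] and subC = g_moduleD(1)[OF E(3)]
  have i: "clinear i" "i v \<in> B" for v using E(4) by (auto simp: clinear_on_UNIV)
  have inj: "inj i" by (rule E(6))
  have C0: "0 \<in> C" by (rule complex_vector.subspace_0[OF subC])
  have act0: "actC x 0 = 0" for x
    by (rule clinear_on_diff(3)[OF g_moduleD(2)[OF E(3)] subC C0 C0])
  have actB1: "actB x b \<in> B" if "b \<in> B" for x b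
    by (rule clinear_onD(1)[OF g_moduleD(2)[OF E(2)] that that])
  have actB2: "actB x (b + b') = actB x b + actB x b'" "actB x (b - b') = actB x b - actB x b'"
    if "b \<in> B" "b' \<in> B" for x b b'
    using clinear_onD[OF g_moduleD(2)[OF E(2)] that] clinear_on_diff[OF g_moduleD(2)[OF E(2)] subB that] by auto
  note actB = actB1 actB2
  note closed = complex_vector.subspace_add[OF subB] complex_vector.subspace_diff[OF subB]
  have "crossed_choice B (yoneda_map d) (ext_carrier C) (ext_bracket actC \<alpha>) snd (\<lambda>x. (0, x)) \<beta>"
    by (simp add: crossed_choice_def clinear_on_def ext_carrier_def C0 scaleC_prod_def \<beta> yoneda_map_def
        ext_bracket_def act0 d\<beta>)
  moreover have "\<exists>c\<in>ce_Z3 UNIV trivial_act. (\<forall>x y z. i (c x y z) = crossed_cocycle (yoneda_act actB) \<rho> b x y z) \<and>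
        ce_class3 UNIV trivial_act c = ce_class3 UNIV trivial_act f"
    if choice: "crossed_choice B (yoneda_map d) (ext_carrier C) (ext_bracket actC \<alpha>) snd \<rho> b" for \<rho> b
  proof -
    have \<rho>: "clinear \<rho>" "\<rho> x \<in> ext_carrier C" "snd (\<rho> x) = x" and b: "b \<in> ce_C2 B"
      and db: "yoneda_map d (b x y) = ext_bracket actC \<alpha> (\<rho> x) (\<rho> y) - \<rho> (lie_bracket x y)" for x y
      using choice by (auto simp: crossed_choice_def clinear_on_UNIV)
    define h where "h x = fst (\<rho> x)" for x
    have \<rho>_eq: "\<rho> x = (h x, x)" for x using \<rho>(3)[of x] by (simp add: h_def prod_eq_iff)
    have hC: "h x \<in> C" for x using \<rho>(2)[of x] by (simp add: \<rho>_eq ext_carrier_def)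
    have h: "clinear h"
      using clinearD[OF \<rho>(1)] by (intro clinearI) (simp_all add: h_def scaleC_prod_def)
    define k where "k x = s (h x)" for x
    have kB: "k x \<in> B" and dk: "d (k x) = h x" for x
      using clinear_onD(1)[OF s(1) hC hC] s(2)[OF hC] by (simp_all add: k_def)
    have k: "clinear k"
      using clinear_onD(2,3)[OF s(1) hC hC] by (intro clinearI) (simp_all add: k_def clinearD[OF h])
    \<comment> \<open>The coboundary of the 1-cochain k; it accounts for the change from the section
      (0, x) to \<open>\<rho>\<close>.\<close>
    define \<delta> where "\<delta> x y = actB x (k y) - actB y (k x) - k (lie_bracket x y)" for x y
    have \<delta>B: "\<delta> x y \<in> B" for x y by (simp add: \<delta>_def closed actB(1) kB)
    have lin_act: "clinear (\<lambda>x. actB x v)" if "v \<in> B" for v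
      using g_moduleD(3)[OF E(2) that] by (simp add: clinear_on_UNIV)
    have lin_actk: "clinear (\<lambda>y. actB x (k y))" for x
      using clinear_onD[OF g_moduleD(2)[OF E(2)] kB kB] by (intro clinearI) (simp_all add: clinearD[OF k])
    have \<delta>C2: "\<delta> \<in> ce_C2 B"
    proof (rule ce_C2I)
      show "clinear (\<delta> x)" for x
        unfolding \<delta>_def
        by (intro clinear_minus lin_actk lin_act kB clinear_compose2[OF k clinear_lie_bracket_right])
      show "clinear (\<lambda>x. \<delta> x y)" for y
        unfolding \<delta>_def
        by (intro clinear_minus lin_actk lin_act kB clinear_compose2[OF k clinear_lie_bracket_left])
      show "\<delta> x x = 0" for x by (simp add: \<delta>_def lie_bracket_self clinearD[OF k])
    qed (rule \<delta>B)
    have \<delta>_cycl: "ce_cycl actB \<delta> x y z = 0" for x y z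
    proof -
      have jac: "k (lie_bracket (lie_bracket x y) z) + k (lie_bracket (lie_bracket y z) x)
          + k (lie_bracket (lie_bracket z x) y) = 0"
      proof -
        have "lie_bracket (lie_bracket x y) z + lie_bracket (lie_bracket y z) x + lie_bracket (lie_bracket z x) y
          = - (lie_bracket x (lie_bracket y z) + lie_bracket y (lie_bracket z x) + lie_bracket z (lie_bracket x y))"
          using lie_bracket_swap[of "lie_bracket x y" z] lie_bracket_swap[of "lie_bracket y z" x]
            lie_bracket_swap[of "lie_bracket z x" y] by simp
        then show ?thesis by (simp add: lie_jacobi clinearD[OF k] flip: clinearD(1)[OF k])
      qed
      have br: "actB (lie_bracket u v) (k w) = actB u (actB v (k w)) - actB v (actB u (k w))" for u v w
        by (rule g_moduleD(4)[OF E(2) kB])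
      have "ce_cycl actB \<delta> x y z = k (lie_bracket (lie_bracket x y) z) + k (lie_bracket (lie_bracket y z) x)
          + k (lie_bracket (lie_bracket z x) y)"
        by (simp add: ce_cycl_def \<delta>_def actB closed kB br algebra_simps)
      then show ?thesis by (simp add: jac)
    qed
    \<comment> \<open>Both b and \<open>\<beta> + \<delta>\<close> lift the curvature of
      \<open>\<rho>\<close>, so their difference lies in the kernel of d, the range of i.\<close>
    define e where "e x y = inv i (b x y - \<beta> x y - \<delta> x y)" for x y
    have ie: "i (e x y) = b x y - \<beta> x y - \<delta> x y" for x y
    proof -
      let ?u = "b x y - \<beta> x y - \<delta> x y"
      have uB: "?u \<in> B" by (simp add: closed ce_C2D(3)[OF b] ce_C2D(3)[OF \<beta>] \<delta>B)
      have dd: "d (u - v) = d u - d v" if "u \<in> B" "v \<in> B" for u v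
        by (rule clinear_on_diff(1)[OF E(5) subB that])
      have "d (b x y) = actC x (h y) - actC y (h x) + \<alpha> x y - h (lie_bracket x y)"
        using db[of x y] by (simp add: yoneda_map_def ext_bracket_def \<rho>_eq)
      then have "d ?u = 0"
        by (simp add: dd closed actB(1) ce_C2D(3)[OF b] ce_C2D(3)[OF \<beta>] kB d\<beta> \<delta>_def E(10) dk)
      with uB have "?u \<in> range i" using E(7) by blast
      then show ?thesis unfolding e_def by (rule f_inv_into_f)
    qed
    have e: "e \<in> ce_C2 UNIV"
    proof (rule ce_C2I)
      show "clinear (e x)" for x
        by (rule clinearI; rule injD[OF inj]) (simp_all add: clinearD[OF i(1)] ie clinearD[OF ce_C2D(1)[OF b]]
          clinearD[OF ce_C2D(1)[OF \<beta>]] clinearD[OF ce_C2D(1)[OF \<delta>C2]] complex_vector.scale_right_diff_distrib)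
      show "clinear (\<lambda>x. e x y)" for y
        by (rule clinearI; rule injD[OF inj]) (simp_all add: clinearD[OF i(1)] ie clinearD[OF ce_C2D(2)[OF b]]
          clinearD[OF ce_C2D(2)[OF \<beta>]] clinearD[OF ce_C2D(2)[OF \<delta>C2]] complex_vector.scale_right_diff_distrib)
      show "e x x = 0" for x
        by (rule injD[OF inj]) (simp add: ie clinearD[OF i(1)] ce_C2D(4)[OF b] ce_C2D(4)[OF \<beta>] ce_C2D(4)[OF \<delta>C2])
    qed simp
    let ?c = "f + ce_d2 trivial_act e"
    have "i (?c x y z) = crossed_cocycle (yoneda_act actB) \<rho> b x y z" for x y z
    proof -
      have bsum: "b u v = \<beta> u v + (\<delta> u v + i (e u v))" for u v by (simp add: ie)
      have acti: "actB u (i v) = 0" for u v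
        using E(9)[of v u] by (simp add: trivial_act_def clinearD[OF i(1)])
      have "crossed_cocycle (yoneda_act actB) \<rho> b x y z = ce_cycl actB b x y z"
        by (simp add: crossed_cocycle_def ce_cycl_def yoneda_act_def \<rho>_eq)
      also have "\<dots> = ce_cycl actB \<beta> x y z + (ce_cycl actB \<delta> x y z + i (ce_cycl trivial_act e x y z))"
        unfolding ce_cycl_def bsum
        by (simp add: actB closed ce_C2D(3)[OF \<beta>] \<delta>B i acti clinearD[OF i(1)] trivial_act_def algebra_simps)
      also have "ce_cycl trivial_act e x y z = ce_d2 trivial_act e x y z"
        by (rule ce_d2_eq_cycl[OF E(1) e, symmetric])
      also have "ce_cycl actB \<beta> x y z = i (f x y z)"
        using ce_d2_eq_cycl[OF E(2) \<beta>] cob by simp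
      finally show ?thesis by (simp add: \<delta>_cycl clinearD[OF i(1)])
    qed
    moreover have "?c \<in> ce_Z3 UNIV trivial_act"
      by (rule ce_Z3_add[OF f ce_d2_trivial_in_Z3[OF e]])
    ultimately show ?thesis using ce_class3_add_coboundary[OF e, of f] by blast
  qed
  ultimately show ?thesis unfolding represents_class_def by blast
qed

section \<open>Duals of the enveloping algebra\<close>

lemma counit_simps:
  fixes x y :: "'g::complex_lie_algebra uea"
  shows "counit (x + y) = counit x + counit y" "counit (x - y) = counit x - counit y"
    "counit (c *\<^sub>C x) = c * counit x" "counit (0 :: 'g uea) = 0"
    "counit (1 :: 'g uea) = 1" "counit (x * y) = counit x * counit y"
  by (simp_all add: clinearD[OF clinear_counit] algebra_homD(2,3)[OF counit(1)])

lemma csubspace_aug_ideal: "csubspace aug_ideal"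
  by (simp add: complex_vector.subspace_def aug_ideal_def counit_simps)

lemma aug_ideal_mult_incl: "x * uea_incl g \<in> aug_ideal"
  by (simp add: aug_ideal_def counit_simps counit(2))

lemma csubspace_dual_space: "csubspace W \<Longrightarrow> csubspace (dual_space W)"
  by (subst complex_vector.subspace_def)
    (auto simp: dual_space_def clinear_on_def scaleC_fun_def complex_vector.subspace_add
      complex_vector.subspace_scale algebra_simps)

lemma dual_spaceD:
  assumes "\<phi> \<in> dual_space W"
  shows "x \<in> W \<Longrightarrow> y \<in> W \<Longrightarrow> \<phi> (x + y) = \<phi> x + \<phi> y" "x \<in> W \<Longrightarrow> \<phi> (c *\<^sub>C x) = c * \<phi> x"
    "x \<notin> W \<Longrightarrow> \<phi> x = 0" "csubspace W \<Longrightarrow> x \<in> W \<Longrightarrow> y \<in> W \<Longrightarrow> \<phi> (x - y) = \<phi> x - \<phi> y"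
  using assms clinear_on_diff(1)[of W UNIV \<phi> x y] by (auto simp: dual_space_def clinear_on_def)

lemma uea_dual_iff: "\<phi> \<in> uea_dual \<longleftrightarrow> clinear \<phi>"
  by (simp add: dual_space_def clinear_on_UNIV)

text \<open>Serves both U\<gg> and its augmentation ideal: right multiplication by an element of
  \<gg> carries all of U\<gg> into either.\<close>

lemma g_module_dual:
  fixes W :: "'g::complex_lie_algebra uea set"
  assumes W: "csubspace W" and mult: "\<And>x g. x * uea_incl g \<in> W"
  shows "g_module (dual_space W) (dual_act W)"
proof (rule g_moduleI)
  show "csubspace (dual_space W)" by (rule csubspace_dual_space[OF W])
  note WD = complex_vector.subspace_add[OF W] complex_vector.subspace_scale[OF W]
  have mem: "dual_act W g \<phi> \<in> dual_space W" if "\<phi> \<in> dual_space W" for g \<phi>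
    using dual_spaceD(1,2)[OF that] WD mult
    by (auto simp: dual_space_def dual_act_def clinear_on_def distrib_right scaleC_mult_left)
  show "cbilinear_on UNIV (dual_space W) (dual_space W) (dual_act W)"
    unfolding cbilinear_on_def
  proof (intro conjI ballI)
    show "clinear_on (dual_space W) (dual_space W) (dual_act W g)" for g
      unfolding clinear_on_def by (auto simp: mem) (auto simp: dual_act_def fun_eq_iff scaleC_fun_def)
    show "clinear_on UNIV (dual_space W) (\<lambda>g. dual_act W g \<phi>)" if "\<phi> \<in> dual_space W" for \<phi>
      using dual_spaceD(1,2)[OF that]
      by (simp add: clinear_on_def mem[OF that])
        (simp add: dual_act_def fun_eq_iff scaleC_fun_def uea_incl_linear distrib_left scaleC_mult_right mult)
  qed
  show "dual_act W (lie_bracket g h) \<phi> = dual_act W g (dual_act W h \<phi>) - dual_act W h (dual_act W g \<phi>)"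
    if "\<phi> \<in> dual_space W" for g h \<phi>
    using dual_spaceD(4)[OF that W]
    by (simp add: dual_act_def fun_eq_iff uea_incl_bracket right_diff_distrib mult mult.assoc[symmetric])
qed

text \<open>The linear splitting given by U\<gg> = U\<gg>+ \<oplus> C 1: extend a functional by zero
  on 1.\<close>

definition dual_section :: "('g::complex_lie_algebra uea \<Rightarrow> complex) \<Rightarrow> 'g uea \<Rightarrow> complex"
  where "dual_section \<psi> = (\<lambda>x. \<psi> (x - counit x *\<^sub>C 1))"

lemma reduced_in_aug_ideal: "x - counit x *\<^sub>C 1 \<in> aug_ideal"
  by (simp add: aug_ideal_def counit_simps)

lemma dual_section:
  fixes \<psi> :: "'g::complex_lie_algebra uea \<Rightarrow> complex"
  shows "clinear_on aug_dual uea_dual (dual_section :: ('g uea \<Rightarrow> complex) \<Rightarrow> _)"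
    and "\<psi> \<in> aug_dual \<Longrightarrow> restrict_aug (dual_section \<psi>) = \<psi>"
proof -
  have "clinear (dual_section \<psi>)" if \<psi>: "\<psi> \<in> aug_dual" for \<psi> :: "'g uea \<Rightarrow> complex"
  proof (rule clinearI)
    fix x y :: "'g uea" and c
    have "x + y - counit (x + y) *\<^sub>C 1 = (x - counit x *\<^sub>C 1) + (y - counit y *\<^sub>C 1)"
      by (simp add: counit_simps scaleC_add_left)
    then show "dual_section \<psi> (x + y) = dual_section \<psi> x + dual_section \<psi> y"
      unfolding dual_section_def by (simp only: dual_spaceD(1)[OF \<psi>] reduced_in_aug_ideal)
    have "c *\<^sub>C x - counit (c *\<^sub>C x) *\<^sub>C 1 = c *\<^sub>C (x - counit x *\<^sub>C 1)"
      by (simp add: counit_simps complex_vector.scale_right_diff_distrib scaleC_scaleC)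
    then show "dual_section \<psi> (c *\<^sub>C x) = c *\<^sub>C dual_section \<psi> x"
      unfolding dual_section_def by (simp only: dual_spaceD(2)[OF \<psi>] reduced_in_aug_ideal scaleC_complex_def)
  qed
  then show "clinear_on aug_dual uea_dual (dual_section :: ('g uea \<Rightarrow> complex) \<Rightarrow> _)"
    by (simp add: clinear_on_def uea_dual_iff) (simp add: dual_section_def fun_eq_iff scaleC_fun_def)
  show "restrict_aug (dual_section \<psi>) = \<psi>" if "\<psi> \<in> aug_dual"
    using dual_spaceD(3)[OF that]
    by (auto simp: restrict_aug_def dual_section_def fun_eq_iff aug_ideal_def)
qed

lemma restrict_aug_mem: "\<phi> \<in> uea_dual \<Longrightarrow> restrict_aug \<phi> \<in> aug_dual"
  unfolding uea_dual_iff
  by (auto simp: dual_space_def restrict_aug_def clinear_on_def clinear_iff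
      complex_vector.subspace_add[OF csubspace_aug_ideal] complex_vector.subspace_scale[OF csubspace_aug_ideal])

lemma counit_dual_short_exact:
  "g_module_short_exact UNIV (trivial_act :: 'g::complex_lie_algebra \<Rightarrow> _) counit_dual
    uea_dual uea_dual_act restrict_aug aug_dual aug_dual_act"
  unfolding g_module_short_exact_def short_exact_def
proof (intro conjI allI ballI)
  show "g_module UNIV (trivial_act :: 'g \<Rightarrow> complex \<Rightarrow> _)"
    by (rule g_moduleI) (simp_all add: complex_vector.subspace_UNIV cbilinear_on_def clinear_on_def trivial_act_def)
  show "g_module (uea_dual :: ('g uea \<Rightarrow> complex) set) uea_dual_act"
    by (rule g_module_dual) (simp_all add: complex_vector.subspace_UNIV)
  show "g_module (aug_dual :: ('g uea \<Rightarrow> complex) set) aug_dual_act"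
    by (rule g_module_dual[OF csubspace_aug_ideal aug_ideal_mult_incl])
  have mem: "counit_dual z \<in> (uea_dual :: ('g uea \<Rightarrow> complex) set)" for z
    unfolding uea_dual_iff by (rule clinearI) (simp_all add: counit_dual_def counit_simps algebra_simps)
  then show "clinear_on UNIV (uea_dual :: ('g uea \<Rightarrow> complex) set) counit_dual"
    by (simp add: clinear_on_def) (simp add: counit_dual_def fun_eq_iff scaleC_fun_def algebra_simps)
  show "clinear_on (uea_dual :: ('g uea \<Rightarrow> complex) set) aug_dual restrict_aug"
    by (simp add: clinear_on_def restrict_aug_mem) (auto simp: restrict_aug_def fun_eq_iff scaleC_fun_def)
  show "inj (counit_dual :: complex \<Rightarrow> 'g uea \<Rightarrow> _)"
  proof (rule injI)
    fix z z' assume "(counit_dual z :: 'g uea \<Rightarrow> complex) = counit_dual z'"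
    then have "counit_dual z (1 :: 'g uea) = counit_dual z' (1 :: 'g uea)" by (rule fun_cong)
    then show "z = z'" by (simp add: counit_dual_def counit_simps)
  qed
  show "range counit_dual = {\<phi> \<in> (uea_dual :: ('g uea \<Rightarrow> complex) set). restrict_aug \<phi> = 0}"
  proof (intro set_eqI iffI)
    fix \<phi> :: "'g uea \<Rightarrow> complex" assume "\<phi> \<in> range counit_dual"
    then show "\<phi> \<in> {\<phi> \<in> uea_dual. restrict_aug \<phi> = 0}"
      using mem by (auto simp: restrict_aug_def counit_dual_def aug_ideal_def fun_eq_iff)
  next
    fix \<phi> :: "'g uea \<Rightarrow> complex" assume "\<phi> \<in> {\<phi> \<in> uea_dual. restrict_aug \<phi> = 0}"
    then have lin: "clinear \<phi>" and zero: "restrict_aug \<phi> = 0" by (simp_all add: uea_dual_iff)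
    \<comment> \<open>A functional that vanishes on the augmentation ideal is fixed by its value at
      1, since \<open>x - counit x *\<^sub>C 1\<close> lies in the ideal.\<close>
    have eq: "\<phi> x = \<phi> 1 * counit x" for x
    proof -
      have "restrict_aug \<phi> (x - counit x *\<^sub>C 1) = 0" by (simp add: zero)
      then have "\<phi> (x - counit x *\<^sub>C 1) = 0" by (simp add: restrict_aug_def reduced_in_aug_ideal)
      then show ?thesis by (simp add: clinearD[OF lin] mult.commute)
    qed
    have "\<phi> = counit_dual (\<phi> 1)" unfolding counit_dual_def by (rule ext, rule eq)
    then show "\<phi> \<in> range counit_dual" by blast
  qed
  show "restrict_aug ` uea_dual = (aug_dual :: ('g uea \<Rightarrow> complex) set)"
  proof
    show "restrict_aug ` uea_dual \<subseteq> (aug_dual :: ('g uea \<Rightarrow> complex) set)" using restrict_aug_mem by blast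
    show "(aug_dual :: ('g uea \<Rightarrow> complex) set) \<subseteq> restrict_aug ` uea_dual"
    proof
      fix \<psi> :: "'g uea \<Rightarrow> complex" assume \<psi>: "\<psi> \<in> aug_dual"
      have "dual_section \<psi> \<in> uea_dual" by (rule clinear_onD(1)[OF dual_section(1) \<psi> \<psi>])
      with dual_section(2)[OF \<psi>] show "\<psi> \<in> restrict_aug ` uea_dual" by (metis imageI)
    qed
  qed
  show "counit_dual (trivial_act g z) = uea_dual_act g (counit_dual z)" for g :: 'g and z
    by (simp add: trivial_act_def counit_dual_def dual_act_def counit_simps counit(2))
  show "restrict_aug (uea_dual_act g \<phi>) = aug_dual_act g (restrict_aug \<phi>)" for g :: 'g and \<phi>
    using aug_ideal_mult_incl by (auto simp: restrict_aug_def dual_act_def fun_eq_iff)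
qed

section \<open>The cocycle \<open>\<alpha>\<close>\<close>

definition unit_integral :: "complex poly \<Rightarrow> complex"
  where "unit_integral p = integral {0..1} (\<lambda>t::real. poly p (of_real t))"

lemma poly_integrable: "(\<lambda>t::real. poly p (complex_of_real t)) integrable_on {0..1}"
  by (intro integrable_continuous_interval continuous_intros)

lemma clinear_unit_integral: "clinear unit_integral"
  by (rule clinearI)
    (simp_all add: unit_integral_def integral_add poly_integrable)

lemma unit_integral_pderiv: "unit_integral (pderiv p) = poly p 1 - poly p 0"
proof -
  have "((\<lambda>t::real. poly (pderiv p) (complex_of_real t)) has_integral
      (poly p (complex_of_real 1) - poly p (complex_of_real 0))) {0..1}"
  proof (rule fundamental_theorem_of_calculus)
    fix t :: real
    show "((\<lambda>t. poly p (complex_of_real t)) has_vector_derivative poly (pderiv p) (complex_of_real t)) (at t within {0..1})"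
      by (rule has_vector_derivative_real_field[OF poly_DERIV])
  qed simp
  then show ?thesis by (simp add: unit_integral_def integral_unique)
qed

text \<open>\<open>\<alpha>\<close> is given by the same formula on all of \<open>U\<gg>\<close>; this lifts it to a cochain with values in \<open>(U\<gg>)\<^sup>\<or>\<close>.\<close>

definition alpha_lift :: "('g::complex_lie_algebra \<Rightarrow> 'g \<Rightarrow> 'g \<Rightarrow> complex) \<Rightarrow> 'g \<Rightarrow> 'g \<Rightarrow> 'g uea \<Rightarrow> complex"
  where "alpha_lift f u v x = unit_integral (alpha_integrand f u v x)"

lemma restrict_alpha_lift: "restrict_aug (alpha_lift f u v) = alpha f u v"
  by (simp add: restrict_aug_def alpha_lift_def alpha_def unit_integral_def fun_eq_iff)

context three_cocycle
begin

lemma clinear_alpha_lift: "clinear (alpha_lift f u v)"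
  unfolding alpha_lift_def
  by (rule clinear_compose2[OF clinear_unit_integral alpha_integrand(1)[OF ctrilinear]])

text \<open>Checked on divided powers, where the explicit formula shows linearity in u and v
  although \<open>A_form\<close> is defined by an inverse.\<close>

lemma alpha_integrand_linear:
  "clinear (\<lambda>u. alpha_integrand f u v x)" "clinear (\<lambda>v. alpha_integrand f u v x)"
proof -
  note lin = alpha_integrand(1)[OF ctrilinear] and E = alpha_integrand(2)[OF ctrilinear]
  note N = clinearD[OF clinear_ad_pow]
  show "clinear (\<lambda>u. alpha_integrand f u v x)"
  proof (rule clinearI)
    show "alpha_integrand f (u + u') v x = alpha_integrand f u v x + alpha_integrand f u' v x" for u u'
      by (rule uea_divpow_ext[OF lin clinear_add[OF lin lin]])
        (simp only: E N linear2 smult_add_left sum.distrib)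
    show "alpha_integrand f (c *\<^sub>C u) v x = c *\<^sub>C alpha_integrand f u v x" for c u
      by (rule uea_divpow_ext[OF lin clinear_scaleC[OF lin]])
        (simp add: E N linear2 smult_sum_right)
  qed
  show "clinear (\<lambda>v. alpha_integrand f u v x)"
  proof (rule clinearI)
    show "alpha_integrand f u (v + v') x = alpha_integrand f u v x + alpha_integrand f u v' x" for v v'
      by (rule uea_divpow_ext[OF lin clinear_add[OF lin lin]])
        (simp only: E N linear3 smult_add_left sum.distrib)
    show "alpha_integrand f u (c *\<^sub>C v) x = c *\<^sub>C alpha_integrand f u v x" for c v
      by (rule uea_divpow_ext[OF lin clinear_scaleC[OF lin]])
        (simp add: E N linear3 smult_sum_right)
  qed
qed

text \<open>Reversing j to n - 1 - j and using antisymmetry of f shows that the sum equals its own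
  negative.\<close>

lemma alpha_integrand_alternating: "alpha_integrand f u u x = 0"
proof (rule uea_divpow_ext[OF alpha_integrand(1)[OF ctrilinear] clinear_const_zero])
  fix y n
  let ?F = "\<lambda>j k. smult (f y (ad_pow y j u) (ad_pow y k u)) (todd_poly j * todd_poly k)"
  have "(\<Sum>j<n. ?F j (n - Suc j)) = (\<Sum>j<n. ?F (n - Suc j) j)"
    by (rule sum.reindex_bij_witness[of _ "\<lambda>j. n - Suc j" "\<lambda>j. n - Suc j"]) auto
  also have "\<dots> = (\<Sum>j<n. - ?F j (n - Suc j))"
    by (rule sum.cong[OF refl], subst swap23) (simp add: mult.commute)
  finally have neg: "(\<Sum>j<n. ?F j (n - Suc j)) = - (\<Sum>j<n. ?F j (n - Suc j))"
    by (simp only: sum_negf)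
  have "(\<Sum>j<n. ?F j (n - Suc j)) + (\<Sum>j<n. ?F j (n - Suc j)) = 0"
    by (subst (2) neg) (rule add.right_inverse)
  then have "2 * (\<Sum>j<n. ?F j (n - Suc j)) = 0" by (simp only: mult_2)
  then have "(\<Sum>j<n. ?F j (n - Suc j)) = 0" by (simp only: mult_eq_0_iff) simp
  then show "alpha_integrand f u u (divpow y n) = 0" by (simp add: alpha_integrand(2)[OF ctrilinear])
qed

lemma alpha_lift_C2: "alpha_lift f \<in> ce_C2 uea_dual"
proof (rule ce_C2I)
  note I = clinearD[OF clinear_unit_integral]
  show "clinear (alpha_lift f u)" for u
    by (rule clinearI)
      (simp_all add: alpha_lift_def fun_eq_iff scaleC_fun_def clinearD[OF alpha_integrand_linear(2)] I
        flip: scaleC_complex_poly)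
  show "clinear (\<lambda>u. alpha_lift f u v)" for v
    by (rule clinearI)
      (simp_all add: alpha_lift_def fun_eq_iff scaleC_fun_def clinearD[OF alpha_integrand_linear(1)] I
        flip: scaleC_complex_poly)
  show "alpha_lift f u v \<in> uea_dual" for u v
    unfolding uea_dual_iff by (rule clinear_alpha_lift)
  show "alpha_lift f u u = 0" for u
    by (simp add: alpha_lift_def fun_eq_iff alpha_integrand_alternating I)
qed

text \<open>The integral is f(A_1 u, A_1 v, A_1 w) - f(A_0 u, A_0 v, A_0 w). As A_0 = 0 and A_1 = 1,
  only the part of degree 0 in y survives, and that is where the counit is nonzero.\<close>

lemma unit_integral_int_coboundary: "unit_integral (int_coboundary u v w x) = f u v w * counit x"
proof (rule uea_divpow_ext[of "\<lambda>x. unit_integral (int_coboundary u v w x)"])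
  note lin = alpha_integrand(1)[OF ctrilinear]
  have "clinear (int_coboundary u v w)"
    unfolding int_coboundary_def by (intro clinear_add clinear_minus lin clinear_compose2[OF lin clinear_mult_left])
  then show "clinear (\<lambda>x. unit_integral (int_coboundary u v w x))"
    by (rule clinear_compose2[OF clinear_unit_integral])
  show "clinear (\<lambda>x. f u v w * counit x)"
    by (rule clinearI) (simp_all add: counit_simps algebra_simps)
  fix y n
  have "unit_integral (int_coboundary u v w (divpow y n))
    = triple_sum n (\<lambda>i j k. f (ad_pow y i u) (ad_pow y j v) (ad_pow y k w)
      * ((if i = 0 then 1 else 0) * (if j = 0 then 1 else 0) * (if k = 0 then 1 else 0)))"
    unfolding int_coboundary_divpow unit_integral_pderiv triple_sum_def
    by (simp add: poly_sum del: mult_eq_0_iff)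
  also have "\<dots> = (if n = 0 then f u v w else 0)"
  proof (cases "n = 0")
    case False
    then show ?thesis
      unfolding triple_sum_def by (auto intro!: sum.neutral)
  qed (simp add: triple_sum_def)
  finally show "unit_integral (int_coboundary u v w (divpow y n)) = f u v w * counit (divpow y n)"
    by (simp add: counit_divpow)
qed

lemma ce_d2_alpha_lift: "ce_d2 uea_dual_act (alpha_lift f) u v w = counit_dual (f u v w)"
proof
  fix x
  have "ce_d2 uea_dual_act (alpha_lift f) u v w x = unit_integral (int_coboundary u v w x)"
    unfolding ce_d2_eq_cycl[OF g_module_short_exactD(2)[OF counit_dual_short_exact] alpha_lift_C2]
    by (simp add: ce_cycl_def dual_act_def alpha_lift_def int_coboundary_def clinearD[OF clinear_unit_integral])
  then show "ce_d2 uea_dual_act (alpha_lift f) u v w x = counit_dual (f u v w) x"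
    by (simp add: unit_integral_int_coboundary counit_dual_def)
qed

text \<open>Restriction to U\<gg>+ is equivariant and kills multiples of the counit, so the
  coboundary of \<open>alpha_lift\<close> restricts to zero.\<close>

lemma alpha_Z2: "alpha f \<in> ce_Z2 aug_dual aug_dual_act"
proof -
  note E = g_module_short_exactD[OF counit_dual_short_exact]
  note B = ce_C2D[OF alpha_lift_C2]
  have r: "restrict_aug (\<phi> + \<psi>) = restrict_aug \<phi> + restrict_aug \<psi>"
    "restrict_aug (c *\<^sub>C \<phi>) = c *\<^sub>C restrict_aug \<phi>"
    "restrict_aug (\<phi> - \<psi>) = restrict_aug \<phi> - restrict_aug \<psi>" for \<phi> \<psi> :: "'g uea \<Rightarrow> complex" and c
    by (auto simp: restrict_aug_def fun_eq_iff scaleC_fun_def)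
  have C2: "alpha f \<in> ce_C2 aug_dual"
  proof (rule ce_C2I)
    show "clinear (alpha f u)" for u
      unfolding restrict_alpha_lift[symmetric] by (rule clinearI) (simp_all only: clinearD[OF B(1)] r)
    show "clinear (\<lambda>u. alpha f u v)" for v
      unfolding restrict_alpha_lift[symmetric] by (rule clinearI) (simp_all only: clinearD[OF B(2)] r)
    show "alpha f u v \<in> aug_dual" for u v
      unfolding restrict_alpha_lift[symmetric] by (rule restrict_aug_mem[OF B(3)])
    show "alpha f u u = 0" for u
      unfolding restrict_alpha_lift[symmetric] B(4) by (simp add: restrict_aug_def fun_eq_iff)
  qed
  have "restrict_aug (counit_dual z) = (0 :: 'g uea \<Rightarrow> complex)" for z
    using E(7) by blast
  moreover have "ce_d2 aug_dual_act (alpha f) u v w = restrict_aug (ce_d2 uea_dual_act (alpha_lift f) u v w)" for u v w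
    by (simp add: ce_d2_def r E(10) B(3) restrict_alpha_lift)
  ultimately have "ce_d2 aug_dual_act (alpha f) u v w = 0" for u v w
    by (simp add: ce_d2_alpha_lift)
  with C2 show ?thesis by (simp add: ce_Z2_def)
qed

end


theorem corollary1:
  fixes f :: "'g::complex_lie_algebra \<Rightarrow> 'g \<Rightarrow> 'g \<Rightarrow> complex"
  assumes "f \<in> ce_Z3 UNIV trivial_act"
  shows "alpha f \<in> ce_Z2 aug_dual aug_dual_act \<and>
    g_module_short_exact
      UNIV trivial_act counit_dual uea_dual uea_dual_act restrict_aug aug_dual aug_dual_act \<and>
    crossed_extension
      UNIV trivial_act counit_dual uea_dual (\<lambda>_ _. 0) (yoneda_map restrict_aug)
      (ext_carrier aug_dual) (ext_bracket aug_dual_act (alpha f)) (yoneda_act uea_dual_act) snd \<and>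
    represents_class
      UNIV trivial_act counit_dual uea_dual (yoneda_map restrict_aug)
      (ext_carrier aug_dual) (ext_bracket aug_dual_act (alpha f)) (yoneda_act uea_dual_act) snd f"
proof -
  interpret three_cocycle f by (rule three_cocycle.intro[OF assms])
  note se = counit_dual_short_exact[where 'g = 'g]
  \<comment> \<open>Here \<beta> is \<open>alpha_lift f\<close> and the linear section s is
    \<open>dual_section\<close>.\<close>
  have "represents_class
      UNIV trivial_act counit_dual uea_dual (yoneda_map restrict_aug)
      (ext_carrier aug_dual) (ext_bracket aug_dual_act (alpha f)) (yoneda_act uea_dual_act) snd f"
    by (rule yoneda_represents_class[OF se assms alpha_lift_C2])
      (fact restrict_alpha_lift ce_d2_alpha_lift dual_section)+
  then show ?thesis
    by (intro conjI alpha_Z2 counit_dual_short_exact yoneda_crossed_extension[OF se alpha_Z2])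
qed

end
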